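(* Let $u$ be a nonconstant inner function, $\alpha\in\mathbb{T}$, and let $A$ be a closed densely defined self-adjoint operator in $K_u$ that commutes with $S_u^\alpha$, written $A=\Phi(S_u^\alpha)$ with $\Phi$ a real-valued measurable function on $\mathbb{T}$. Then: (1) $\Phi(S_u^\alpha)$ has a bounded inverse if and only if $0\notin\Phi_{ess}(\mathbb{T})$. In that case, the inverse of $\Phi(S_u^\alpha)$ is $\Psi(S_u^\alpha)$, where $\Psi:\mathbb{T}\to\mathbb{R}$ is defined by $\Psi(s)=\frac{1}{\Phi(s)}$ if $\Phi(s)\neq0$ and $\Psi(s)=0$ otherwise. (2) The eigenvalues of $\Phi(S_u^\alpha)$ are the $\lambda\in\mathbb{R}$ such that $\mu_\alpha(\Phi^{-1}(\{\lambda\}))>0$, and the corresponding eigenspace is $\{V_\alpha f: f\in L^2(\mathbb{T},\mu_\alpha),\ f|_{\{\Phi\neq\lambda\}}=0\}$.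
   Context: $H^2$ is the Hardy space on the unit disk $\mathbb{D}$ (functions identified with boundary values on the circle $\mathbb{T}$). For a nonconstant inner function $u$, $K_u=H^2\ominus uH^2$, $P_u$ is the orthogonal projection of $L^2(\mathbb{T})$ onto $K_u$, and $S_uf=P_u(zf)$ on $K_u$. With $k_0^u=1-\overline{u(0)}u$, $\widetilde{k_0^u}(z)=\frac{u(z)-u(0)}{z}$ and $(x\otimes y)h=\langle h,y\rangle x$, for $\alpha\in\mathbb{T}$ put $S_u^\alpha=S_u+\frac{\alpha}{1-\alpha\overline{u(0)}}\,k_0^u\otimes\widetilde{k_0^u}$, a unitary operator. A closed densely defined operator $A$ commutes with a bounded operator $B$ if $B\mathcal{D}(A)\subset\mathcal{D}(A)$ and $BAf=ABf$ for all $f\in\mathcal{D}(A)$. An operator $A$ on a Hilbert space $\mathcal{H}$ has a bounded inverse if there is a bounded operator $A^{-1}$ on $\mathcal{H}$ with $AA^{-1}=I$ on $\mathcal{H}$ and $A^{-1}A=I$ on $\mathcal{D}(A)$, with $A^{-1}(\mathcal{D}(A))\subset\mathcal{D}(A)$. The Clark measure $\mu_\alpha$ is the finite positive Borel measure on $\mathbb{T}$ with $\operatorname{Re}\frac{1+\overline\alpha u(z)}{1-\overline\alpha u(z)}=\int_{\mathbb{T}}\operatorname{Re}\frac{\zeta+z}{\zeta-z}\,d\mu_\alpha(\zeta)$, $z\in\mathbb{D}$; $V_\alpha:L^2(\mu_\alpha)\to K_u$, $(V_\alpha f)(z)=(1-\overline\alpha u(z))\int\frac{f(\zeta)}{1-\overline\zeta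 z}d\mu_\alpha(\zeta)$, is unitary and $S_u^\alpha=V_\alpha M_\zeta V_\alpha^{-1}$, with $M_\zeta$ multiplication by the independent variable. For measurable $\Phi:\mathbb{T}\to\mathbb{C}$, $M_\Phi f=\Phi f$ on $\mathcal{D}(M_\Phi)=\{f\in L^2(\mu_\alpha):\Phi f\in L^2(\mu_\alpha)\}$, and $\Phi(S_u^\alpha)=V_\alpha M_\Phi V_\alpha^{-1}$ with domain $\{f\in K_u: V_\alpha^{-1}f\in\mathcal{D}(M_\Phi)\}$. Closed densely defined self-adjoint operators commuting with $S_u^\alpha$ are of this form with $\Phi$ real-valued. The essential range is $\Phi_{ess}(\mathbb{T})=\{\lambda\in\mathbb{C}:\forall\varepsilon>0,\ \mu_\alpha(\{s\in\mathbb{T}:|\Phi(s)-\lambda|<\varepsilon\})>0\}$. The condition $f|_{\{\Phi\neq\lambda\}}=0$ is understood $\mu_\alpha$-a.e. *)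

theory Defs
  imports "HOL-Complex_Analysis.Complex_Analysis"
begin

section \<open>Square-integrable functions and the circle\<close>

text \<open>Elements of \<open>L\<^sup>2(M)\<close> are represented by functions; two functions represent the same
  element iff they agree almost everywhere.\<close>

definition L2 :: "'a measure \<Rightarrow> ('a \<Rightarrow> complex) set" where
  "L2 M = {f \<in> borel_measurable M. integrable M (\<lambda>x. (cmod (f x))\<^sup>2)}"

definition L2_inner :: "'a measure \<Rightarrow> ('a \<Rightarrow> complex) \<Rightarrow> ('a \<Rightarrow> complex) \<Rightarrow> complex" where
  "L2_inner M f g = (LINT x|M. f x * cnj (g x))"

abbreviation borel_circle :: "complex measure" where
  "borel_circle \<equiv> restrict_space borel (sphere 0 1)"

text \<open>Normalised Lebesgue measure on the circle.\<close>

definition circle_measure :: "complex measure" where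
  "circle_measure = distr (uniform_measure lborel {0..<2 * pi}) borel_circle cis"

section \<open>The Hardy space and the model space\<close>

text \<open>An element of the Hardy space is a holomorphic function on the unit disk, extended by \<open>0\<close> to
  the rest of the plane, so that equality of elements is equality of functions.\<close>

definition on_disk :: "(complex \<Rightarrow> complex) \<Rightarrow> complex \<Rightarrow> complex" where
  "on_disk f = (\<lambda>z. if z \<in> ball 0 1 then f z else 0)"

definition taylor_coeff :: "(complex \<Rightarrow> complex) \<Rightarrow> nat \<Rightarrow> complex" where
  "taylor_coeff f n = (deriv ^^ n) f 0 / fact n"

definition H2 :: "(complex \<Rightarrow> complex) set" where
  "H2 = {f. f holomorphic_on ball 0 1 \<and> (\<forall>z. z \<notin> ball 0 1 \<longrightarrow> f z = 0) \<and>
            summable (\<lambda>n. (cmod (taylor_coeff f n))\<^sup>2)}"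

text \<open>By Parseval's identity this is the inner product of the boundary values in \<open>L\<^sup>2\<close> of the
  circle.\<close>

definition H2_inner :: "(complex \<Rightarrow> complex) \<Rightarrow> (complex \<Rightarrow> complex) \<Rightarrow> complex" where
  "H2_inner f g = (\<Sum>n. taylor_coeff f n * cnj (taylor_coeff g n))"

definition H2_norm :: "(complex \<Rightarrow> complex) \<Rightarrow> real" where
  "H2_norm f = sqrt (Re (H2_inner f f))"

text \<open>The radial limit; it exists at almost every point of the circle when \<open>f\<close> is in \<open>H2\<close>.\<close>

definition boundary_value :: "(complex \<Rightarrow> complex) \<Rightarrow> complex \<Rightarrow> complex" where
  "boundary_value f \<zeta> = Lim (at_left 1) (\<lambda>r::real. f (complex_of_real r * \<zeta>))"

definition inner_function :: "(complex \<Rightarrow> complex) \<Rightarrow> bool" where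
  "inner_function u \<longleftrightarrow>
     u holomorphic_on ball 0 1 \<and> bounded (u ` ball 0 1) \<and>
     (AE \<zeta> in circle_measure. \<exists>w. cmod w = 1 \<and>
        ((\<lambda>r::real. u (complex_of_real r * \<zeta>)) \<longlongrightarrow> w) (at_left 1))"

definition model_space :: "(complex \<Rightarrow> complex) \<Rightarrow> (complex \<Rightarrow> complex) set" where
  "model_space u = {f \<in> H2. \<forall>h \<in> H2. H2_inner f (\<lambda>z. u z * h z) = 0}"

text \<open>The orthogonal projection of \<open>L\<^sup>2\<close> of the circle onto \<open>model_space u\<close>, whose elements are
  identified with their boundary values.\<close>

definition model_proj :: "(complex \<Rightarrow> complex) \<Rightarrow> (complex \<Rightarrow> complex) \<Rightarrow> complex \<Rightarrow> complex" where
  "model_proj u h = (THE g. g \<in> model_space u \<and>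
     (\<forall>k \<in> model_space u.
        L2_inner circle_measure (\<lambda>\<zeta>. h \<zeta> - boundary_value g \<zeta>) (boundary_value k) = 0))"

section \<open>Operators\<close>

text \<open>A possibly unbounded operator is a partial function: \<open>dom A\<close> is its domain, equality of
  operators includes equality of their domains, and \<open>\<circ>\<^sub>m\<close> is the product of operators on its natural
  domain. In the definitions below, \<open>H\<close> is a closed subspace of \<open>H2\<close>.\<close>

type_synonym operator = "(complex \<Rightarrow> complex) \<rightharpoonup> (complex \<Rightarrow> complex)"

definition appl :: "operator \<Rightarrow> (complex \<Rightarrow> complex) \<Rightarrow> complex \<Rightarrow> complex" where
  "appl A f = the (A f)"

definition linear_operator :: "(complex \<Rightarrow> complex) set \<Rightarrow> operator \<Rightarrow> bool" where
  "linear_operator H A \<longleftrightarrow>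
     dom A \<subseteq> H \<and> ran A \<subseteq> H \<and> (\<lambda>z. 0) \<in> dom A \<and>
     (\<forall>f \<in> dom A. \<forall>g \<in> dom A. (\<lambda>z. f z + g z) \<in> dom A \<and>
        appl A (\<lambda>z. f z + g z) = (\<lambda>z. appl A f z + appl A g z)) \<and>
     (\<forall>c. \<forall>f \<in> dom A. (\<lambda>z. c * f z) \<in> dom A \<and>
        appl A (\<lambda>z. c * f z) = (\<lambda>z. c * appl A f z))"

definition densely_defined :: "(complex \<Rightarrow> complex) set \<Rightarrow> operator \<Rightarrow> bool" where
  "densely_defined H A \<longleftrightarrow>
     (\<forall>f \<in> H. \<forall>\<epsilon> > 0. \<exists>g \<in> dom A. H2_norm (\<lambda>z. f z - g z) < \<epsilon>)"

definition closed_operator :: "(complex \<Rightarrow> complex) set \<Rightarrow> operator \<Rightarrow> bool" where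
  "closed_operator H A \<longleftrightarrow>
     (\<forall>F f g. range F \<subseteq> dom A \<and> f \<in> H \<and> g \<in> H \<and>
        (\<lambda>n::nat. H2_norm (\<lambda>z. F n z - f z)) \<longlonglongrightarrow> 0 \<and>
        (\<lambda>n. H2_norm (\<lambda>z. appl A (F n) z - g z)) \<longlonglongrightarrow> 0
        \<longrightarrow> A f = Some g)"

definition adjoint_operator :: "(complex \<Rightarrow> complex) set \<Rightarrow> operator \<Rightarrow> operator" where
  "adjoint_operator H A = (\<lambda>g.
     let Q = (\<lambda>h. h \<in> H \<and> (\<forall>f \<in> dom A. H2_inner (appl A f) g = H2_inner f h))
     in if g \<in> H \<and> (\<exists>h. Q h) then Some (THE h. Q h) else None)"

definition self_adjoint :: "(complex \<Rightarrow> complex) set \<Rightarrow> operator \<Rightarrow> bool" where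
  "self_adjoint H A \<longleftrightarrow> adjoint_operator H A = A"

definition bounded_operator :: "(complex \<Rightarrow> complex) set \<Rightarrow> operator \<Rightarrow> bool" where
  "bounded_operator H B \<longleftrightarrow>
     linear_operator H B \<and> dom B = H \<and> (\<exists>C. \<forall>f \<in> H. H2_norm (appl B f) \<le> C * H2_norm f)"

definition commutes_with :: "operator \<Rightarrow> operator \<Rightarrow> bool" where
  "commutes_with A B \<longleftrightarrow>
     (\<forall>f \<in> dom A. appl B f \<in> dom A \<and> appl B (appl A f) = appl A (appl B f))"

definition is_bounded_inverse :: "(complex \<Rightarrow> complex) set \<Rightarrow> operator \<Rightarrow> operator \<Rightarrow> bool" where
  "is_bounded_inverse H A B \<longleftrightarrow>
     bounded_operator H B \<and> A \<circ>\<^sub>m B = Some |` H \<and> B \<circ>\<^sub>m A = Some |` dom A \<and>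
     (\<forall>f \<in> dom A. appl B f \<in> dom A)"

definition has_bounded_inverse :: "(complex \<Rightarrow> complex) set \<Rightarrow> operator \<Rightarrow> bool" where
  "has_bounded_inverse H A \<longleftrightarrow> (\<exists>B. is_bounded_inverse H A B)"

definition eigenspace :: "operator \<Rightarrow> complex \<Rightarrow> (complex \<Rightarrow> complex) set" where
  "eigenspace A c = {f \<in> dom A. appl A f = (\<lambda>z. c * f z)}"

definition eigenvalues :: "operator \<Rightarrow> complex set" where
  "eigenvalues A = {c. \<exists>f \<in> eigenspace A c. f \<noteq> (\<lambda>z. 0)}"

section \<open>Unitary perturbations of the compressed shift\<close>

definition compressed_shift :: "(complex \<Rightarrow> complex) \<Rightarrow> (complex \<Rightarrow> complex) \<Rightarrow> complex \<Rightarrow> complex" where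
  "compressed_shift u f = model_proj u (\<lambda>\<zeta>. \<zeta> * boundary_value f \<zeta>)"

definition kernel_zero :: "(complex \<Rightarrow> complex) \<Rightarrow> complex \<Rightarrow> complex" where
  "kernel_zero u = on_disk (\<lambda>z. 1 - cnj (u 0) * u z)"

text \<open>The difference quotient has a removable singularity at \<open>0\<close>.\<close>

definition conj_kernel_zero :: "(complex \<Rightarrow> complex) \<Rightarrow> complex \<Rightarrow> complex" where
  "conj_kernel_zero u = on_disk (\<lambda>z. if z = 0 then deriv u 0 else (u z - u 0) / z)"

definition clark_unitary :: "(complex \<Rightarrow> complex) \<Rightarrow> complex \<Rightarrow> operator" where
  "clark_unitary u \<alpha> = (\<lambda>f. if f \<in> model_space u
     then Some (\<lambda>z. compressed_shift u f z
       + \<alpha> / (1 - \<alpha> * cnj (u 0)) * (H2_inner f (conj_kernel_zero u) * kernel_zero u z))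
     else None)"

section \<open>Clark measures and the functional calculus\<close>

definition clark_measure :: "(complex \<Rightarrow> complex) \<Rightarrow> complex \<Rightarrow> complex measure \<Rightarrow> bool" where
  "clark_measure u \<alpha> \<mu> \<longleftrightarrow>
     finite_measure \<mu> \<and> sets \<mu> = sets borel_circle \<and>
     (\<forall>z \<in> ball 0 1. Re ((1 + cnj \<alpha> * u z) / (1 - cnj \<alpha> * u z))
                      = (LINT \<zeta>|\<mu>. Re ((\<zeta> + z) / (\<zeta> - z))))"

definition clark_transform ::
  "(complex \<Rightarrow> complex) \<Rightarrow> complex \<Rightarrow> complex measure \<Rightarrow> (complex \<Rightarrow> complex) \<Rightarrow> complex \<Rightarrow> complex" where
  "clark_transform u \<alpha> \<mu> f =
     on_disk (\<lambda>z. (1 - cnj \<alpha> * u z) * (LINT \<zeta>|\<mu>. f \<zeta> / (1 - cnj \<zeta> * z)))"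

definition mult_operator :: "complex measure \<Rightarrow> (complex \<Rightarrow> complex) \<Rightarrow> operator" where
  "mult_operator \<mu> \<Phi> = (\<lambda>f. if f \<in> L2 \<mu> \<and> (\<lambda>\<zeta>. \<Phi> \<zeta> * f \<zeta>) \<in> L2 \<mu>
     then Some (\<lambda>\<zeta>. \<Phi> \<zeta> * f \<zeta>) else None)"

text \<open>\<open>inv_into\<close> picks one representative of the class \<open>V\<^sup>-\<^sup>1 g\<close> in \<open>L\<^sup>2(\<mu>)\<close>; the result does not
  depend on the choice.\<close>

definition clark_calculus ::
  "(complex \<Rightarrow> complex) \<Rightarrow> complex \<Rightarrow> complex measure \<Rightarrow> (complex \<Rightarrow> complex) \<Rightarrow> operator" where
  "clark_calculus u \<alpha> \<mu> \<Phi> = (\<lambda>g. if g \<in> model_space u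
     then map_option (clark_transform u \<alpha> \<mu>)
            (mult_operator \<mu> \<Phi> (inv_into (L2 \<mu>) (clark_transform u \<alpha> \<mu>) g))
     else None)"

definition essential_range :: "complex measure \<Rightarrow> (complex \<Rightarrow> complex) \<Rightarrow> complex set" where
  "essential_range \<mu> \<Phi> =
     {c. \<forall>\<epsilon> > 0. measure \<mu> {s \<in> sphere 0 1. cmod (\<Phi> s - c) < \<epsilon>} > 0}"

end

theory Submission
  imports Defs
begin

text \<open>The Clark transform \<open>V\<close> is unitary and turns the operator into multiplication by \<open>\<Phi>\<close>.
  The Herglotz representation gives the Gram matrix of the Cauchy kernels in
  \<open>L\<^sup>2(\<mu>)\<close>, and it agrees with that of the rescaled reproducing kernels of the model space; hence \<open>V\<close> is
  isometric on the span of the Cauchy kernels and, by projecting onto this span, maps \<open>L\<^sup>2(\<mu>)\<close> onto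
  the model space. If \<open>V f = 0\<close>, then \<open>V (\<zeta> f)\<close> is a constant multiple of \<open>1 - cnj \<alpha> * u\<close>, and a nonzero
  multiple of this function is not in the model space. So the kernel of \<open>V\<close> is invariant under
  multiplication by trigonometric polynomials, while its elements have integral zero; it is therefore
  trivial, and the Cauchy kernels are complete.\<close>

subsection \<open>Square-integrable functions\<close>

text \<open>The obstacle is a circularity. That \<open>V\<close> preserves norms on all of
  \<open>L2 \<mu>\<close> amounts to completeness of the Cauchy kernels, yet the argument for
  completeness needs \<open>V (\<lambda>\<zeta>. \<zeta> * f \<zeta>)\<close> to lie in the model
  space before completeness is known. The way out is that \<open>V f z\<close> sees \<open>f\<close>
  only through its inner product with one Cauchy kernel, so \<open>f\<close> and its projection onto
  the closed span have the same transform.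

  An inner function is given as a bounded holomorphic function with unimodular radial limits, so
  even \<open>cmod (u z) \<le> 1\<close> has to be derived. This is done on circles of radius below
  1: Parseval's identity there and dominated convergence make multiplication by \<open>u\<close>
  isometric, and the bound follows by testing on Szego kernels. Only the radial limits of
  \<open>u\<close> itself enter.

  Elements of \<open>L2\<close> are functions, so \<open>L2_norm\<close> is a seminorm and
  uniqueness holds almost everywhere. Hardy functions are handled through their Taylor
  coefficients.\<close>

definition L2_norm :: "'a measure \<Rightarrow> ('a \<Rightarrow> complex) \<Rightarrow> real" where
  "L2_norm M f = sqrt (LINT x|M. (cmod (f x))\<^sup>2)"

lemma L2_measurable [measurable_dest]: "f \<in> L2 M \<Longrightarrow> f \<in> borel_measurable M"
  by (simp add: L2_def)

lemma L2_integrable_square: "f \<in> L2 M \<Longrightarrow> integrable M (\<lambda>x. (cmod (f x))\<^sup>2)"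
  by (simp add: L2_def)

lemma cmod_add_square_le: "(cmod (a + b))\<^sup>2 \<le> 2 * (cmod a)\<^sup>2 + 2 * (cmod b)\<^sup>2"
proof -
  have "(cmod (a + b))\<^sup>2 \<le> (cmod a + cmod b)\<^sup>2"
    by (simp add: norm_triangle_ineq power_mono)
  also have "\<dots> \<le> 2 * (cmod a)\<^sup>2 + 2 * (cmod b)\<^sup>2"
    using sum_squares_bound[of "cmod a" "cmod b"] by (simp add: power2_sum)
  finally show ?thesis .
qed

lemma L2_bounded_by:
  assumes "f \<in> borel_measurable M" "integrable M g" "AE x in M. (cmod (f x))\<^sup>2 \<le> g x"
  shows "f \<in> L2 M"
  using assms unfolding L2_def
  by (auto intro!: Bochner_Integration.integrable_bound[OF assms(2)])

lemma L2_zero [simp]: "(\<lambda>x. 0) \<in> L2 M"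
  by (simp add: L2_def)

lemma L2_add:
  assumes "f \<in> L2 M" "g \<in> L2 M" shows "(\<lambda>x. f x + g x) \<in> L2 M"
proof (rule L2_bounded_by)
  show "(\<lambda>x. f x + g x) \<in> borel_measurable M" using assms by measurable
  show "integrable M (\<lambda>x. 2 * (cmod (f x))\<^sup>2 + 2 * (cmod (g x))\<^sup>2)"
    using assms by (auto intro!: L2_integrable_square)
qed (simp add: cmod_add_square_le)

lemma L2_cmult: "f \<in> L2 M \<Longrightarrow> (\<lambda>x. c * f x) \<in> L2 M"
  by (auto simp: L2_def norm_mult power_mult_distrib)

lemma L2_minus: "f \<in> L2 M \<Longrightarrow> (\<lambda>x. - f x) \<in> L2 M"
  by (auto simp: L2_def)

lemma L2_diff:
  assumes "f \<in> L2 M" "g \<in> L2 M" shows "(\<lambda>x. f x - g x) \<in> L2 M"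
  using L2_add[OF assms(1) L2_minus[OF assms(2)]] by simp

lemma cnj_measurable [measurable]: "cnj \<in> borel_measurable borel"
  by (intro borel_measurable_continuous_onI continuous_intros)

lemma L2_inner_integrable:
  assumes "f \<in> L2 M" "g \<in> L2 M" shows "integrable M (\<lambda>x. f x * cnj (g x))"
proof (rule Bochner_Integration.integrable_bound)
  show "integrable M (\<lambda>x. (cmod (f x))\<^sup>2 + (cmod (g x))\<^sup>2)"
    using assms by (auto intro!: L2_integrable_square)
  show "(\<lambda>x. f x * cnj (g x)) \<in> borel_measurable M" using assms by measurable
  have "cmod a * cmod b \<le> \<bar>(cmod a)\<^sup>2 + (cmod b)\<^sup>2\<bar>" for a b
    using sum_squares_bound[of "cmod a" "cmod b"] mult_nonneg_nonneg[of "cmod a" "cmod b"]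
    using norm_ge_zero[of a] norm_ge_zero[of b] by linarith
  then show "AE x in M. norm (f x * cnj (g x)) \<le> norm ((cmod (f x))\<^sup>2 + (cmod (g x))\<^sup>2)"
    by (simp add: norm_mult)
qed

lemma L2_inner_add_left:
  "f \<in> L2 M \<Longrightarrow> g \<in> L2 M \<Longrightarrow> h \<in> L2 M \<Longrightarrow>
    L2_inner M (\<lambda>x. f x + g x) h = L2_inner M f h + L2_inner M g h"
  by (simp add: L2_inner_def distrib_right L2_inner_integrable)

lemma L2_inner_diff_left:
  "f \<in> L2 M \<Longrightarrow> g \<in> L2 M \<Longrightarrow> h \<in> L2 M \<Longrightarrow>
    L2_inner M (\<lambda>x. f x - g x) h = L2_inner M f h - L2_inner M g h"
  by (simp add: L2_inner_def left_diff_distrib L2_inner_integrable)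

lemma L2_inner_cmult_left: "L2_inner M (\<lambda>x. c * f x) h = c * L2_inner M f h"
  by (simp add: L2_inner_def mult.assoc)

lemma L2_inner_cnj: "L2_inner M g f = cnj (L2_inner M f g)"
  unfolding L2_inner_def by (simp add: mult.commute flip: Bochner_Integration.integral_cnj)

lemma L2_inner_cmult_right: "L2_inner M f (\<lambda>x. c * h x) = cnj c * L2_inner M f h"
  by (subst (1 2) L2_inner_cnj) (simp add: L2_inner_cmult_left)

lemma L2_inner_add_right:
  "f \<in> L2 M \<Longrightarrow> g \<in> L2 M \<Longrightarrow> h \<in> L2 M \<Longrightarrow>
    L2_inner M h (\<lambda>x. f x + g x) = L2_inner M h f + L2_inner M h g"
  by (subst (1 2 3) L2_inner_cnj) (simp add: L2_inner_add_left)

section \<open>The seminorm and the Cauchy-Schwarz inequality\<close>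

lemma L2_norm_nonneg [simp]: "0 \<le> L2_norm M f"
  by (simp add: L2_norm_def)

lemma L2_norm_square: "(L2_norm M f)\<^sup>2 = (LINT x|M. (cmod (f x))\<^sup>2)"
  by (simp add: L2_norm_def)

lemma L2_inner_self: "L2_inner M f f = complex_of_real ((L2_norm M f)\<^sup>2)"
  unfolding L2_norm_square L2_inner_def
  by (subst integral_complex_of_real [symmetric]) (simp add: complex_norm_square del: of_real_power)

lemma L2_norm_eq_sqrt_inner: "L2_norm M f = sqrt (Re (L2_inner M f f))"
  by (simp add: L2_inner_self)

lemma L2_norm_cmult: "L2_norm M (\<lambda>x. c * f x) = cmod c * L2_norm M f"
  by (simp add: L2_norm_def norm_mult power_mult_distrib real_sqrt_mult)

lemma L2_norm_diff_commute: "L2_norm M (\<lambda>x. f x - g x) = L2_norm M (\<lambda>x. g x - f x)"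
  by (simp add: L2_norm_def norm_minus_commute)

lemma L2_norm_add_square:
  assumes "f \<in> L2 M" "g \<in> L2 M"
  shows "(L2_norm M (\<lambda>x. f x + g x))\<^sup>2
    = (L2_norm M f)\<^sup>2 + 2 * Re (L2_inner M f g) + (L2_norm M g)\<^sup>2"
proof -
  have "L2_inner M (\<lambda>x. f x + g x) (\<lambda>x. f x + g x)
      = L2_inner M f f + L2_inner M f g + (cnj (L2_inner M f g) + L2_inner M g g)"
    using assms by (simp add: L2_inner_add_left L2_inner_add_right L2_add flip: L2_inner_cnj)
  then have "Re (L2_inner M (\<lambda>x. f x + g x) (\<lambda>x. f x + g x))
      = Re (L2_inner M f f) + 2 * Re (L2_inner M f g) + Re (L2_inner M g g)"
    by simp
  then show ?thesis by (simp add: L2_inner_self)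
qed

lemma L2_norm_diff_square:
  assumes "f \<in> L2 M" "g \<in> L2 M"
  shows "(L2_norm M (\<lambda>x. f x - g x))\<^sup>2
    = (L2_norm M f)\<^sup>2 - 2 * Re (L2_inner M f g) + (L2_norm M g)\<^sup>2"
  using L2_norm_add_square[OF assms(1) L2_minus[OF assms(2)]] L2_inner_cmult_right[of M f "-1" g]
    L2_norm_cmult[of M "-1" g] by simp

text \<open>Since \<open>L2_norm M g = 0\<close> does not make \<open>g\<close> the zero function,
  this case is treated apart. Both cases rest on one quadratic inequality in a real parameter,
  obtained by subtracting \<open>(t * c) * g\<close> from \<open>f\<close>.\<close>

lemma L2_Cauchy_Schwarz:
  assumes "f \<in> L2 M" "g \<in> L2 M"
  shows "cmod (L2_inner M f g) \<le> L2_norm M f * L2_norm M g"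
proof -
  define c where "c = L2_inner M f g"
  have key: "0 \<le> (L2_norm M f)\<^sup>2 - 2 * t * (cmod c)\<^sup>2 + t\<^sup>2 * (cmod c)\<^sup>2 * (L2_norm M g)\<^sup>2" for t :: real
  proof -
    have "0 \<le> (L2_norm M (\<lambda>x. f x - (t * c) * g x))\<^sup>2" by simp
    also have "\<dots> = (L2_norm M f)\<^sup>2 - 2 * Re (L2_inner M f (\<lambda>x. (t * c) * g x)) + (L2_norm M (\<lambda>x. (t * c) * g x))\<^sup>2"
      using assms by (intro L2_norm_diff_square L2_cmult)
    also have "L2_inner M f (\<lambda>x. (t * c) * g x) = complex_of_real (t * (cmod c)\<^sup>2)"
      by (simp only: L2_inner_cmult_right) (simp add: c_def complex_norm_square mult_ac del: of_real_power)
    also have "L2_norm M (\<lambda>x. (t * c) * g x) = \<bar>t\<bar> * cmod c * L2_norm M g"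
      by (simp add: L2_norm_cmult norm_mult)
    finally show ?thesis by (simp add: power_mult_distrib mult.assoc)
  qed
  show ?thesis
  proof (cases "L2_norm M g = 0")
    case True
    have "cmod c = 0"
    proof (rule ccontr)
      assume "cmod c \<noteq> 0"
      then have "(cmod c)\<^sup>2 > 0" by simp
      \<comment> \<open>If \<open>g\<close> has norm 0, the bound in \<open>key\<close> is linear in
        \<open>t\<close>; this value makes it equal to -1.\<close>
      with key[of "((L2_norm M f)\<^sup>2 + 1) / (2 * (cmod c)\<^sup>2)"] True show False by simp
    qed
    then show ?thesis using True by (simp add: c_def)
  next
    case False
    then have pos: "(L2_norm M g)\<^sup>2 > 0" by simp
    \<comment> \<open>The quadratic in \<open>key\<close> is smallest at
      \<open>t = 1 / (L2_norm M g)\<^sup>2\<close>.\<close>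
    have "0 \<le> (L2_norm M f)\<^sup>2 - (cmod c)\<^sup>2 / (L2_norm M g)\<^sup>2"
      using key[of "1 / (L2_norm M g)\<^sup>2"] pos
      by (simp add: power2_eq_square[of "1 / (L2_norm M g)\<^sup>2"] power_one_over) (simp add: power4_eq_xxxx power2_eq_square)
    then have "(cmod c)\<^sup>2 \<le> (L2_norm M f * L2_norm M g)\<^sup>2"
      using pos by (simp add: field_simps power_mult_distrib)
    then show ?thesis unfolding c_def by (rule power2_le_imp_le) simp
  qed
qed

lemma L2_norm_triangle:
  assumes "f \<in> L2 M" "g \<in> L2 M"
  shows "L2_norm M (\<lambda>x. f x + g x) \<le> L2_norm M f + L2_norm M g"
proof (rule power2_le_imp_le)
  have "Re (L2_inner M f g) \<le> L2_norm M f * L2_norm M g"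
    using L2_Cauchy_Schwarz[OF assms] complex_Re_le_cmod[of "L2_inner M f g"] by linarith
  then show "(L2_norm M (\<lambda>x. f x + g x))\<^sup>2 \<le> (L2_norm M f + L2_norm M g)\<^sup>2"
    by (simp add: L2_norm_add_square[OF assms] power2_sum)
qed simp

lemma L2_norm_triangle_diff:
  assumes "f \<in> L2 M" "g \<in> L2 M" "h \<in> L2 M"
  shows "L2_norm M (\<lambda>x. f x - h x) \<le> L2_norm M (\<lambda>x. f x - g x) + L2_norm M (\<lambda>x. g x - h x)"
  using L2_norm_triangle[of "\<lambda>x. f x - g x" M "\<lambda>x. g x - h x"] assms by (simp add: L2_diff)

lemma L2_norm_le_add_diff:
  assumes "f \<in> L2 M" "g \<in> L2 M"
  shows "\<bar>L2_norm M f - L2_norm M g\<bar> \<le> L2_norm M (\<lambda>x. f x - g x)"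
  using L2_norm_triangle_diff[of f M g "\<lambda>x. 0"] L2_norm_triangle_diff[of g M f "\<lambda>x. 0"] assms
    L2_norm_diff_commute[of M f g] by auto

lemma L2_inner_tendsto:
  assumes "\<And>n. F n \<in> L2 M" "f \<in> L2 M" "h \<in> L2 M" "(\<lambda>n. L2_norm M (\<lambda>x. F n x - f x)) \<longlonglongrightarrow> 0"
  shows "(\<lambda>n. L2_inner M (F n) h) \<longlonglongrightarrow> L2_inner M f h"
proof -
  have "(\<lambda>n. L2_norm M (\<lambda>x. F n x - f x) * L2_norm M h) \<longlonglongrightarrow> 0"
    by (rule tendsto_mult_left_zero) fact
  then have "(\<lambda>n. L2_inner M (F n) h - L2_inner M f h) \<longlonglongrightarrow> 0"
  proof (rule Lim_null_comparison[rotated], intro always_eventually allI)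
    fix n show "norm (L2_inner M (F n) h - L2_inner M f h) \<le> L2_norm M (\<lambda>x. F n x - f x) * L2_norm M h"
      using L2_Cauchy_Schwarz[of "\<lambda>x. F n x - f x" M h] assms by (simp add: L2_inner_diff_left L2_diff)
  qed
  then show ?thesis by (simp add: LIM_zero_iff)
qed

lemma L2_norm_tendsto:
  assumes "\<And>n. F n \<in> L2 M" "f \<in> L2 M" "(\<lambda>n. L2_norm M (\<lambda>x. F n x - f x)) \<longlonglongrightarrow> 0"
  shows "(\<lambda>n. L2_norm M (F n)) \<longlonglongrightarrow> L2_norm M f"
proof -
  have "(\<lambda>n. L2_norm M (F n) - L2_norm M f) \<longlonglongrightarrow> 0"
    by (rule Lim_null_comparison[OF _ assms(3)]) (use assms in \<open>simp add: L2_norm_le_add_diff\<close>)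
  then show ?thesis by (simp add: LIM_zero_iff)
qed

lemma L2_norm_square_nn_integral:
  assumes "f \<in> L2 M"
  shows "(\<integral>\<^sup>+ x. ennreal ((cmod (f x))\<^sup>2) \<partial>M) = ennreal ((L2_norm M f)\<^sup>2)"
  unfolding L2_norm_square by (rule nn_integral_eq_integral) (use assms L2_integrable_square in auto)

section \<open>Completeness and orthogonal projection\<close>

definition L2_Cauchy :: "'a measure \<Rightarrow> (nat \<Rightarrow> 'a \<Rightarrow> complex) \<Rightarrow> bool" where
  "L2_Cauchy M F \<longleftrightarrow> (\<forall>e>0. \<exists>N. \<forall>m\<ge>N. \<forall>n\<ge>N. L2_norm M (\<lambda>x. F m x - F n x) < e)"

lemma L2_Cauchy_convergent:
  assumes "\<And>n. F n \<in> L2 M" "f \<in> L2 M" "(\<lambda>n. L2_norm M (\<lambda>x. F n x - f x)) \<longlonglongrightarrow> 0"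
  shows "L2_Cauchy M F"
  unfolding L2_Cauchy_def
proof (intro allI impI)
  fix e :: real assume "e > 0"
  then have "\<forall>\<^sub>F n in sequentially. L2_norm M (\<lambda>x. F n x - f x) < e / 2"
    using order_tendstoD(2)[OF assms(3), of "e / 2"] by simp
  then obtain N where N: "\<And>n. n \<ge> N \<Longrightarrow> L2_norm M (\<lambda>x. F n x - f x) < e / 2"
    by (auto simp: eventually_sequentially)
  have "L2_norm M (\<lambda>x. F m x - F n x) < e" if "m \<ge> N" "n \<ge> N" for m n
    using N[OF that(1)] N[OF that(2)] L2_norm_triangle_diff[of "F m" M f "F n"] assms
    by (simp add: L2_norm_diff_commute[of M f])
  then show "\<exists>N. \<forall>m\<ge>N. \<forall>n\<ge>N. L2_norm M (\<lambda>x. F m x - F n x) < e" by blast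
qed

text \<open>An almost everywhere convergent subsequence supplies the limit function, and Fatou's
  lemma turns the Cauchy bound along the subsequence into a bound on the distance to that
  limit.\<close>

theorem L2_complete:
  fixes F :: "nat \<Rightarrow> 'a \<Rightarrow> complex"
  assumes F: "\<And>n. F n \<in> L2 M" and cau: "L2_Cauchy M F"
  obtains f where "f \<in> L2 M" "(\<lambda>n. L2_norm M (\<lambda>x. F n x - f x)) \<longlonglongrightarrow> 0"
proof -
  have [measurable]: "F n \<in> borel_measurable M" for n using F by measurable
  have "\<exists>N. \<forall>m\<ge>N. \<forall>n\<ge>N. L2_norm M (\<lambda>x. F m x - F n x) < (1/2)^k" for k :: nat
    using cau by (simp add: L2_Cauchy_def)
  then obtain N where N: "\<And>k m n. m \<ge> N k \<Longrightarrow> n \<ge> N k \<Longrightarrow> L2_norm M (\<lambda>x. F m x - F n x) < (1/2)^k"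
    by metis
  \<comment> \<open>The maximum makes \<open>r j\<close> at least every \<open>N k\<close> with
    \<open>k \<le> j\<close>; the summand \<open>k\<close> makes \<open>r\<close> reach into every
    tail of the sequence.\<close>
  define r where "r k = Max (N ` {..k}) + k" for k
  have rN: "r j \<ge> N k" if "j \<ge> k" for j k
    using that by (auto simp: r_def intro!: trans_le_add1 Max_ge)
  have rk: "r k \<ge> k" for k by (simp add: r_def)
  define d where "d k x = F (r (Suc k)) x - F (r k) x" for k x
  have d_L2: "d k \<in> L2 M" for k unfolding d_def by (intro L2_diff F)
  have d_norm: "L2_norm M (d k) \<le> (1/2)^k" for k
    unfolding d_def using N[of k "r (Suc k)" "r k"] rN[of k "Suc k"] rN[of k k] by simp
  have [measurable]: "d k \<in> borel_measurable M" for k unfolding d_def by measurable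
  \<comment> \<open>The weights \<open>2 ^ k\<close> leave room both for summability of the integrals and for a pointwise
    geometric bound on \<open>d k\<close>, so that Minkowski's inequality for series is not needed.\<close>
  define G where "G x = (\<Sum>k. ennreal (2^k * (cmod (d k x))\<^sup>2))" for x
  have [measurable]: "G \<in> borel_measurable M" unfolding G_def by measurable
  have "(\<integral>\<^sup>+x. G x \<partial>M) = (\<Sum>k. \<integral>\<^sup>+x. ennreal (2^k * (cmod (d k x))\<^sup>2) \<partial>M)"
    unfolding G_def by (rule nn_integral_suminf) measurable
  also have "\<dots> = (\<Sum>k. ennreal (2^k * (L2_norm M (d k))\<^sup>2))"
  proof (rule suminf_cong)
    fix k
    have "(\<integral>\<^sup>+x. ennreal (2^k * (cmod (d k x))\<^sup>2) \<partial>M) = (\<integral>\<^sup>+x. ennreal (2^k) * ennreal ((cmod (d k x))\<^sup>2) \<partial>M)"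
      by (simp add: ennreal_mult)
    also have "\<dots> = ennreal (2^k) * (\<integral>\<^sup>+x. ennreal ((cmod (d k x))\<^sup>2) \<partial>M)"
      by (rule nn_integral_cmult) measurable
    also have "\<dots> = ennreal (2^k * (L2_norm M (d k))\<^sup>2)"
      by (simp add: L2_norm_square_nn_integral[OF d_L2] ennreal_mult)
    finally show "(\<integral>\<^sup>+x. ennreal (2^k * (cmod (d k x))\<^sup>2) \<partial>M) = ennreal (2^k * (L2_norm M (d k))\<^sup>2)" .
  qed
  also have "\<dots> \<le> (\<Sum>k. ennreal ((1/2)^k))"
  proof (intro suminf_le ennreal_leI)
    fix k
    have "2^k * (L2_norm M (d k))\<^sup>2 \<le> 2^k * ((1/2)^k)\<^sup>2"
      by (intro mult_left_mono power_mono d_norm) auto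
    also have "\<dots> = (1/2::real)^k" by (simp add: power2_eq_square power_one_over)
    finally show "2^k * (L2_norm M (d k))\<^sup>2 \<le> (1/2)^k" .
  qed auto
  also have "\<dots> < \<infinity>"
    by (subst suminf_ennreal2) (auto intro: summable_geometric)
  finally have "AE x in M. G x \<noteq> \<infinity>" by (intro nn_integral_PInf_AE) auto
  then have conv: "AE x in M. convergent (\<lambda>k. F (r k) x)"
  proof eventually_elim
    fix x assume "G x \<noteq> \<infinity>"
    then obtain c where c: "c \<ge> 0" "G x = ennreal c" by (cases "G x") auto
    have bd: "cmod (d k x) \<le> sqrt c * (sqrt (1/2))^k" for k
    proof -
      have "ennreal (2^k * (cmod (d k x))\<^sup>2) \<le> G x"
        unfolding G_def by (rule ennreal_suminf_lessD[THEN order.strict_implies_order]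
          order_trans[OF _ sum_le_suminf[of _ "{k}"]]) auto
      then have "2^k * (cmod (d k x))\<^sup>2 \<le> c" using c by simp
      then have "(cmod (d k x))\<^sup>2 \<le> c * (1/2)^k" by (simp add: field_simps)
      then have "sqrt ((cmod (d k x))\<^sup>2) \<le> sqrt (c * (1/2)^k)" by (rule real_sqrt_le_mono)
      then show ?thesis by (simp add: real_sqrt_mult real_sqrt_power)
    qed
    have "summable (\<lambda>k. sqrt c * (sqrt (1/2))^k)"
      by (intro summable_mult summable_geometric) (auto simp: real_sqrt_lt_1_iff)
    then have "summable (\<lambda>k. d k x)" by (rule summable_comparison_test') (use bd in auto)
    then have "convergent (\<lambda>n. \<Sum>k<n. d k x)" by (simp add: summable_iff_convergent)
    moreover have "(\<Sum>k<n. d k x) = F (r n) x - F (r 0) x" for n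
      unfolding d_def by (rule sum_lessThan_telescope)
    ultimately show "convergent (\<lambda>k. F (r k) x)"
      using convergent_diff_const_right_iff by (simp add: convergent_diff_const_right_iff)
  qed
  \<comment> \<open>Where the subsequence diverges, \<open>lim\<close> has an unspecified value, but
    such points form a null set.\<close>
  define f where "f x = lim (\<lambda>k. F (r k) x)" for x
  have [measurable]: "f \<in> borel_measurable M" unfolding f_def by (rule borel_measurable_lim_metric) measurable
  have lim: "AE x in M. (\<lambda>k. F (r k) x) \<longlonglongrightarrow> f x"
    using conv unfolding f_def by eventually_elim (simp add: convergent_LIMSEQ_iff)
  \<comment> \<open>This estimate serves twice: for membership of the limit in \<open>L2 M\<close>
    and for convergence in norm.\<close>
  have fatou: "(\<integral>\<^sup>+x. ennreal ((cmod (F m x - f x))\<^sup>2) \<partial>M) \<le> ennreal (e\<^sup>2)"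
    if e: "e > 0" and M: "\<forall>n\<ge>K. L2_norm M (\<lambda>x. F m x - F n x) < e" for e m K
  proof -
    have "(\<integral>\<^sup>+x. ennreal ((cmod (F m x - f x))\<^sup>2) \<partial>M)
        = (\<integral>\<^sup>+x. liminf (\<lambda>k. ennreal ((cmod (F m x - F (r k) x))\<^sup>2)) \<partial>M)"
    proof (rule nn_integral_cong_AE, use lim in eventually_elim)
      fix x assume "(\<lambda>k. F (r k) x) \<longlonglongrightarrow> f x"
      then have "(\<lambda>k. ennreal ((cmod (F m x - F (r k) x))\<^sup>2)) \<longlonglongrightarrow> ennreal ((cmod (F m x - f x))\<^sup>2)"
        by (intro tendsto_intros)
      from lim_imp_Liminf[OF _ this]
      show "ennreal ((cmod (F m x - f x))\<^sup>2) = liminf (\<lambda>k. ennreal ((cmod (F m x - F (r k) x))\<^sup>2))"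
        by simp
    qed
    also have "\<dots> \<le> liminf (\<lambda>k. \<integral>\<^sup>+x. ennreal ((cmod (F m x - F (r k) x))\<^sup>2) \<partial>M)"
      by (rule nn_integral_liminf) measurable
    also have "\<dots> \<le> ennreal (e\<^sup>2)"
    proof (rule order_trans[OF Liminf_le_Limsup Limsup_bounded],
        simp, unfold eventually_sequentially, intro exI allI impI)
      fix k assume "K \<le> k"
      then have "L2_norm M (\<lambda>x. F m x - F (r k) x) < e" using M rk[of k] by auto
      then have "(L2_norm M (\<lambda>x. F m x - F (r k) x))\<^sup>2 \<le> e\<^sup>2" by (intro power_mono) auto
      then show "(\<integral>\<^sup>+x. ennreal ((cmod (F m x - F (r k) x))\<^sup>2) \<partial>M) \<le> ennreal (e\<^sup>2)"
        by (simp add: L2_norm_square_nn_integral L2_diff F ennreal_leI)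
    qed
    finally show ?thesis .
  qed
  have diff_L2: "(\<lambda>x. F m x - f x) \<in> L2 M"
    if "e > 0" "\<forall>n\<ge>K. L2_norm M (\<lambda>x. F m x - F n x) < e" for e m K
    unfolding L2_def using fatou[OF that]
    by (auto intro!: integrableI_bounded simp: top_unique less_top[symmetric] elim: le_less_trans)
  obtain K1 where K1: "\<forall>m\<ge>K1. \<forall>n\<ge>K1. L2_norm M (\<lambda>x. F m x - F n x) < 1"
    using cau unfolding L2_Cauchy_def by (metis zero_less_one)
  then have "(\<lambda>x. F K1 x - f x) \<in> L2 M" using diff_L2[of 1 K1] by auto
  from L2_diff[OF F[of K1] this] have fL2: "f \<in> L2 M" by simp
  moreover have "(\<lambda>n. L2_norm M (\<lambda>x. F n x - f x)) \<longlonglongrightarrow> 0"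
  proof (rule metric_LIMSEQ_I)
    fix e :: real assume "e > 0"
    then obtain K where K: "\<forall>m\<ge>K. \<forall>n\<ge>K. L2_norm M (\<lambda>x. F m x - F n x) < e / 2"
      using cau unfolding L2_Cauchy_def by (metis half_gt_zero)
    have "L2_norm M (\<lambda>x. F m x - f x) \<le> e / 2" if "m \<ge> K" for m
    proof (rule power2_le_imp_le)
      show "(L2_norm M (\<lambda>x. F m x - f x))\<^sup>2 \<le> (e / 2)\<^sup>2"
        using fatou[of "e/2" K m] K that \<open>e > 0\<close>
        by (simp add: L2_norm_square_nn_integral L2_diff F fL2)
    qed (use \<open>e > 0\<close> in auto)
    then show "\<exists>K. \<forall>n\<ge>K. dist (L2_norm M (\<lambda>x. F n x - f x)) 0 < e"
      using \<open>e > 0\<close> by (intro exI[of _ K]) (fastforce simp: dist_real_def)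
  qed
  ultimately show ?thesis using that by blast
qed

text \<open>The projection is onto the closure of \<open>E\<close>, and membership in the closure is
  recorded by the sequence \<open>e\<close>, to which the Clark transform can later be applied term
  by term.\<close>

theorem L2_projection:
  assumes E: "E \<subseteq> L2 M" and E0: "(\<lambda>x. 0) \<in> E"
    and E_lin: "\<And>c g h. g \<in> E \<Longrightarrow> h \<in> E \<Longrightarrow> (\<lambda>x. g x + c * h x) \<in> E"
    and f: "f \<in> L2 M"
  obtains g e where "g \<in> L2 M" "\<And>n::nat. e n \<in> E"
    "(\<lambda>n. L2_norm M (\<lambda>x. e n x - g x)) \<longlonglongrightarrow> 0"
    "\<And>h. h \<in> E \<Longrightarrow> L2_inner M (\<lambda>x. f x - g x) h = 0"
proof -
  define D where "D = (\<lambda>h. (L2_norm M (\<lambda>x. f x - h x))\<^sup>2) ` E"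
  define d where "d = Inf D"
  have D0: "\<And>t. t \<in> D \<Longrightarrow> 0 \<le> t" and Dne: "D \<noteq> {}" using E0 by (auto simp: D_def)
  have bdd: "bdd_below D" using D0 by (auto simp: bdd_below_def)
  have dle: "d \<le> (L2_norm M (\<lambda>x. f x - h x))\<^sup>2" if "h \<in> E" for h
    unfolding d_def by (rule cInf_lower) (use that bdd in \<open>auto simp: D_def\<close>)
  have "\<exists>h\<in>E. (L2_norm M (\<lambda>x. f x - h x))\<^sup>2 < d + 1 / real (Suc n)" for n
    using cInf_lessD[OF Dne, of "d + 1 / real (Suc n)"] unfolding d_def D_def by auto
  then obtain e where eE: "\<And>n. e n \<in> E"
    and e_lt: "\<And>n. (L2_norm M (\<lambda>x. f x - e n x))\<^sup>2 < d + 1 / real (Suc n)" by metis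
  have eL: "e n \<in> L2 M" for n using eE E by auto
  \<comment> \<open>Parallelogram law: the midpoint of \<open>e m\<close> and \<open>e n\<close>
    lies in \<open>E\<close>, which bounds the sum below by \<open>4 * d\<close> and so forces the
    difference to be small.\<close>
  have par: "(L2_norm M (\<lambda>x. e m x - e n x))\<^sup>2 \<le> 2 / real (Suc m) + 2 / real (Suc n)" for m n
  proof -
    let ?a = "\<lambda>x. f x - e m x" and ?b = "\<lambda>x. f x - e n x"
    have ab: "?a \<in> L2 M" "?b \<in> L2 M" using f eL by (auto intro: L2_diff)
    have "(L2_norm M (\<lambda>x. ?a x + ?b x))\<^sup>2 + (L2_norm M (\<lambda>x. ?a x - ?b x))\<^sup>2
        = 2 * (L2_norm M ?a)\<^sup>2 + 2 * (L2_norm M ?b)\<^sup>2"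
      by (simp only: L2_norm_add_square[OF ab] L2_norm_diff_square[OF ab])
    moreover have "(L2_norm M (\<lambda>x. ?a x + ?b x))\<^sup>2 \<ge> 4 * d"
    proof -
      have h: "(\<lambda>x. (1/2) * e m x + (1/2) * e n x) \<in> E"
        using E_lin[OF E_lin[OF E0 eE[of m], of "1/2"] eE[of n], of "1/2"] by simp
      have "(\<lambda>x. ?a x + ?b x) = (\<lambda>x. 2 * (f x - ((1/2) * e m x + (1/2) * e n x)))"
        by (auto simp: algebra_simps)
      then have "(L2_norm M (\<lambda>x. ?a x + ?b x))\<^sup>2
          = (L2_norm M (\<lambda>x. 2 * (f x - ((1/2) * e m x + (1/2) * e n x))))\<^sup>2" by simp
      also have "\<dots> = 4 * (L2_norm M (\<lambda>x. f x - ((1/2) * e m x + (1/2) * e n x)))\<^sup>2"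
        by (simp only: L2_norm_cmult) (simp add: power_mult_distrib)
      finally show ?thesis using dle[OF h] by simp
    qed
    moreover have "(L2_norm M (\<lambda>x. ?a x - ?b x))\<^sup>2 = (L2_norm M (\<lambda>x. e m x - e n x))\<^sup>2"
      using L2_norm_diff_commute[of M "e m" "e n"] by simp
    moreover have "2 / real (Suc m) = 2 * (1 / real (Suc m))" "2 / real (Suc n) = 2 * (1 / real (Suc n))"
      by simp_all
    ultimately show ?thesis using e_lt[of m] e_lt[of n] by linarith
  qed
  have "L2_Cauchy M e"
    unfolding L2_Cauchy_def
  proof (intro allI impI)
    fix \<epsilon> :: real assume "\<epsilon> > 0"
    then obtain N where N: "1 / real (Suc N) < \<epsilon>\<^sup>2 / 4"
      using reals_Archimedean[of "\<epsilon>\<^sup>2 / 4"] by (auto simp: inverse_eq_divide)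
    have "L2_norm M (\<lambda>x. e m x - e n x) < \<epsilon>" if "m \<ge> N" "n \<ge> N" for m n
    proof (rule power_less_imp_less_base)
      have "1 / real (Suc m) \<le> 1 / real (Suc N)" "1 / real (Suc n) \<le> 1 / real (Suc N)"
        using that by (auto simp: frac_le)
      then show "(L2_norm M (\<lambda>x. e m x - e n x))\<^sup>2 < \<epsilon>\<^sup>2" using N par[of m n] by simp
    qed (use \<open>\<epsilon> > 0\<close> in auto)
    then show "\<exists>N. \<forall>m\<ge>N. \<forall>n\<ge>N. L2_norm M (\<lambda>x. e m x - e n x) < \<epsilon>" by blast
  qed
  then obtain g where gL: "g \<in> L2 M" and g: "(\<lambda>n. L2_norm M (\<lambda>x. e n x - g x)) \<longlonglongrightarrow> 0"
    using L2_complete eL by blast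
  have fgL: "(\<lambda>x. f x - g x) \<in> L2 M" using f gL by (rule L2_diff)
  have "L2_inner M (\<lambda>x. f x - g x) h = 0" if h: "h \<in> E" for h
  proof -
    have hL: "h \<in> L2 M" using h E by auto
    define c where "c = L2_inner M (\<lambda>x. f x - g x) h"
    have lim_fe: "(\<lambda>n. L2_norm M (\<lambda>x. (f x - e n x) - (f x - g x))) \<longlonglongrightarrow> 0"
      using g by (simp add: L2_norm_diff_commute[of M g])
    have lim_sq: "(\<lambda>n. (L2_norm M (\<lambda>x. f x - e n x))\<^sup>2) \<longlonglongrightarrow> (L2_norm M (\<lambda>x. f x - g x))\<^sup>2"
      by (intro tendsto_power L2_norm_tendsto[OF _ fgL lim_fe] L2_diff f eL)
    have lim_in: "(\<lambda>n. L2_inner M (\<lambda>x. f x - e n x) h) \<longlonglongrightarrow> c"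
      unfolding c_def by (intro L2_inner_tendsto[OF _ fgL hL lim_fe] L2_diff f eL)
    have min: "(L2_norm M (\<lambda>x. f x - g x))\<^sup>2 \<le> d"
    proof (rule LIMSEQ_le[OF lim_sq])
      show "(\<lambda>n. d + 1 / real (Suc n)) \<longlonglongrightarrow> d"
        using tendsto_add[OF tendsto_const[of d] LIMSEQ_Suc[OF lim_1_over_n]] by simp
      show "\<exists>N. \<forall>n\<ge>N. (L2_norm M (\<lambda>x. f x - e n x))\<^sup>2 \<le> d + 1 / real (Suc n)"
        using e_lt less_imp_le by blast
    qed
    \<comment> \<open>Moving by \<open>(t * c) * h\<close> makes the linear term
      \<open>2 * t * (cmod c)\<^sup>2\<close> whatever the phase of \<open>c\<close>. As
      \<open>g\<close> may lie outside \<open>E\<close>, minimality is used at \<open>e n\<close>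
      and passed to the limit.\<close>
    have key: "2 * t * (cmod c)\<^sup>2 \<le> t\<^sup>2 * (cmod c)\<^sup>2 * (L2_norm M h)\<^sup>2" for t :: real
    proof -
      have ineq: "d \<le> (L2_norm M (\<lambda>x. f x - e n x))\<^sup>2 - 2 * Re (cnj (t * c) * L2_inner M (\<lambda>x. f x - e n x) h)
          + t\<^sup>2 * (cmod c)\<^sup>2 * (L2_norm M h)\<^sup>2" for n
      proof -
        have "d \<le> (L2_norm M (\<lambda>x. f x - (e n x + (t * c) * h x)))\<^sup>2"
          by (intro dle E_lin eE h)
        also have "(\<lambda>x. f x - (e n x + (t * c) * h x)) = (\<lambda>x. (f x - e n x) - (t * c) * h x)"
          by (auto simp: algebra_simps)
        also have "(L2_norm M \<dots>)\<^sup>2 = (L2_norm M (\<lambda>x. f x - e n x))\<^sup>2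
            - 2 * Re (L2_inner M (\<lambda>x. f x - e n x) (\<lambda>x. (t * c) * h x)) + (L2_norm M (\<lambda>x. (t * c) * h x))\<^sup>2"
          by (intro L2_norm_diff_square L2_cmult L2_diff f eL hL)
        finally show ?thesis
          by (simp only: L2_inner_cmult_right L2_norm_cmult)
            (simp add: norm_mult power_mult_distrib)
      qed
      have "(\<lambda>n. (L2_norm M (\<lambda>x. f x - e n x))\<^sup>2 - 2 * Re (cnj (t * c) * L2_inner M (\<lambda>x. f x - e n x) h)
          + t\<^sup>2 * (cmod c)\<^sup>2 * (L2_norm M h)\<^sup>2)
        \<longlonglongrightarrow> (L2_norm M (\<lambda>x. f x - g x))\<^sup>2 - 2 * Re (cnj (t * c) * c) + t\<^sup>2 * (cmod c)\<^sup>2 * (L2_norm M h)\<^sup>2"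
        by (intro tendsto_intros lim_sq lim_in)
      then have "d \<le> (L2_norm M (\<lambda>x. f x - g x))\<^sup>2 - 2 * Re (cnj (t * c) * c) + t\<^sup>2 * (cmod c)\<^sup>2 * (L2_norm M h)\<^sup>2"
        by (rule LIMSEQ_le_const) (use ineq in auto)
      moreover have "Re (cnj (t * c) * c) = t * (cmod c)\<^sup>2"
        unfolding cmod_power2 by (simp add: power2_eq_square algebra_simps)
      ultimately show ?thesis using min by simp
    qed
    show "c = 0"
    proof (rule ccontr)
      assume "c \<noteq> 0"
      then have cp: "(cmod c)\<^sup>2 > 0" by simp
      \<comment> \<open>The added 1 keeps \<open>s\<close> positive when \<open>h\<close> has norm
        0. With \<open>t = 1 / s\<close> the inequality \<open>key\<close> reads
        \<open>2 * s \<le> (L2_norm M h)\<^sup>2\<close>, but the right-hand side is below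
        \<open>s\<close>.\<close>
      define s where "s = (L2_norm M h)\<^sup>2 + 1"
      have s: "s > 0" unfolding s_def by (simp add: add_nonneg_pos)
      have "s\<^sup>2 * (2 * (1 / s) * (cmod c)\<^sup>2) \<le> s\<^sup>2 * ((1 / s)\<^sup>2 * (cmod c)\<^sup>2 * (L2_norm M h)\<^sup>2)"
        by (intro mult_left_mono key) simp
      also have "s\<^sup>2 * (2 * (1 / s) * (cmod c)\<^sup>2) = (cmod c)\<^sup>2 * (2 * s)"
        using s by (simp add: power2_eq_square)
      also have "s\<^sup>2 * ((1 / s)\<^sup>2 * (cmod c)\<^sup>2 * (L2_norm M h)\<^sup>2) = (cmod c)\<^sup>2 * (L2_norm M h)\<^sup>2"
        using s by (simp add: power_one_over)
      finally have "2 * s \<le> (L2_norm M h)\<^sup>2" using cp by simp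
      then show False using s by (simp add: s_def)
    qed
  qed
  then show ?thesis using that gL eE g by blast
qed

text \<open>Only norms of combinations are compared, so no linear map has to be named. The values
  \<open>1\<close> and \<open>-1\<close> of \<open>c\<close> recover the real part,
  \<open>\<i>\<close> and \<open>-\<i>\<close> the imaginary part.\<close>

lemma L2_polarization:
  assumes "a \<in> L2 M" "b \<in> L2 M" "a' \<in> L2 N" "b' \<in> L2 N"
    and norms: "\<And>c. L2_norm N (\<lambda>x. a' x + c * b' x) = L2_norm M (\<lambda>x. a x + c * b x)"
  shows "L2_inner N a' b' = L2_inner M a b"
proof -
  have sq: "(L2_norm N a')\<^sup>2 + 2 * Re (cnj c * L2_inner N a' b') + (cmod c * L2_norm N b')\<^sup>2
      = (L2_norm M a)\<^sup>2 + 2 * Re (cnj c * L2_inner M a b) + (cmod c * L2_norm M b)\<^sup>2" for c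
    using L2_norm_add_square[OF assms(3) L2_cmult[OF assms(4)], of c]
      L2_norm_add_square[OF assms(1) L2_cmult[OF assms(2)], of c] norms[of c]
    by (simp add: L2_inner_cmult_right L2_norm_cmult)
  show ?thesis
    using sq[of 1] sq[of "-1"] sq[of \<i>] sq[of "-\<i>"] by (simp add: complex_eq_iff)
qed

lemma L2_mult_bounded:
  assumes f: "f \<in> L2 M" and h: "h \<in> borel_measurable M" "AE x in M. cmod (h x) \<le> B"
  shows "(\<lambda>x. h x * f x) \<in> L2 M" and "0 \<le> B \<Longrightarrow> L2_norm M (\<lambda>x. h x * f x) \<le> B * L2_norm M f"
proof -
  note [measurable] = L2_measurable[OF f] h(1)
  have int: "integrable M (\<lambda>x. B\<^sup>2 * (cmod (f x))\<^sup>2)" using L2_integrable_square[OF f] by simp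
  have le: "AE x in M. (cmod (h x * f x))\<^sup>2 \<le> B\<^sup>2 * (cmod (f x))\<^sup>2"
    using h(2) by eventually_elim (auto simp: norm_mult power_mult_distrib intro!: mult_right_mono power_mono)
  show L: "(\<lambda>x. h x * f x) \<in> L2 M" by (rule L2_bounded_by[OF _ int le]) measurable
  assume B: "0 \<le> B"
  have "(L2_norm M (\<lambda>x. h x * f x))\<^sup>2 \<le> (B * L2_norm M f)\<^sup>2"
    unfolding power_mult_distrib L2_norm_square integral_mult_right_zero [symmetric]
    by (rule integral_mono_AE[OF L2_integrable_square[OF L] int le])
  then show "L2_norm M (\<lambda>x. h x * f x) \<le> B * L2_norm M f"
    by (rule power2_le_imp_le) (simp add: B)
qed

lemma L2_cong_AE:
  assumes "f \<in> L2 M" "g \<in> borel_measurable M" "AE x in M. g x = f x"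
  shows "g \<in> L2 M"
proof (rule L2_bounded_by[OF assms(2) L2_integrable_square[OF assms(1)]])
  show "AE x in M. (cmod (g x))\<^sup>2 \<le> (cmod (f x))\<^sup>2"
    using assms(3) by eventually_elim simp
qed

lemma L2_inner_cong_AE:
  assumes [measurable]: "f \<in> L2 M" "g \<in> borel_measurable M" "h \<in> L2 M" and eq: "AE x in M. g x = f x"
  shows "L2_inner M g h = L2_inner M f h"
  unfolding L2_inner_def
proof (rule integral_cong_AE)
  show "AE x in M. g x * cnj (h x) = f x * cnj (h x)" using eq by eventually_elim simp
qed measurable

subsection \<open>Square-summable sequences\<close>

text \<open>With counting measure the theory above applies to sequences too, so completeness and
  projection are available for Taylor coefficients.\<close>

abbreviation l2 :: "(nat \<Rightarrow> complex) set" where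
  "l2 \<equiv> L2 (count_space UNIV)"

abbreviation l2_norm :: "(nat \<Rightarrow> complex) \<Rightarrow> real" where
  "l2_norm \<equiv> L2_norm (count_space UNIV)"

abbreviation l2_inner :: "(nat \<Rightarrow> complex) \<Rightarrow> (nat \<Rightarrow> complex) \<Rightarrow> complex" where
  "l2_inner \<equiv> L2_inner (count_space UNIV)"

lemma l2_iff: "a \<in> l2 \<longleftrightarrow> summable (\<lambda>n. (cmod (a n))\<^sup>2)"
  by (simp add: L2_def integrable_count_space_nat_iff)

lemma l2_norm_square: "a \<in> l2 \<Longrightarrow> (l2_norm a)\<^sup>2 = (\<Sum>n. (cmod (a n))\<^sup>2)"
  by (simp add: L2_norm_square integral_count_space_nat L2_integrable_square)

lemma l2_inner_eq: "a \<in> l2 \<Longrightarrow> b \<in> l2 \<Longrightarrow> l2_inner a b = (\<Sum>n. a n * cnj (b n))"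
  by (simp add: L2_inner_def integral_count_space_nat L2_inner_integrable)

lemma l2_inner_sums: "a \<in> l2 \<Longrightarrow> b \<in> l2 \<Longrightarrow> (\<lambda>n. a n * cnj (b n)) sums l2_inner a b"
  unfolding L2_inner_def by (intro sums_integral_count_space_nat L2_inner_integrable)

lemma l2_geometric: "cmod w < 1 \<Longrightarrow> (\<lambda>n. w ^ n) \<in> l2"
proof -
  assume "cmod w < 1"
  then have "summable (\<lambda>n. ((cmod w)\<^sup>2) ^ n)" by (intro summable_geometric) (simp add: abs_square_less_1)
  moreover have "((cmod w)\<^sup>2) ^ n = (cmod (w ^ n))\<^sup>2" for n
    unfolding norm_power power_mult [symmetric] by (simp only: mult.commute)
  ultimately show ?thesis by (simp add: l2_iff)
qed

lemma l2_power_series_summable: "a \<in> l2 \<Longrightarrow> cmod z < 1 \<Longrightarrow> summable (\<lambda>n. a n * z ^ n)"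
  using l2_inner_sums[of a "\<lambda>n. cnj z ^ n"] l2_geometric[of "cnj z"] by (auto simp: sums_iff)

subsection \<open>Taylor coefficients\<close>

lemma holomorphic_taylor_sums:
  "f holomorphic_on ball 0 1 \<Longrightarrow> z \<in> ball 0 1 \<Longrightarrow> (\<lambda>n. taylor_coeff f n * z ^ n) sums f z"
  unfolding taylor_coeff_def using holomorphic_power_series[of f 0 1 z] by simp

lemma taylor_coeff_eqI:
  assumes "\<And>z. z \<in> ball 0 1 \<Longrightarrow> (\<lambda>n. a n * z ^ n) sums f z"
  shows "taylor_coeff f = a"
proof
  fix n
  have "f has_fps_expansion Abs_fps a"
    by (intro has_fps_expansionI eventually_nhds_in_open[of "ball 0 1", THEN eventually_mono])
      (use assms in auto)
  from fps_nth_fps_expansion[OF this, of n] show "taylor_coeff f n = a n"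
    by (simp add: taylor_coeff_def)
qed

lemma taylor_coeff_add:
  assumes "f holomorphic_on ball 0 1" "g holomorphic_on ball 0 1"
  shows "taylor_coeff (\<lambda>z. f z + g z) = (\<lambda>n. taylor_coeff f n + taylor_coeff g n)"
  by (rule taylor_coeff_eqI)
    (use assms in \<open>simp add: distrib_right sums_add holomorphic_taylor_sums\<close>)

lemma taylor_coeff_cmult:
  assumes "f holomorphic_on ball 0 1"
  shows "taylor_coeff (\<lambda>z. c * f z) = (\<lambda>n. c * taylor_coeff f n)"
  by (rule taylor_coeff_eqI)
    (use assms in \<open>simp add: mult.assoc sums_mult holomorphic_taylor_sums\<close>)

lemma taylor_coeff_diff:
  assumes "f holomorphic_on ball 0 1" "g holomorphic_on ball 0 1"
  shows "taylor_coeff (\<lambda>z. f z - g z) = (\<lambda>n. taylor_coeff f n - taylor_coeff g n)"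
  by (rule taylor_coeff_eqI)
    (use assms in \<open>simp add: left_diff_distrib sums_diff holomorphic_taylor_sums\<close>)

subsection \<open>The Hardy space\<close>

lemma H2_holomorphic: "f \<in> H2 \<Longrightarrow> f holomorphic_on ball 0 1"
  and H2_outside: "f \<in> H2 \<Longrightarrow> z \<notin> ball 0 1 \<Longrightarrow> f z = 0"
  and H2_taylor_coeff_l2: "f \<in> H2 \<Longrightarrow> taylor_coeff f \<in> l2"
  by (auto simp: H2_def l2_iff)

lemma H2_iff: "f \<in> H2 \<longleftrightarrow>
    f holomorphic_on ball 0 1 \<and> (\<forall>z. z \<notin> ball 0 1 \<longrightarrow> f z = 0) \<and> taylor_coeff f \<in> l2"
  by (auto simp: H2_def l2_iff)

lemma H2_inner_l2: "f \<in> H2 \<Longrightarrow> g \<in> H2 \<Longrightarrow> H2_inner f g = l2_inner (taylor_coeff f) (taylor_coeff g)"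
  by (simp add: H2_inner_def l2_inner_eq H2_taylor_coeff_l2)

lemma H2_norm_l2: "f \<in> H2 \<Longrightarrow> H2_norm f = l2_norm (taylor_coeff f)"
  by (simp add: H2_norm_def H2_inner_l2 L2_norm_eq_sqrt_inner)

text \<open>The inverse of \<open>taylor_coeff\<close> on \<open>l2\<close>; it turns limits found
  in \<open>l2\<close> back into Hardy functions.\<close>

definition of_coeffs :: "(nat \<Rightarrow> complex) \<Rightarrow> complex \<Rightarrow> complex" where
  "of_coeffs a = on_disk (\<lambda>z. \<Sum>n. a n * z ^ n)"

lemma of_coeffs_sums: "a \<in> l2 \<Longrightarrow> z \<in> ball 0 1 \<Longrightarrow> (\<lambda>n. a n * z ^ n) sums of_coeffs a z"
  by (simp add: of_coeffs_def on_disk_def summable_sums l2_power_series_summable)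

lemma taylor_coeff_of_coeffs: "a \<in> l2 \<Longrightarrow> taylor_coeff (of_coeffs a) = a"
  by (rule taylor_coeff_eqI) (rule of_coeffs_sums)

lemma of_coeffs_H2: "a \<in> l2 \<Longrightarrow> of_coeffs a \<in> H2"
  using power_series_holomorphic[of 0 1 a "of_coeffs a"] of_coeffs_sums[of a]
  by (simp add: H2_iff taylor_coeff_of_coeffs) (simp add: of_coeffs_def on_disk_def)

lemma H2_eqI:
  assumes "f \<in> H2" "g \<in> H2" "\<And>z. z \<in> ball 0 1 \<Longrightarrow> f z = g z"
  shows "f = g"
proof
  fix z show "f z = g z"
    using assms H2_outside[of f z] H2_outside[of g z] by (cases "z \<in> ball 0 1") simp_all
qed

lemma H2_add: "f \<in> H2 \<Longrightarrow> g \<in> H2 \<Longrightarrow> (\<lambda>z. f z + g z) \<in> H2"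
  by (simp add: H2_iff taylor_coeff_add holomorphic_on_add L2_add)

lemma H2_diff: "f \<in> H2 \<Longrightarrow> g \<in> H2 \<Longrightarrow> (\<lambda>z. f z - g z) \<in> H2"
  by (simp add: H2_iff taylor_coeff_diff holomorphic_on_diff L2_diff)

lemma H2_cmult: "f \<in> H2 \<Longrightarrow> (\<lambda>z. c * f z) \<in> H2"
  by (simp add: H2_iff taylor_coeff_cmult holomorphic_on_mult L2_cmult)

lemma H2_zero: "(\<lambda>z. 0) \<in> H2"
  using taylor_coeff_eqI[of "\<lambda>n. 0" "\<lambda>z. 0"] by (simp add: H2_iff)

section \<open>Reproducing kernels and norm limits in the Hardy space\<close>

definition szego_kernel :: "complex \<Rightarrow> complex \<Rightarrow> complex" where
  "szego_kernel w = on_disk (\<lambda>z. 1 / (1 - cnj w * z))"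

lemma cmod_mult_less_1: "cmod w < 1 \<Longrightarrow> cmod z \<le> 1 \<Longrightarrow> cmod (w * z) < 1"
  using mult_left_le[of "cmod z" "cmod w"] by (simp add: norm_mult)

lemma szego_kernel_eq_of_coeffs:
  assumes "w \<in> ball 0 1" shows "szego_kernel w = of_coeffs (\<lambda>n. cnj w ^ n)"
proof
  fix z show "szego_kernel w z = of_coeffs (\<lambda>n. cnj w ^ n) z"
    using assms geometric_sums[of "cnj w * z"] cmod_mult_less_1[of "cnj w" z]
    by (auto simp: szego_kernel_def of_coeffs_def on_disk_def power_mult_distrib sums_iff)
qed

lemma
  assumes "w \<in> ball 0 1"
  shows szego_kernel_H2: "szego_kernel w \<in> H2"
    and taylor_coeff_szego_kernel: "taylor_coeff (szego_kernel w) = (\<lambda>n. cnj w ^ n)"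
  using assms by (auto simp: szego_kernel_eq_of_coeffs taylor_coeff_of_coeffs l2_geometric of_coeffs_H2)

lemma H2_inner_szego_kernel:
  assumes "f \<in> H2" "w \<in> ball 0 1" shows "H2_inner f (szego_kernel w) = f w"
  using holomorphic_taylor_sums[OF H2_holomorphic[OF assms(1)] assms(2)]
  by (simp add: H2_inner_def taylor_coeff_szego_kernel[OF assms(2)] sums_iff)

text \<open>Evaluation at \<open>w\<close> is the inner product with the Szego kernel, hence
  continuous. This identifies a norm limit with a function given by a pointwise formula, as the
  Clark transform is.\<close>

lemma H2_tendsto_pointwise:
  assumes "\<And>n. F n \<in> H2" "f \<in> H2" "(\<lambda>n. H2_norm (\<lambda>z. F n z - f z)) \<longlonglongrightarrow> 0" "w \<in> ball 0 1"
  shows "(\<lambda>n. F n w) \<longlonglongrightarrow> f w"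
proof -
  have "(\<lambda>n. l2_inner (taylor_coeff (F n)) (taylor_coeff (szego_kernel w)))
      \<longlonglongrightarrow> l2_inner (taylor_coeff f) (taylor_coeff (szego_kernel w))"
    by (rule L2_inner_tendsto)
      (use assms in \<open>auto simp: H2_norm_l2 H2_diff taylor_coeff_diff H2_holomorphic
        intro!: H2_taylor_coeff_l2 szego_kernel_H2\<close>)
  then show ?thesis using assms
    by (simp add: H2_inner_szego_kernel szego_kernel_H2 flip: H2_inner_l2)
qed

lemma H2_inner_add_left: "f \<in> H2 \<Longrightarrow> g \<in> H2 \<Longrightarrow> h \<in> H2 \<Longrightarrow>
    H2_inner (\<lambda>z. f z + g z) h = H2_inner f h + H2_inner g h"
  by (simp add: H2_inner_l2 H2_add taylor_coeff_add H2_holomorphic L2_inner_add_left H2_taylor_coeff_l2)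

lemma H2_inner_diff_left: "f \<in> H2 \<Longrightarrow> g \<in> H2 \<Longrightarrow> h \<in> H2 \<Longrightarrow>
    H2_inner (\<lambda>z. f z - g z) h = H2_inner f h - H2_inner g h"
  by (simp add: H2_inner_l2 H2_diff taylor_coeff_diff H2_holomorphic L2_inner_diff_left H2_taylor_coeff_l2)

lemma H2_inner_cmult_left: "f \<in> H2 \<Longrightarrow> h \<in> H2 \<Longrightarrow>
    H2_inner (\<lambda>z. c * f z) h = c * H2_inner f h"
  by (simp only: H2_inner_l2 H2_cmult taylor_coeff_cmult H2_holomorphic L2_inner_cmult_left)

lemma H2_inner_cnj: "f \<in> H2 \<Longrightarrow> g \<in> H2 \<Longrightarrow> H2_inner g f = cnj (H2_inner f g)"
  by (simp only: H2_inner_l2 L2_inner_cnj[of _ "taylor_coeff g"])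

lemma H2_inner_add_right: "f \<in> H2 \<Longrightarrow> g \<in> H2 \<Longrightarrow> h \<in> H2 \<Longrightarrow>
    H2_inner h (\<lambda>z. f z + g z) = H2_inner h f + H2_inner h g"
  by (simp add: H2_inner_cnj[of _ h] H2_add H2_inner_add_left)

lemma H2_inner_diff_right: "f \<in> H2 \<Longrightarrow> g \<in> H2 \<Longrightarrow> h \<in> H2 \<Longrightarrow>
    H2_inner h (\<lambda>z. f z - g z) = H2_inner h f - H2_inner h g"
  by (simp add: H2_inner_cnj[of _ h] H2_diff H2_inner_diff_left)

lemma H2_inner_cmult_right: "f \<in> H2 \<Longrightarrow> h \<in> H2 \<Longrightarrow>
    H2_inner h (\<lambda>z. c * f z) = cnj c * H2_inner h f"
  by (simp add: H2_inner_cnj[of _ h] H2_cmult H2_inner_cmult_left)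

lemma H2_Cauchy_Schwarz: "f \<in> H2 \<Longrightarrow> g \<in> H2 \<Longrightarrow> cmod (H2_inner f g) \<le> H2_norm f * H2_norm g"
  by (simp add: H2_inner_l2 H2_norm_l2 L2_Cauchy_Schwarz H2_taylor_coeff_l2)

lemma H2_inner_tendsto:
  assumes "\<And>n. F n \<in> H2" "f \<in> H2" "h \<in> H2" "(\<lambda>n. H2_norm (\<lambda>z. F n z - f z)) \<longlonglongrightarrow> 0"
  shows "(\<lambda>n. H2_inner (F n) h) \<longlonglongrightarrow> H2_inner f h"
  using L2_inner_tendsto[of "\<lambda>n. taylor_coeff (F n)" "count_space UNIV" "taylor_coeff f" "taylor_coeff h"] assms
  by (simp add: H2_inner_l2 H2_norm_l2 H2_diff taylor_coeff_diff H2_holomorphic H2_taylor_coeff_l2)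

text \<open>Taylor polynomials are bounded on the disk. Facts about multiplication by an inner
  function come from dominated convergence, which wants bounded factors; this density carries them
  over to all of \<open>H2\<close>.\<close>

lemma H2_approx_bounded:
  assumes h: "h \<in> H2"
  obtains H K where "\<And>n::nat. H n \<in> H2" "\<And>n z. z \<in> ball 0 1 \<Longrightarrow> cmod (H n z) \<le> K n"
    "(\<lambda>n. H2_norm (\<lambda>z. H n z - h z)) \<longlonglongrightarrow> 0"
proof -
  define a where "a N n = (if n < N then taylor_coeff h n else 0)" for N n :: nat
  have hl: "taylor_coeff h \<in> l2" using h by (rule H2_taylor_coeff_l2)
  have al: "a N \<in> l2" for N
    unfolding l2_iff a_def by (rule summable_finite[of "{..<N}"]) auto
  have "cmod (of_coeffs (a N) z) \<le> (\<Sum>n<N. cmod (taylor_coeff h n))" if z: "z \<in> ball 0 1" for N z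
  proof -
    have "(\<lambda>n. a N n * z ^ n) sums (\<Sum>n<N. a N n * z ^ n)"
      by (rule sums_finite) (auto simp: a_def)
    then have "of_coeffs (a N) z = (\<Sum>n<N. taylor_coeff h n * z ^ n)"
      using sums_unique2[OF of_coeffs_sums[OF al z]] by (simp add: a_def)
    also have "cmod \<dots> \<le> (\<Sum>n<N. cmod (taylor_coeff h n))"
      using z by (intro sum_norm_le) (auto simp: norm_mult norm_power intro!: mult_left_le power_le_one)
    finally show ?thesis .
  qed
  moreover have "(\<lambda>N. H2_norm (\<lambda>z. of_coeffs (a N) z - h z)) \<longlonglongrightarrow> 0"
  proof -
    have "(\<lambda>N. LINT n|count_space UNIV. (cmod (a N n - taylor_coeff h n))\<^sup>2) \<longlonglongrightarrow> (LINT n|count_space (UNIV :: nat set). 0 :: real)"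
    proof (rule integral_dominated_convergence[where w = "\<lambda>n. (cmod (taylor_coeff h n))\<^sup>2"])
      show "AE n in count_space UNIV. (\<lambda>N. (cmod (a N n - taylor_coeff h n))\<^sup>2) \<longlonglongrightarrow> 0"
        unfolding a_def
        by (intro AE_I2 tendsto_eventually eventually_mono[OF eventually_gt_at_top]) auto
    qed (auto intro!: L2_integrable_square hl simp: a_def)
    then have "(\<lambda>N. sqrt (LINT n|count_space UNIV. (cmod (a N n - taylor_coeff h n))\<^sup>2)) \<longlonglongrightarrow> sqrt 0"
      by (intro tendsto_real_sqrt) simp
    then show ?thesis
      using h al by (simp add: H2_norm_l2 H2_diff of_coeffs_H2 taylor_coeff_diff H2_holomorphic
        taylor_coeff_of_coeffs L2_norm_def)
  qed
  ultimately show ?thesis by (rule that[OF of_coeffs_H2[OF al]])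
qed

subsection \<open>Parseval's identity\<close>

lemma cis_measurable [measurable]: "cis \<in> borel_measurable borel"
  by (intro borel_measurable_continuous_onI continuous_intros)

lemma cis_measurable_circle: "cis \<in> measurable (uniform_measure lborel {0..<2 * pi}) borel_circle"
  by (rule measurable_restrict_space2) (auto simp: measurable_cong_sets[OF sets_uniform_measure refl])

lemma space_circle_measure [simp]: "space circle_measure = sphere 0 1"
  and sets_circle_measure [measurable_cong]: "sets circle_measure = sets borel_circle"
  by (simp_all add: circle_measure_def space_restrict_space)

lemma emeasure_circle_measure: "emeasure circle_measure (space circle_measure) = 1"
proof -
  have "emeasure circle_measure (space circle_measure)
      = emeasure (uniform_measure lborel {0..<2 * pi}) (cis -` sphere 0 1 \<inter> UNIV)"
    unfolding circle_measure_def
    using sets.top[of borel_circle]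
    by (subst emeasure_distr[OF cis_measurable_circle]) (simp_all add: space_restrict_space)
  also have "cis -` sphere 0 1 \<inter> UNIV = UNIV" by auto
  also have "emeasure (uniform_measure lborel {0..<2 * pi}) UNIV = 1"
    by (subst emeasure_uniform_measure) (auto simp: ennreal_divide_self)
  finally show ?thesis .
qed

lemma finite_measure_circle_measure: "finite_measure circle_measure"
  by (rule finite_measureI) (simp add: emeasure_circle_measure del: space_circle_measure)

text \<open>The closed interval, which differs from the half-open one by a null set, is what the
  fundamental theorem of calculus in \<open>integral_circle_power\<close> works with.\<close>

lemma integral_circle_measure:
  fixes f :: "complex \<Rightarrow> complex"
  assumes "f \<in> borel_measurable borel_circle"
  shows "(LINT \<zeta>|circle_measure. f \<zeta>)
    = (LINT t|lborel. (indicator {0..2 * pi} t / (2 * pi)) *\<^sub>R f (cis t))"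
proof -
  have m [measurable]: "(\<lambda>t. f (cis t)) \<in> borel_measurable borel"
    using measurable_compose[OF cis_measurable_circle assms]
    by (simp add: measurable_cong_sets[OF sets_uniform_measure refl])
  have "(LINT \<zeta>|circle_measure. f \<zeta>) = (LINT t|uniform_measure lborel {0..<2 * pi}. f (cis t))"
    unfolding circle_measure_def by (rule integral_distr[OF cis_measurable_circle assms])
  also have "uniform_measure lborel {0..<2 * pi}
      = density lborel (\<lambda>t. ennreal (indicator {0..<2 * pi} t / (2 * pi)))"
    unfolding uniform_measure_def
    by (intro density_cong AE_I2) (auto simp: divide_ennreal[symmetric] split: split_indicator)
  also have "(LINT t|\<dots>. f (cis t)) = (LINT t|lborel. (indicator {0..<2 * pi} t / (2 * pi)) *\<^sub>R f (cis t))"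
    by (rule integral_density) auto
  also have "\<dots> = (LINT t|lborel. (indicator {0..2 * pi} t / (2 * pi)) *\<^sub>R f (cis t))"
    by (rule integral_cong_AE) (auto intro!: eventually_mono[OF AE_lborel_singleton[of "2 * pi"]] split: split_indicator)
  finally show ?thesis .
qed

lemma circle_power_cnj: "cmod z = 1 \<Longrightarrow> z ^ n * cnj z ^ n = 1"
  by (metis complex_norm_square of_real_1 power_one power_mult_distrib)

lemma integral_circle_power:
  "(LINT \<zeta>|circle_measure. \<zeta> ^ m * cnj \<zeta> ^ n) = (if m = n then 1 else 0)"
proof (cases "m = n")
  case True
  interpret finite_measure circle_measure by (rule finite_measure_circle_measure)
  have "(LINT \<zeta>|circle_measure. \<zeta> ^ m * cnj \<zeta> ^ n) = (LINT \<zeta>|circle_measure. 1)"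
    by (rule Bochner_Integration.integral_cong) (auto simp: True circle_power_cnj)
  then show ?thesis using True emeasure_circle_measure by (simp add: measure_def)
next
  case False
  define k where "k = real m - real n"
  have k: "k \<noteq> 0" using False by (simp add: k_def)
  define F where "F t = cis (k * t) / (\<i> * k)" for t
  have e: "cis t ^ m * cnj (cis t) ^ n = cis (k * t)" for t
    by (simp only: cis_cnj Complex.DeMoivre cis_mult k_def) (simp add: left_diff_distrib)
  have "(F has_vector_derivative cis (k * t)) (at t within {0..2*pi})" for t
  proof -
    have "((\<lambda>z. exp (\<i> * k * z) / (\<i> * k)) has_field_derivative exp (\<i> * k * complex_of_real t))
        (at (complex_of_real t))"
      using k by (auto intro!: derivative_eq_intros)
    from has_vector_derivative_real_field[OF this, of "{0..2*pi}"] show ?thesis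
      by (simp add: F_def[abs_def] cis_conv_exp mult.assoc)
  qed
  then have "(LINT t|lborel. indicator {0..2*pi} t *\<^sub>R cis (k * t)) = F (2*pi) - F 0"
    by (intro integral_FTC_Icc) (auto intro!: continuous_intros)
  also have "cis (k * (2*pi)) = 1"
    using cis_multiple_2pi[of k] by (simp add: k_def mult_ac)
  then have "F (2*pi) - F 0 = 0" by (simp add: F_def)
  finally have z: "(LINT t|lborel. indicator {0..2*pi} t *\<^sub>R cis (k * t)) = 0" .
  have "(LINT \<zeta>|circle_measure. \<zeta> ^ m * cnj \<zeta> ^ n)
      = (LINT t|lborel. (1 / (2*pi)) *\<^sub>R (indicator {0..2*pi} t *\<^sub>R cis (k * t)))"
    by (subst integral_circle_measure)
      (auto intro!: borel_measurable_continuous_on_restrict continuous_intros simp: e)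
  also have "\<dots> = 0" by (simp only: integral_scaleR_right z) simp
  finally show ?thesis using False by simp
qed

lemma integrable_circle_continuous:
  fixes g :: "complex \<Rightarrow> 'b :: {banach, second_countable_topology}"
  assumes "continuous_on (sphere 0 1) g"
  shows "integrable circle_measure g"
proof -
  interpret finite_measure circle_measure by (rule finite_measure_circle_measure)
  have "compact (g ` sphere 0 1)" by (intro compact_continuous_image assms) auto
  then obtain B where "\<And>x. x \<in> sphere 0 1 \<Longrightarrow> norm (g x) \<le> B"
    by (meson compact_imp_bounded bounded_iff imageI)
  moreover have "g \<in> borel_measurable circle_measure"
    using borel_measurable_continuous_on_restrict[OF assms]
    by (simp add: measurable_cong_sets[OF sets_circle_measure refl])
  ultimately show ?thesis by (intro integrable_const_bound[of _ B]) (auto intro!: AE_I2)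
qed

lemma continuous_on_dilation:
  assumes "f holomorphic_on ball 0 1" "0 \<le> r" "r < 1"
  shows "continuous_on (sphere 0 1) (\<lambda>\<zeta>. f (complex_of_real r * \<zeta>))"
proof (rule continuous_on_compose2[OF holomorphic_on_imp_continuous_on[OF assms(1)]])
  show "(\<lambda>\<zeta>. complex_of_real r * \<zeta>) ` sphere 0 1 \<subseteq> ball 0 1"
    using assms by (auto simp: norm_mult)
qed (intro continuous_intros)

text \<open>On a circle of radius below 1 every holomorphic function is continuous, so no boundary
  values occur. Orthogonality of the powers settles the partial sums, and their uniform bound gives
  the limit.\<close>

theorem parseval_dilation:
  assumes f: "f holomorphic_on ball 0 1" and r: "0 \<le> r" "r < 1"
  shows "(\<lambda>n. (cmod (taylor_coeff f n))\<^sup>2 * r ^ (2 * n)) sums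
    (LINT \<zeta>|circle_measure. (cmod (f (complex_of_real r * \<zeta>)))\<^sup>2)"
proof -
  interpret finite_measure circle_measure by (rule finite_measure_circle_measure)
  define b where "b n = taylor_coeff f n * complex_of_real r ^ n" for n
  \<comment> \<open>Convergence of the Taylor series at a radius strictly between \<open>r\<close>
    and 1 makes it absolutely convergent at \<open>r\<close>.\<close>
  define \<rho> where "\<rho> = (1 + r) / 2"
  have \<rho>: "0 < \<rho>" "\<rho> < 1" "r < \<rho>" using r by (auto simp: \<rho>_def)
  have "summable (\<lambda>n. taylor_coeff f n * complex_of_real \<rho> ^ n)"
    using holomorphic_taylor_sums[OF f, of "complex_of_real \<rho>"] \<rho> by (simp add: sums_iff)
  then have sb: "summable (\<lambda>n. cmod (b n))"
    unfolding b_def by (rule powser_insidea) (use r \<rho> in simp)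
  define S where "S N \<zeta> = (\<Sum>n<N. b n * \<zeta> ^ n)" for N \<zeta>
  have bound: "cmod (S N \<zeta>) \<le> (\<Sum>n. cmod (b n))" if "cmod \<zeta> = 1" for N \<zeta>
  proof -
    have "cmod (S N \<zeta>) \<le> (\<Sum>n<N. cmod (b n))"
      unfolding S_def by (rule order_trans[OF norm_sum]) (simp add: norm_mult norm_power that)
    also have "\<dots> \<le> (\<Sum>n. cmod (b n))" by (rule sum_le_suminf[OF sb]) auto
    finally show ?thesis .
  qed
  have cont: "continuous_on (sphere 0 1) (S N)" for N
    unfolding S_def by (intro continuous_intros)
  have part: "(LINT \<zeta>|circle_measure. (cmod (S N \<zeta>))\<^sup>2) = (\<Sum>n<N. (cmod (b n))\<^sup>2)" for N
  proof -
    have "complex_of_real (LINT \<zeta>|circle_measure. (cmod (S N \<zeta>))\<^sup>2)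
        = (LINT \<zeta>|circle_measure. S N \<zeta> * cnj (S N \<zeta>))"
      by (subst integral_complex_of_real [symmetric]) (simp add: complex_norm_square del: of_real_power)
    also have "\<dots> = (LINT \<zeta>|circle_measure. (\<Sum>i<N. \<Sum>j<N. (b i * cnj (b j)) * (\<zeta> ^ i * cnj \<zeta> ^ j)))"
      by (rule Bochner_Integration.integral_cong) (auto simp: S_def sum_product mult_ac)
    also have "\<dots> = (\<Sum>i<N. \<Sum>j<N. (b i * cnj (b j)) * (LINT \<zeta>|circle_measure. \<zeta> ^ i * cnj \<zeta> ^ j))"
      by (subst Bochner_Integration.integral_sum Bochner_Integration.integral_mult_right_zero,
        (intro integrable_circle_continuous continuous_intros)?)+ (rule refl)
    also have "\<dots> = (\<Sum>i<N. b i * cnj (b i))"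
      by (simp add: integral_circle_power if_distrib cong: if_cong)
    also have "\<dots> = complex_of_real (\<Sum>n<N. (cmod (b n))\<^sup>2)"
      by (simp add: complex_norm_square del: of_real_power)
    finally show ?thesis by (simp only: of_real_eq_iff)
  qed
  have "(\<lambda>N. LINT \<zeta>|circle_measure. (cmod (S N \<zeta>))\<^sup>2)
      \<longlonglongrightarrow> (LINT \<zeta>|circle_measure. (cmod (f (complex_of_real r * \<zeta>)))\<^sup>2)"
  proof (rule integral_dominated_convergence[where w = "\<lambda>_. (\<Sum>n. cmod (b n))\<^sup>2"])
    show "(\<lambda>\<zeta>. (cmod (f (complex_of_real r * \<zeta>)))\<^sup>2) \<in> borel_measurable circle_measure"
      by (intro borel_measurable_integrable integrable_circle_continuous continuous_intros
          continuous_on_dilation f r)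
    show "(\<lambda>\<zeta>. (cmod (S N \<zeta>))\<^sup>2) \<in> borel_measurable circle_measure" for N
      by (intro borel_measurable_integrable integrable_circle_continuous continuous_intros cont)
    show "AE \<zeta> in circle_measure. (\<lambda>N. (cmod (S N \<zeta>))\<^sup>2) \<longlonglongrightarrow> (cmod (f (complex_of_real r * \<zeta>)))\<^sup>2"
    proof (rule AE_I2)
      fix \<zeta> assume "\<zeta> \<in> space circle_measure"
      then have "(\<lambda>n. b n * \<zeta> ^ n) sums f (complex_of_real r * \<zeta>)"
        using holomorphic_taylor_sums[OF f, of "complex_of_real r * \<zeta>"] r
        by (simp add: b_def norm_mult power_mult_distrib mult.assoc)
      then show "(\<lambda>N. (cmod (S N \<zeta>))\<^sup>2) \<longlonglongrightarrow> (cmod (f (complex_of_real r * \<zeta>)))\<^sup>2"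
        unfolding S_def sums_def by (intro tendsto_intros)
    qed
    show "AE \<zeta> in circle_measure. norm ((cmod (S N \<zeta>))\<^sup>2) \<le> (\<Sum>n. cmod (b n))\<^sup>2" for N
      by (rule AE_I2) (auto intro!: power_mono bound)
  qed auto
  then show ?thesis
    by (simp add: part sums_def b_def norm_mult norm_power power_mult_distrib r mult.commute[of 2]
        flip: power_mult)
qed

text \<open>Tannery's theorem with the squared coefficients as dominating series: the norm is the
  limit of the integral means, the link between coefficients and the values of a function near the
  circle.\<close>

lemma tendsto_dilation_norm:
  assumes g: "g \<in> H2" and r: "\<And>k. 0 \<le> r k" "\<And>k. r k < 1" "r \<longlonglongrightarrow> 1"
  shows "(\<lambda>k::nat. LINT \<zeta>|circle_measure. (cmod (g (complex_of_real (r k) * \<zeta>)))\<^sup>2) \<longlonglongrightarrow> (H2_norm g)\<^sup>2"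
proof -
  have "(\<lambda>k. \<Sum>n. (cmod (taylor_coeff g n))\<^sup>2 * r k ^ (2 * n)) \<longlonglongrightarrow> (\<Sum>n. (cmod (taylor_coeff g n))\<^sup>2)"
  proof (rule tannerys_theorem[THEN conjunct2, THEN conjunct2])
    show "(\<lambda>k. (cmod (taylor_coeff g n))\<^sup>2 * r k ^ (2 * n)) \<longlonglongrightarrow> (cmod (taylor_coeff g n))\<^sup>2" for n
      by (rule tendsto_eq_intros r refl)+ simp
    show "\<forall>\<^sub>F (n, k) in at_top \<times>\<^sub>F sequentially.
        norm ((cmod (taylor_coeff g n))\<^sup>2 * r k ^ (2 * n)) \<le> (cmod (taylor_coeff g n))\<^sup>2"
      using r(1) less_imp_le[OF r(2)]
      by (intro always_eventually) (auto simp: abs_mult intro!: mult_left_le power_le_one)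
    show "summable (\<lambda>n. (cmod (taylor_coeff g n))\<^sup>2)" using H2_taylor_coeff_l2[OF g] by (simp add: l2_iff)
  qed auto
  moreover have "(\<Sum>n. (cmod (taylor_coeff g n))\<^sup>2 * r k ^ (2 * n))
      = (LINT \<zeta>|circle_measure. (cmod (g (complex_of_real (r k) * \<zeta>)))\<^sup>2)" for k
    using parseval_dilation[OF H2_holomorphic[OF g] r(1,2)] by (simp add: sums_iff)
  ultimately show ?thesis by (simp add: H2_norm_l2 g l2_norm_square H2_taylor_coeff_l2)
qed

text \<open>Parseval at radius \<open>r\<close> bounds each partial sum of the squared coefficients
  by a constant independent of \<open>r\<close> and \<open>N\<close>; let \<open>r\<close> tend to 1
  in the finite sum, then \<open>N\<close> grow. The bound \<open>C\<close> is left general because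
  \<open>cmod (u z) \<le> 1\<close> is derived later from this lemma.\<close>

lemma
  assumes u: "u holomorphic_on ball 0 1" "\<And>z. z \<in> ball 0 1 \<Longrightarrow> cmod (u z) \<le> C" and f: "f \<in> H2"
  shows H2_mult: "(\<lambda>z. u z * f z) \<in> H2"
    and H2_norm_mult_le: "H2_norm (\<lambda>z. u z * f z) \<le> C * H2_norm f"
proof -
  let ?g = "\<lambda>z. u z * f z"
  have hol: "?g holomorphic_on ball 0 1" by (intro holomorphic_on_mult u(1) H2_holomorphic[OF f])
  have C: "0 \<le> C" using order_trans[OF norm_ge_zero u(2)[of 0]] by simp
  have le: "(\<Sum>n<N. (cmod (taylor_coeff ?g n))\<^sup>2 * r ^ (2 * n)) \<le> C\<^sup>2 * (H2_norm f)\<^sup>2"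
    if r: "0 \<le> r" "r < 1" for r N
  proof -
    note pg = parseval_dilation[OF hol r] and pf = parseval_dilation[OF H2_holomorphic[OF f] r]
    have "(\<Sum>n<N. (cmod (taylor_coeff ?g n))\<^sup>2 * r ^ (2 * n))
        \<le> (LINT \<zeta>|circle_measure. (cmod (?g (complex_of_real r * \<zeta>)))\<^sup>2)"
      using sum_le_suminf[OF sums_summable[OF pg], of "{..<N}"] sums_unique[OF pg] r(1) by simp
    also have "\<dots> \<le> (LINT \<zeta>|circle_measure. C\<^sup>2 * (cmod (f (complex_of_real r * \<zeta>)))\<^sup>2)"
    proof (intro integral_mono integrable_circle_continuous continuous_intros continuous_on_dilation
        u(1) H2_holomorphic f r)
      fix \<zeta> assume "\<zeta> \<in> space circle_measure"
      then have "complex_of_real r * \<zeta> \<in> ball 0 1" using r by (simp add: norm_mult)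
      then show "(cmod (?g (complex_of_real r * \<zeta>)))\<^sup>2 \<le> C\<^sup>2 * (cmod (f (complex_of_real r * \<zeta>)))\<^sup>2"
        using u(2) C by (simp add: norm_mult power_mult_distrib mult_right_mono power_mono)
    qed
    also have "\<dots> = C\<^sup>2 * (\<Sum>n. (cmod (taylor_coeff f n))\<^sup>2 * r ^ (2 * n))"
      using pf by (simp add: sums_iff)
    also have "\<dots> \<le> C\<^sup>2 * (\<Sum>n. (cmod (taylor_coeff f n))\<^sup>2)"
      using pf r H2_taylor_coeff_l2[OF f]
      by (intro mult_left_mono suminf_le) (auto simp: sums_iff l2_iff intro!: mult_left_le power_le_one)
    finally show ?thesis by (simp add: H2_norm_l2 f l2_norm_square H2_taylor_coeff_l2)
  qed
  have le1: "(\<Sum>n<N. (cmod (taylor_coeff ?g n))\<^sup>2) \<le> C\<^sup>2 * (H2_norm f)\<^sup>2" for N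
  proof (rule tendsto_upperbound)
    show "((\<lambda>r. \<Sum>n<N. (cmod (taylor_coeff ?g n))\<^sup>2 * r ^ (2 * n)) \<longlongrightarrow> (\<Sum>n<N. (cmod (taylor_coeff ?g n))\<^sup>2)) (at_left (1::real))"
      by (rule tendsto_eq_intros refl)+ simp
    show "\<forall>\<^sub>F r in at_left (1::real). (\<Sum>n<N. (cmod (taylor_coeff ?g n))\<^sup>2 * r ^ (2 * n)) \<le> C\<^sup>2 * (H2_norm f)\<^sup>2"
      using eventually_at_left_real[of 0 1] by (rule eventually_mono) (use le in auto)
  qed auto
  have sm: "summable (\<lambda>n. (cmod (taylor_coeff ?g n))\<^sup>2)"
    by (rule summableI_nonneg_bounded[OF _ le1]) simp
  then show g: "?g \<in> H2"
    using hol f by (auto simp: H2_iff l2_iff)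
  have "(H2_norm ?g)\<^sup>2 \<le> (C * H2_norm f)\<^sup>2"
    using suminf_le_const[OF sm le1]
    by (simp add: H2_norm_l2 g l2_norm_square H2_taylor_coeff_l2 power_mult_distrib)
  then show "H2_norm ?g \<le> C * H2_norm f"
    by (rule power2_le_imp_le) (simp add: C H2_norm_l2 f)
qed

subsection \<open>Multiplication by an inner function\<close>

text \<open>The integral means of \<open>u * f\<close> and \<open>f\<close> differ by the integral
  of \<open>((cmod u)\<^sup>2 - 1) * (cmod f)\<^sup>2\<close>. The first factor tends to 0 almost
  everywhere and the second stays below \<open>K\<^sup>2\<close>, so dominated convergence equates
  the norms.\<close>

lemma H2_norm_mult_inner_bounded:
  assumes u: "inner_function u" and f: "f \<in> H2" "\<And>z. z \<in> ball 0 1 \<Longrightarrow> cmod (f z) \<le> K"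
  shows "H2_norm (\<lambda>z. u z * f z) = H2_norm f"
proof -
  interpret finite_measure circle_measure by (rule finite_measure_circle_measure)
  have "bounded (u ` ball 0 1)" using u by (simp add: inner_function_def)
  then obtain C where C: "\<And>z. z \<in> ball 0 1 \<Longrightarrow> cmod (u z) \<le> C"
    unfolding bounded_iff by blast
  have hol: "u holomorphic_on ball 0 1" using u by (simp add: inner_function_def)
  let ?g = "\<lambda>z. u z * f z"
  have g: "?g \<in> H2" using H2_mult[OF hol C f(1)] .
  \<comment> \<open>A sequence of radii in place of the filter \<open>at_left 1\<close>, since
    dominated convergence is about sequences.\<close>
  define r where "r k = 1 - 1 / real (k + 2)" for k
  have r: "0 \<le> r k" "r k < 1" for k by (auto simp: r_def)
  have "(\<lambda>k. 1 - 1 / real (k + 2)) \<longlonglongrightarrow> 1 - 0"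
    by (intro tendsto_diff tendsto_const LIMSEQ_ignore_initial_segment lim_1_over_n)
  then have r1: "r \<longlonglongrightarrow> 1" by (simp add: r_def[abs_def])
  have in_ball: "complex_of_real (r k) * \<zeta> \<in> ball 0 1" if "\<zeta> \<in> space circle_measure" for k \<zeta>
    using that r[of k] by (simp add: norm_mult)
  have "(\<lambda>k. LINT \<zeta>|circle_measure. ((cmod (u (complex_of_real (r k) * \<zeta>)))\<^sup>2 - 1)
      * (cmod (f (complex_of_real (r k) * \<zeta>)))\<^sup>2) \<longlonglongrightarrow> (LINT \<zeta>|circle_measure. 0)"
  proof (rule integral_dominated_convergence[where w = "\<lambda>_. (C\<^sup>2 + 1) * K\<^sup>2"])
    show "(\<lambda>\<zeta>. ((cmod (u (complex_of_real (r k) * \<zeta>)))\<^sup>2 - 1) * (cmod (f (complex_of_real (r k) * \<zeta>)))\<^sup>2)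
        \<in> borel_measurable circle_measure" for k
      by (intro borel_measurable_integrable integrable_circle_continuous continuous_intros
          continuous_on_dilation hol H2_holomorphic f r)
    have "AE \<zeta> in circle_measure. \<exists>w. cmod w = 1 \<and>
        ((\<lambda>r::real. u (complex_of_real r * \<zeta>)) \<longlongrightarrow> w) (at_left 1)"
      using u by (simp add: inner_function_def)
    then show "AE \<zeta> in circle_measure. (\<lambda>k. ((cmod (u (complex_of_real (r k) * \<zeta>)))\<^sup>2 - 1)
        * (cmod (f (complex_of_real (r k) * \<zeta>)))\<^sup>2) \<longlonglongrightarrow> 0"
    proof (rule AE_mp, intro AE_I2 impI)
      fix \<zeta> assume \<zeta>: "\<zeta> \<in> space circle_measure"
        and "\<exists>w. cmod w = 1 \<and> ((\<lambda>r::real. u (complex_of_real r * \<zeta>)) \<longlongrightarrow> w) (at_left 1)"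
      then obtain w where w: "cmod w = 1" "((\<lambda>r::real. u (complex_of_real r * \<zeta>)) \<longlongrightarrow> w) (at_left 1)"
        by blast
      have "filterlim r (at_left 1) sequentially"
        using r1 r by (auto simp: filterlim_at less_imp_neq)
      from filterlim_compose[OF w(2) this]
      have "(\<lambda>k. u (complex_of_real (r k) * \<zeta>)) \<longlonglongrightarrow> w" .
      then have "(\<lambda>k. \<bar>(cmod (u (complex_of_real (r k) * \<zeta>)))\<^sup>2 - 1\<bar> * K\<^sup>2) \<longlonglongrightarrow> \<bar>(cmod w)\<^sup>2 - 1\<bar> * K\<^sup>2"
        by (intro tendsto_intros)
      then have lim: "(\<lambda>k. \<bar>(cmod (u (complex_of_real (r k) * \<zeta>)))\<^sup>2 - 1\<bar> * K\<^sup>2) \<longlonglongrightarrow> 0"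
        by (simp add: w(1))
      show "(\<lambda>k. ((cmod (u (complex_of_real (r k) * \<zeta>)))\<^sup>2 - 1)
        * (cmod (f (complex_of_real (r k) * \<zeta>)))\<^sup>2) \<longlonglongrightarrow> 0"
      proof (rule Lim_null_comparison[OF always_eventually lim], rule allI)
        fix k show "norm (((cmod (u (complex_of_real (r k) * \<zeta>)))\<^sup>2 - 1) * (cmod (f (complex_of_real (r k) * \<zeta>)))\<^sup>2)
            \<le> \<bar>(cmod (u (complex_of_real (r k) * \<zeta>)))\<^sup>2 - 1\<bar> * K\<^sup>2"
          using f(2)[OF in_ball[OF \<zeta>]] by (auto simp: abs_mult intro!: mult_left_mono power_mono)
      qed
    qed
    show "AE \<zeta> in circle_measure. norm (((cmod (u (complex_of_real (r k) * \<zeta>)))\<^sup>2 - 1)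
        * (cmod (f (complex_of_real (r k) * \<zeta>)))\<^sup>2) \<le> (C\<^sup>2 + 1) * K\<^sup>2" for k
    proof (rule AE_I2)
      fix \<zeta> assume \<zeta>: "\<zeta> \<in> space circle_measure"
      have "(cmod (u (complex_of_real (r k) * \<zeta>)))\<^sup>2 \<le> C\<^sup>2" "(cmod (f (complex_of_real (r k) * \<zeta>)))\<^sup>2 \<le> K\<^sup>2"
        using C[OF in_ball[OF \<zeta>]] f(2)[OF in_ball[OF \<zeta>]] by (auto intro!: power_mono)
      moreover from this(1) have "\<bar>(cmod (u (complex_of_real (r k) * \<zeta>)))\<^sup>2 - 1\<bar> \<le> C\<^sup>2 + 1"
        using zero_le_power2[of "cmod (u (complex_of_real (r k) * \<zeta>))"] by linarith
      ultimately show "norm (((cmod (u (complex_of_real (r k) * \<zeta>)))\<^sup>2 - 1)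
        * (cmod (f (complex_of_real (r k) * \<zeta>)))\<^sup>2) \<le> (C\<^sup>2 + 1) * K\<^sup>2"
        by (auto simp: abs_mult intro!: mult_mono)
    qed
  qed auto
  moreover have "(LINT \<zeta>|circle_measure. ((cmod (u (complex_of_real (r k) * \<zeta>)))\<^sup>2 - 1)
      * (cmod (f (complex_of_real (r k) * \<zeta>)))\<^sup>2)
    = (LINT \<zeta>|circle_measure. (cmod (?g (complex_of_real (r k) * \<zeta>)))\<^sup>2)
      - (LINT \<zeta>|circle_measure. (cmod (f (complex_of_real (r k) * \<zeta>)))\<^sup>2)" for k
    by (subst Bochner_Integration.integral_diff [symmetric],
        (intro integrable_circle_continuous continuous_intros continuous_on_dilation
          hol H2_holomorphic f r g)+)
      (simp add: norm_mult power_mult_distrib left_diff_distrib)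
  ultimately have "(\<lambda>k. (LINT \<zeta>|circle_measure. (cmod (?g (complex_of_real (r k) * \<zeta>)))\<^sup>2)
      - (LINT \<zeta>|circle_measure. (cmod (f (complex_of_real (r k) * \<zeta>)))\<^sup>2)) \<longlonglongrightarrow> 0" by simp
  moreover have "(\<lambda>k. (LINT \<zeta>|circle_measure. (cmod (?g (complex_of_real (r k) * \<zeta>)))\<^sup>2)
      - (LINT \<zeta>|circle_measure. (cmod (f (complex_of_real (r k) * \<zeta>)))\<^sup>2)) \<longlonglongrightarrow> (H2_norm ?g)\<^sup>2 - (H2_norm f)\<^sup>2"
    by (intro tendsto_diff tendsto_dilation_norm g f r r1)
  ultimately have "(H2_norm ?g)\<^sup>2 - (H2_norm f)\<^sup>2 = 0" using LIMSEQ_unique by blast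
  then show ?thesis by (simp add: H2_norm_l2 g f)
qed

section \<open>Preservation of inner products and the bound on an inner function\<close>

lemma inner_function_holomorphic: "inner_function u \<Longrightarrow> u holomorphic_on ball 0 1"
  by (simp add: inner_function_def)

lemma inner_function_bounded:
  assumes "inner_function u" obtains C where "\<And>z. z \<in> ball 0 1 \<Longrightarrow> cmod (u z) \<le> C"
proof -
  have "bounded (u ` ball 0 1)" using assms by (simp add: inner_function_def)
  then show thesis using that unfolding bounded_iff by blast
qed

lemma H2_mult_inner: "inner_function u \<Longrightarrow> f \<in> H2 \<Longrightarrow> (\<lambda>z. u z * f z) \<in> H2"
  by (metis inner_function_bounded inner_function_holomorphic H2_mult)

text \<open>Polarisation of the norm identity, applied to the coefficient sequences; boundedness
  passes to the combinations \<open>f + c * g\<close>.\<close>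

lemma H2_inner_mult_inner_bounded:
  assumes u: "inner_function u" and f: "f \<in> H2" "\<And>z. z \<in> ball 0 1 \<Longrightarrow> cmod (f z) \<le> K"
    and g: "g \<in> H2" "\<And>z. z \<in> ball 0 1 \<Longrightarrow> cmod (g z) \<le> L"
  shows "H2_inner (\<lambda>z. u z * f z) (\<lambda>z. u z * g z) = H2_inner f g"
proof -
  note hol = inner_function_holomorphic[OF u]
  have "H2_norm (\<lambda>z. u z * (f z + c * g z)) = H2_norm (\<lambda>z. f z + c * g z)" for c
  proof (rule H2_norm_mult_inner_bounded[OF u])
    show "(\<lambda>z. f z + c * g z) \<in> H2" using f g by (intro H2_add H2_cmult)
    show "cmod (f z + c * g z) \<le> K + cmod c * L" if "z \<in> ball 0 1" for z
      using f(2)[OF that] g(2)[OF that]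
      by (intro order_trans[OF norm_triangle_ineq]) (auto simp: norm_mult intro!: add_mono mult_left_mono)
  qed
  then have "H2_norm (\<lambda>z. u z * f z + c * (u z * g z)) = H2_norm (\<lambda>z. f z + c * g z)" for c
    by (simp add: algebra_simps)
  then show ?thesis
    using f(1) g(1) H2_mult_inner[OF u f(1)] H2_mult_inner[OF u g(1)]
    by (simp add: H2_inner_l2 H2_norm_l2 H2_add H2_cmult taylor_coeff_add taylor_coeff_cmult
        H2_holomorphic holomorphic_on_mult hol L2_polarization H2_taylor_coeff_l2)
qed

text \<open>One factor stays bounded because it will always be a Szego kernel; the other is
  approximated by bounded functions, and multiplication by \<open>u\<close> is continuous.\<close>

lemma H2_inner_mult_inner:
  assumes u: "inner_function u" and f: "f \<in> H2" "\<And>z. z \<in> ball 0 1 \<Longrightarrow> cmod (f z) \<le> K"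
    and h: "h \<in> H2"
  shows "H2_inner (\<lambda>z. u z * h z) (\<lambda>z. u z * f z) = H2_inner h f"
proof -
  obtain C where C: "\<And>z. z \<in> ball 0 1 \<Longrightarrow> cmod (u z) \<le> C"
    by (rule inner_function_bounded[OF u], rule that)
  obtain H L where H: "\<And>n::nat. H n \<in> H2" "\<And>n z. z \<in> ball 0 1 \<Longrightarrow> cmod (H n z) \<le> L n"
    and lim: "(\<lambda>n. H2_norm (\<lambda>z. H n z - h z)) \<longlonglongrightarrow> 0"
    by (rule H2_approx_bounded[OF h], rule that)
  have eq: "H2_inner (\<lambda>z. u z * H n z) (\<lambda>z. u z * f z) = H2_inner (H n) f" for n
    by (rule H2_inner_mult_inner_bounded[OF u H(1) H(2) f])
  have "(\<lambda>n. H2_norm (\<lambda>z. u z * H n z - u z * h z)) \<longlonglongrightarrow> 0"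
  proof (rule tendsto_sandwich[OF _ _ tendsto_const])
    show "(\<lambda>n. C * H2_norm (\<lambda>z. H n z - h z)) \<longlonglongrightarrow> 0"
      by (rule tendsto_mult_right_zero[OF lim])
    have "H2_norm (\<lambda>z. u z * (H n z - h z)) \<le> C * H2_norm (\<lambda>z. H n z - h z)" for n
      by (intro H2_norm_mult_le inner_function_holomorphic u C H2_diff H h)
    then show "\<forall>\<^sub>F n in sequentially. H2_norm (\<lambda>z. u z * H n z - u z * h z) \<le> C * H2_norm (\<lambda>z. H n z - h z)"
      by (simp add: right_diff_distrib)
    show "\<forall>\<^sub>F n in sequentially. 0 \<le> H2_norm (\<lambda>z. u z * H n z - u z * h z)"
      by (simp add: H2_norm_l2 H2_diff H2_mult_inner u H h)
  qed
  then have "(\<lambda>n. H2_inner (\<lambda>z. u z * H n z) (\<lambda>z. u z * f z)) \<longlonglongrightarrow> H2_inner (\<lambda>z. u z * h z) (\<lambda>z. u z * f z)"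
    by (intro H2_inner_tendsto H2_mult_inner u H h f)
  moreover have "(\<lambda>n. H2_inner (H n) f) \<longlonglongrightarrow> H2_inner h f"
    by (intro H2_inner_tendsto lim H h f)
  ultimately show ?thesis by (simp add: eq LIMSEQ_unique)
qed

lemma szego_kernel_bounded:
  assumes "w \<in> ball 0 1" "z \<in> ball 0 1" shows "cmod (szego_kernel w z) \<le> 1 / (1 - cmod w)"
proof -
  have "cmod (cnj w * z) \<le> cmod w" using assms by (simp add: norm_mult mult_left_le)
  then have "1 - cmod w \<le> cmod (1 - cnj w * z)"
    using norm_triangle_ineq2[of 1 "cnj w * z"] by simp
  then show ?thesis using assms
    by (simp add: szego_kernel_def on_disk_def norm_divide frac_le)
qed

text \<open>With \<open>k\<close> the Szego kernel at \<open>w\<close>, the inner product of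
  \<open>u * k\<close> with \<open>k\<close> is \<open>u w * k w\<close>, of modulus at most
  \<open>H2_norm (u * k) * H2_norm k\<close>. By the isometry this is the squared norm of
  \<open>k\<close>, which equals \<open>cmod (k w)\<close>.\<close>

lemma inner_function_le_1:
  assumes u: "inner_function u" and w: "w \<in> ball 0 1" shows "cmod (u w) \<le> 1"
proof -
  let ?k = "szego_kernel w"
  note k = szego_kernel_H2[OF w]
  have kk: "H2_inner ?k ?k = 1 / (1 - cnj w * w)"
    using w by (simp only: H2_inner_szego_kernel[OF k w]) (simp add: szego_kernel_def on_disk_def)
  have pos: "H2_norm ?k > 0"
  proof -
    have "H2_norm ?k \<noteq> 0"
    proof
      assume "H2_norm ?k = 0"
      then have "H2_inner ?k ?k = 0" using H2_Cauchy_Schwarz[OF k k] by simp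
      moreover have "cmod (cnj w * w) < 1" by (rule cmod_mult_less_1) (use w in auto)
      ultimately show False using kk by auto
    qed
    then show ?thesis by (simp add: H2_norm_l2 k order_less_le)
  qed
  have iso: "H2_norm (\<lambda>z. u z * ?k z) = H2_norm ?k"
    by (rule H2_norm_mult_inner_bounded[OF u k szego_kernel_bounded[OF w]])
  have le: "cmod (u w * ?k w) \<le> H2_norm (\<lambda>z. u z * ?k z) * H2_norm ?k"
    using H2_Cauchy_Schwarz[OF H2_mult_inner[OF u k] k]
    by (simp only: H2_inner_szego_kernel[OF H2_mult_inner[OF u k] w])
  have eq: "H2_norm ?k * H2_norm ?k = cmod (?k w)"
  proof -
    have "H2_inner ?k ?k = complex_of_real ((H2_norm ?k)\<^sup>2)"
      by (simp add: H2_inner_l2 H2_norm_l2 k L2_inner_self)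
    then have "?k w = complex_of_real ((H2_norm ?k)\<^sup>2)" by (simp only: H2_inner_szego_kernel[OF k w])
    then show ?thesis by (simp add: norm_power power2_eq_square norm_mult del: of_real_power)
  qed
  have "cmod (?k w) > 0" using eq pos by (metis mult_pos_pos)
  moreover have "cmod (u w) * cmod (?k w) \<le> 1 * cmod (?k w)" using le by (simp add: iso eq norm_mult)
  ultimately show ?thesis by (simp only: mult_le_cancel_right_pos)
qed

lemma inner_function_less_1:
  assumes u: "inner_function u" "\<not> u constant_on ball 0 1" and w: "w \<in> ball 0 1"
  shows "cmod (u w) < 1"
proof (rule ccontr)
  assume "\<not> cmod (u w) < 1"
  then have "cmod (u w) = 1" using inner_function_le_1[OF u(1) w] by simp
  then have "u constant_on ball 0 1"
    by (intro maximum_modulus_principle[of u "ball 0 1" "ball 0 1" w])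
      (use inner_function_le_1[OF u(1)] w inner_function_holomorphic[OF u(1)] in auto)
  then show False using u(2) by simp
qed

subsection \<open>The model space\<close>

lemma model_space_H2: "f \<in> model_space u \<Longrightarrow> f \<in> H2"
  by (simp add: model_space_def)

lemma model_space_add:
  "inner_function u \<Longrightarrow> f \<in> model_space u \<Longrightarrow> g \<in> model_space u \<Longrightarrow> (\<lambda>z. f z + g z) \<in> model_space u"
  by (simp add: model_space_def H2_add H2_inner_add_left H2_mult_inner)

lemma model_space_diff:
  "inner_function u \<Longrightarrow> f \<in> model_space u \<Longrightarrow> g \<in> model_space u \<Longrightarrow> (\<lambda>z. f z - g z) \<in> model_space u"
  by (simp add: model_space_def H2_diff H2_inner_diff_left H2_mult_inner)

lemma model_space_cmult:
  "inner_function u \<Longrightarrow> f \<in> model_space u \<Longrightarrow> (\<lambda>z. c * f z) \<in> model_space u"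
  by (simp add: model_space_def H2_cmult H2_inner_cmult_left H2_mult_inner)

lemma model_space_zero: "inner_function u \<Longrightarrow> (\<lambda>z. 0) \<in> model_space u"
  using H2_inner_cmult_left[OF H2_zero, of _ 0] H2_zero
  by (simp add: model_space_def H2_mult_inner)

lemma model_space_closed:
  assumes u: "inner_function u" and F: "\<And>n::nat. F n \<in> model_space u"
    and f: "f \<in> H2" "(\<lambda>n. H2_norm (\<lambda>z. F n z - f z)) \<longlonglongrightarrow> 0"
  shows "f \<in> model_space u"
  unfolding model_space_def
proof (intro CollectI conjI ballI f)
  fix h assume h: "h \<in> H2"
  have "(\<lambda>n. H2_inner (F n) (\<lambda>z. u z * h z)) \<longlonglongrightarrow> H2_inner f (\<lambda>z. u z * h z)"
    by (intro H2_inner_tendsto model_space_H2[OF F] f H2_mult_inner u h)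
  moreover have "H2_inner (F n) (\<lambda>z. u z * h z) = 0" for n
    using F h by (simp add: model_space_def)
  ultimately show "H2_inner f (\<lambda>z. u z * h z) = 0" by (simp add: LIMSEQ_const_iff)
qed

text \<open>The reproducing kernel \<open>(1 - cnj (u w) * u z) / (1 - cnj w * z)\<close> of the
  model space, split into Szego kernels so that its inner products reduce to point
  evaluations.\<close>

definition model_kernel :: "(complex \<Rightarrow> complex) \<Rightarrow> complex \<Rightarrow> complex \<Rightarrow> complex" where
  "model_kernel u w = (\<lambda>z. szego_kernel w z - cnj (u w) * (u z * szego_kernel w z))"

text \<open>Against \<open>u * h\<close> the first term gives \<open>u w * h w\<close> by
  reproduction, and the second gives the same value because multiplication by \<open>u\<close>
  preserves inner products.\<close>

lemma model_kernel_in_model_space: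
  assumes u: "inner_function u" and w: "w \<in> ball 0 1"
  shows "model_kernel u w \<in> model_space u"
proof -
  note k = szego_kernel_H2[OF w]
  have uk: "(\<lambda>z. u z * szego_kernel w z) \<in> H2" by (rule H2_mult_inner[OF u k])
  have "H2_inner (model_kernel u w) (\<lambda>z. u z * h z) = 0" if h: "h \<in> H2" for h
  proof -
    have uh: "(\<lambda>z. u z * h z) \<in> H2" by (rule H2_mult_inner[OF u h])
    have "H2_inner (\<lambda>z. u z * h z) (\<lambda>z. u z * szego_kernel w z) = h w"
      using H2_inner_mult_inner[OF u k szego_kernel_bounded[OF w] h] by (simp only: H2_inner_szego_kernel[OF h w])
    moreover have "H2_inner (\<lambda>z. u z * h z) (szego_kernel w) = u w * h w"
      by (rule H2_inner_szego_kernel[OF uh w])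
    ultimately have "H2_inner (\<lambda>z. u z * h z) (model_kernel u w) = 0"
      by (simp add: model_kernel_def H2_inner_diff_right H2_inner_cmult_right k uk uh H2_cmult)
    moreover have "model_kernel u w \<in> H2" unfolding model_kernel_def by (intro H2_diff H2_cmult k uk)
    ultimately show ?thesis using H2_inner_cnj[OF uh] by simp
  qed
  moreover have "model_kernel u w \<in> H2" unfolding model_kernel_def by (intro H2_diff H2_cmult k uk)
  ultimately show ?thesis by (simp add: model_space_def)
qed

lemma H2_inner_model_kernel:
  assumes u: "inner_function u" and f: "f \<in> model_space u" and w: "w \<in> ball 0 1"
  shows "H2_inner f (model_kernel u w) = f w"
proof -
  note k = szego_kernel_H2[OF w]
  have uk: "(\<lambda>z. u z * szego_kernel w z) \<in> H2" by (rule H2_mult_inner[OF u k])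
  have "H2_inner f (\<lambda>z. u z * szego_kernel w z) = 0" using f k by (simp add: model_space_def)
  then show ?thesis
    by (simp add: model_kernel_def H2_inner_diff_right H2_inner_cmult_right k uk model_space_H2[OF f]
        H2_cmult H2_inner_szego_kernel[OF model_space_H2[OF f] w])
qed

text \<open>Elements of the model space are orthogonal to \<open>u\<close>, but the inner product of
  this function with \<open>u\<close> is \<open>a * (cnj (u 0) - cnj \<alpha>)\<close>, and
  \<open>cmod (u 0) < 1 = cmod \<alpha>\<close>.\<close>

lemma one_minus_inner_notin_model_space:
  assumes u: "inner_function u" "\<not> u constant_on ball 0 1" and \<alpha>: "cmod \<alpha> = 1"
    and mem: "on_disk (\<lambda>z. a * (1 - cnj \<alpha> * u z)) \<in> model_space u"
  shows "a = 0"
proof -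
  \<comment> \<open>The Szego kernel at 0 is the constant 1 on the disk; multiplying by it makes
    \<open>u\<close> vanish outside the disk, as \<open>H2\<close> demands.\<close>
  define o1 where "o1 = szego_kernel 0"
  have o1: "o1 \<in> H2" by (simp add: o1_def szego_kernel_H2)
  have o1_eq: "o1 z = (if z \<in> ball 0 1 then 1 else 0)" for z by (simp add: o1_def szego_kernel_def on_disk_def)
  have uo: "(\<lambda>z. u z * o1 z) \<in> H2" by (rule H2_mult_inner[OF u(1) o1])
  have 1: "H2_inner o1 (\<lambda>z. u z * o1 z) = cnj (u 0)"
    using H2_inner_cnj[OF uo o1] H2_inner_szego_kernel[OF uo, of 0] by (simp add: o1_def [symmetric] o1_eq)
  have 2: "H2_inner (\<lambda>z. u z * o1 z) (\<lambda>z. u z * o1 z) = 1"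
    using H2_inner_mult_inner[OF u(1) o1 _ o1, of 1] H2_inner_szego_kernel[OF o1, of 0]
    by (simp add: o1_def [symmetric] o1_eq)
  have "on_disk (\<lambda>z. a * (1 - cnj \<alpha> * u z)) = (\<lambda>z. a * (o1 z - cnj \<alpha> * (u z * o1 z)))"
    by (auto simp: on_disk_def o1_eq)
  then have "H2_inner (\<lambda>z. a * (o1 z - cnj \<alpha> * (u z * o1 z))) (\<lambda>z. u z * o1 z) = 0"
    using mem o1 by (auto simp: model_space_def)
  then have "a * (cnj (u 0) - cnj \<alpha>) = 0"
    by (simp add: H2_inner_cmult_left H2_inner_diff_left H2_diff H2_cmult o1 uo 1 2)
  moreover have "cmod (cnj (u 0)) \<noteq> cmod (cnj \<alpha>)"
    using inner_function_less_1[OF u, of 0] \<alpha> by simp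
  ultimately show ?thesis by auto
qed

subsection \<open>Finite measures on the circle\<close>

locale circle_finite_measure = finite_measure M for M :: "complex measure" +
  assumes sets_M: "sets M = sets borel_circle"
begin

lemma space_M [simp]: "space M = sphere 0 1"
  using sets_eq_imp_space_eq[OF sets_M] by (simp add: space_restrict_space)

lemma measurable_M: "h \<in> borel_measurable borel_circle \<Longrightarrow> h \<in> borel_measurable M"
  by (simp add: measurable_cong_sets[OF sets_M refl])

lemma continuous_measurable_M:
  fixes h :: "complex \<Rightarrow> 'b :: topological_space"
  shows "continuous_on (sphere 0 1) h \<Longrightarrow> h \<in> borel_measurable M"
  by (intro measurable_M borel_measurable_continuous_on_restrict)

lemma continuous_bounded_M:
  fixes h :: "complex \<Rightarrow> complex"
  assumes "continuous_on (sphere 0 1) h"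
  obtains B where "\<And>x. x \<in> sphere 0 1 \<Longrightarrow> norm (h x) \<le> B"
proof -
  have "compact (h ` sphere 0 1)" by (intro compact_continuous_image assms) auto
  then obtain B where B: "\<And>x. x \<in> sphere 0 1 \<Longrightarrow> norm (h x) \<le> B"
    by (meson compact_imp_bounded bounded_iff imageI)
  then show ?thesis by (rule that)
qed

lemma L2_continuous_mult:
  assumes "continuous_on (sphere 0 1) h" "f \<in> L2 M"
  shows "(\<lambda>x. h x * f x) \<in> L2 M"
proof -
  obtain B where "\<And>x. x \<in> sphere 0 1 \<Longrightarrow> norm (h x) \<le> B"
    using continuous_bounded_M[OF assms(1)] by metis
  then show ?thesis
    by (intro L2_mult_bounded[of _ _ _ B] continuous_measurable_M assms) auto
qed

lemma L2_const: "(\<lambda>x. c) \<in> L2 M"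
  by (simp add: L2_def)

lemma L2_continuous: "continuous_on (sphere 0 1) h \<Longrightarrow> h \<in> L2 M"
  using L2_continuous_mult[of h "\<lambda>x. 1"] L2_const[of 1] by simp

lemma L2_integrable: "f \<in> L2 M \<Longrightarrow> integrable M f"
  using L2_inner_integrable[of f M "\<lambda>x. 1"] L2_const[of 1] by simp

text \<open>Indicators of closed sets are pointwise limits of continuous functions, and closed sets
  form an intersection-stable generator of the Borel sets. So \<open>f\<close> integrates to zero
  over every measurable set.\<close>

lemma AE_zero_of_continuous_integrals:
  fixes f :: "complex \<Rightarrow> complex"
  assumes f: "integrable M f"
    and zero: "\<And>\<phi>. continuous_on UNIV \<phi> \<Longrightarrow> (LINT x|M. complex_of_real (\<phi> x) * f x) = 0"
  shows "AE x in M. f x = 0"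
proof -
  \<comment> \<open>Indexing by Borel sets of the plane and intersecting with the circle afterwards
    keeps the closed sets of the plane as generator.\<close>
  define P where "P B \<longleftrightarrow> (LINT x:(B \<inter> sphere 0 1)|M. f x) = 0" for B
  have int0: "(LINT x|M. f x) = 0" using zero[of "\<lambda>_. 1"] by simp
  have closed: "P C" if C: "closed C" for C
  proof (cases "C = {}")
    case False
    \<comment> \<open>Tent functions that equal 1 on \<open>C\<close> and vanish at distance
      \<open>1 / n\<close> from it and beyond.\<close>
    define \<phi> where "\<phi> n x = max 0 (1 - real n * infdist x C)" for n x
    have cont: "continuous_on UNIV (\<phi> n)" for n
      unfolding \<phi>_def by (intro continuous_intros)
    have lim: "(\<lambda>n. \<phi> n x) \<longlonglongrightarrow> indicator C x" for x
    proof (cases "x \<in> C")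
      case True then show ?thesis by (simp add: \<phi>_def)
    next
      case notin: False
      then have pos: "infdist x C > 0"
        using in_closed_iff_infdist_zero[OF C False] infdist_nonneg[of x C] by (simp add: order_less_le)
      then obtain N where N: "real N * infdist x C > 1" by (metis reals_Archimedean3)
      have "\<phi> n x = 0" if "n \<ge> N" for n
      proof -
        have "real N * infdist x C \<le> real n * infdist x C" using that pos by (intro mult_right_mono) auto
        then show ?thesis using N by (simp add: \<phi>_def max_def)
      qed
      then show ?thesis using notin
        by (auto intro!: tendsto_eventually exI[of _ N] simp: eventually_sequentially)
    qed
    have "(\<lambda>n. LINT x|M. complex_of_real (\<phi> n x) * f x) \<longlonglongrightarrow> (LINT x|M. complex_of_real (indicator C x) * f x)"
    proof (rule integral_dominated_convergence[where w = "\<lambda>x. cmod (f x)"])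
      show m: "(\<lambda>x. complex_of_real (\<phi> n x) * f x) \<in> borel_measurable M" for n
        by (rule borel_measurable_times[OF continuous_measurable_M borel_measurable_integrable[OF f]])
          (intro continuous_intros continuous_on_subset[OF cont] subset_UNIV)
      show "(\<lambda>x. complex_of_real (indicator C x) * f x) \<in> borel_measurable M"
        by (rule borel_measurable_LIMSEQ_metric[where f = "\<lambda>n x. complex_of_real (\<phi> n x) * f x", OF m])
          (intro tendsto_intros lim)
      show "AE x in M. (\<lambda>n. complex_of_real (\<phi> n x) * f x) \<longlonglongrightarrow> complex_of_real (indicator C x) * f x"
        by (intro AE_I2 tendsto_intros lim)
      show "AE x in M. norm (complex_of_real (\<phi> n x) * f x) \<le> cmod (f x)" for n
        by (rule AE_I2) (auto simp: norm_mult \<phi>_def infdist_nonneg intro!: mult_left_le_one_le)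
    qed (use f in simp)
    then have "(LINT x|M. complex_of_real (indicator C x) * f x) = 0"
      by (simp add: zero[OF cont] LIMSEQ_const_iff)
    moreover have "(LINT x:(C \<inter> sphere 0 1)|M. f x) = (LINT x|M. complex_of_real (indicator C x) * f x)"
      unfolding set_lebesgue_integral_def
      by (rule Bochner_Integration.integral_cong) (auto split: split_indicator)
    ultimately show ?thesis by (simp add: P_def)
  qed (simp add: P_def set_lebesgue_integral_def)
  have meas: "B \<inter> sphere 0 1 \<in> sets M" if "B \<in> sets borel" for B
    using that unfolding sets_M sets_restrict_space by (auto simp: Int_commute)
  have stable: "Int_stable (Collect (closed :: complex set \<Rightarrow> bool))" by (auto simp: Int_stable_def)
  have P_all: "P B" if "B \<in> sigma_sets UNIV (Collect closed)" for B
    using stable subset_UNIV[of "Collect closed", folded Pow_UNIV] that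
  proof (induction B rule: sigma_sets_induct_disjoint)
    case (basic A) then show ?case using closed by simp
  next
    case empty show ?case by (simp add: P_def set_lebesgue_integral_def)
  next
    case (compl A)
    then have A: "A \<inter> sphere 0 1 \<in> sets M" by (intro meas) (simp add: borel_eq_closed)
    have "(LINT x:((UNIV - A) \<inter> sphere 0 1)|M. f x) = (LINT x|M. f x - indicator (A \<inter> sphere 0 1) x *\<^sub>R f x)"
      unfolding set_lebesgue_integral_def
      by (rule Bochner_Integration.integral_cong) (auto split: split_indicator)
    also have "\<dots> = 0"
      using compl int0 f integrable_mult_indicator[OF A f]
      by (simp add: P_def set_lebesgue_integral_def)
    finally show ?case by (simp add: P_def)
  next
    case (union A)
    have "set_lebesgue_integral M (\<Union>i. A i \<inter> sphere 0 1) f = (\<Sum>i. set_lebesgue_integral M (A i \<inter> sphere 0 1) f)"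
    proof (rule lebesgue_integral_countable_add)
      show A: "A i \<inter> sphere 0 1 \<in> sets M" for i using union by (intro meas) (auto simp: borel_eq_closed)
      show "A i \<inter> sphere 0 1 \<inter> (A j \<inter> sphere 0 1) = {}" if "i \<noteq> j" for i j
        using union that by (auto simp: disjoint_family_on_def)
      have "(\<Union>i. A i \<inter> sphere 0 1) \<in> sets M" by (intro sets.countable_UN image_subsetI A)
      then show "set_integrable M (\<Union>i. A i \<inter> sphere 0 1) f"
        using f unfolding set_integrable_def by (intro integrable_mult_indicator)
    qed
    also have "(\<Union>i. A i \<inter> sphere 0 1) = (\<Union>i. A i) \<inter> sphere 0 1" by auto
    finally show ?case using union by (simp add: P_def)
  qed
  \<comment> \<open>All averages of \<open>f\<close> over measurable sets lie in the closed set
    \<open>{0}\<close>, hence so do almost all of its values.\<close>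
  have "AE x in M. f x \<in> {0}"
  proof (rule averaging_theorem[OF f])
    fix A assume "A \<in> sets M"
    then obtain B where B: "B \<in> sets borel" "A = sphere 0 1 \<inter> B"
      unfolding sets_M sets_restrict_space by auto
    then have "P B" using P_all by (simp add: borel_eq_closed)
    then show "(1 / measure M A) *\<^sub>R set_lebesgue_integral M A f \<in> {0}"
      using B by (simp add: P_def Int_commute)
  qed auto
  then show ?thesis by simp
qed

text \<open>The family \<open>N\<close> is stable under multiplication by polynomials in \<open>\<zeta>\<close> and \<open>cnj \<zeta>\<close>, so the
  Stone-Weierstrass theorem applies.\<close>

lemma AE_zero_of_shift_invariant:
  assumes N_L2: "N \<subseteq> L2 M"
    and N_add: "\<And>f g. f \<in> N \<Longrightarrow> g \<in> N \<Longrightarrow> (\<lambda>x. f x + g x) \<in> N"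
    and N_cmult: "\<And>c f. f \<in> N \<Longrightarrow> (\<lambda>x. c * f x) \<in> N"
    and N_shift: "\<And>f. f \<in> N \<Longrightarrow> (\<lambda>x. x * f x) \<in> N"
    and N_cnj: "\<And>f. f \<in> N \<Longrightarrow> (\<lambda>x. cnj x * f x) \<in> N"
    and N_int: "\<And>f. f \<in> N \<Longrightarrow> (LINT x|M. f x) = 0"
    and f: "f \<in> N"
  shows "AE x in M. f x = 0"
proof (rule AE_zero_of_continuous_integrals)
  show int: "integrable M f" using f N_L2 by (intro L2_integrable) auto
  \<comment> \<open>The function \<open>g\<close> is general so that a product of two polynomials
    can act one factor at a time.\<close>
  have poly: "(\<lambda>x. complex_of_real (p x) * g x) \<in> N"
    if "real_polynomial_function p" "g \<in> N" for p :: "complex \<Rightarrow> real" and g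
    using that
  proof (induction p arbitrary: g rule: real_polynomial_function.induct)
    case (linear h)
    note g = linear(2)
    interpret bounded_linear h by fact
    have h_eq: "h x = Re x * h 1 + Im x * h \<i>" for x
    proof -
      have "x = Re x *\<^sub>R 1 + Im x *\<^sub>R \<i>" by (simp add: complex_eq_iff)
      then have "h x = h (Re x *\<^sub>R 1 + Im x *\<^sub>R \<i>)" by simp
      then show ?thesis by (simp only: add scaleR real_scaleR_def)
    qed
    \<comment> \<open>A real-linear functional on the plane is a complex combination of
      \<open>x\<close> and \<open>cnj x\<close>, the two multipliers under which \<open>N\<close> is
      stable.\<close>
    have decomp: "complex_of_real (h x) = (h 1 - \<i> * h \<i>) / 2 * x + (h 1 + \<i> * h \<i>) / 2 * cnj x" for x
      by (subst h_eq[of x]) (simp add: complex_eq_iff field_simps)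
    have "(\<lambda>x. complex_of_real (h x) * g x)
        = (\<lambda>x. (h 1 - \<i> * h \<i>) / 2 * (x * g x) + (h 1 + \<i> * h \<i>) / 2 * (cnj x * g x))"
      by (rule ext, subst decomp) (simp only: distrib_right mult.assoc)
    then show ?case by (simp only:) (intro N_add N_cmult N_shift N_cnj g)
  next
    case (const c)
    then show ?case by (intro N_cmult)
  next
    case (add p q)
    then show ?case using N_add[of "\<lambda>x. complex_of_real (p x) * g x" "\<lambda>x. complex_of_real (q x) * g x"]
      by (simp add: distrib_right)
  next
    case (mult p q)
    have "(\<lambda>x. complex_of_real (p x) * (complex_of_real (q x) * g x)) \<in> N"
      by (intro mult.IH mult.prems)
    then show ?case by (simp add: mult.assoc)
  qed
  fix \<phi> :: "complex \<Rightarrow> real" assume \<phi>: "continuous_on UNIV \<phi>"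
  have \<phi>s: "continuous_on (sphere 0 1) \<phi>" using \<phi> continuous_on_subset by blast
  define I where "I = (LINT x|M. cmod (f x))"
  have I: "0 \<le> I" unfolding I_def by simp
  have small: "cmod (LINT x|M. complex_of_real (\<phi> x) * f x) \<le> e * I" if e: "e > 0" for e
  proof -
    obtain p where p: "real_polynomial_function p" "\<And>x. x \<in> sphere 0 1 \<Longrightarrow> \<bar>\<phi> x - p x\<bar> < e"
      using Stone_Weierstrass_real_polynomial_function[OF compact_sphere \<phi>s e] by metis
    have pf: "(\<lambda>x. complex_of_real (p x) * f x) \<in> N" by (rule poly[OF p(1) f])
    have \<phi>f: "(\<lambda>x. complex_of_real (\<phi> x) * f x) \<in> L2 M"
      using f N_L2 by (intro L2_continuous_mult continuous_intros \<phi>s) auto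
    have "(LINT x|M. complex_of_real (\<phi> x) * f x)
        = (LINT x|M. complex_of_real (\<phi> x) * f x - complex_of_real (p x) * f x)"
      using N_int[OF pf] pf N_L2 L2_integrable[OF \<phi>f] L2_integrable by (subst Bochner_Integration.integral_diff) auto
    also have "cmod \<dots> \<le> (LINT x|M. e * cmod (f x))"
    proof (rule order_trans[OF integral_norm_bound integral_mono])
      show "integrable M (\<lambda>x. norm (complex_of_real (\<phi> x) * f x - complex_of_real (p x) * f x))"
        using pf \<phi>f N_L2 by (intro integrable_norm Bochner_Integration.integrable_diff L2_integrable) auto
      show "integrable M (\<lambda>x. e * cmod (f x))" using int by simp
      fix x assume "x \<in> space M"
      then have "\<bar>\<phi> x - p x\<bar> * cmod (f x) \<le> e * cmod (f x)"
        using p(2)[of x] by (intro mult_right_mono) auto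
      then show "norm (complex_of_real (\<phi> x) * f x - complex_of_real (p x) * f x) \<le> e * cmod (f x)"
        by (simp add: norm_mult flip: left_diff_distrib of_real_diff)
    qed
    also have "\<dots> = e * I" by (simp add: I_def)
    finally show ?thesis .
  qed
  have "cmod (LINT x|M. complex_of_real (\<phi> x) * f x) \<le> 0"
  proof (rule field_le_epsilon)
    fix e :: real assume e: "e > 0"
    \<comment> \<open>Dividing by \<open>I + 1\<close> rather than \<open>I\<close> covers the case
      \<open>I = 0\<close>.\<close>
    have "cmod (LINT x|M. complex_of_real (\<phi> x) * f x) \<le> e / (I + 1) * I"
      using e I by (intro small) simp
    also have "\<dots> \<le> e" using e I by (simp add: field_simps)
    finally show "cmod (LINT x|M. complex_of_real (\<phi> x) * f x) \<le> 0 + e" by simp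
  qed
  then show "(LINT x|M. complex_of_real (\<phi> x) * f x) = 0" by simp
qed

text \<open>Integrating the geometric series term by term exhibits the moments of \<open>M\<close>
  as Taylor coefficients.\<close>

lemma cauchy_integral_holomorphic:
  "(\<lambda>z. LINT \<zeta>|M. 1 / (1 - cnj \<zeta> * z)) holomorphic_on ball 0 1"
proof (rule power_series_holomorphic[where a = "\<lambda>n. LINT \<zeta>|M. cnj \<zeta> ^ n"])
  fix z :: complex assume z: "z \<in> ball 0 1"
  have int: "integrable M (\<lambda>\<zeta>. cnj \<zeta> ^ n * z ^ n)" for n
    by (intro L2_integrable L2_continuous continuous_intros)
  have "(\<lambda>n. LINT \<zeta>|M. cnj \<zeta> ^ n * z ^ n) sums (LINT \<zeta>|M. (\<Sum>n. cnj \<zeta> ^ n * z ^ n))"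
  proof (rule sums_integral[OF int])
    show "AE \<zeta> in M. summable (\<lambda>n. norm (cnj \<zeta> ^ n * z ^ n))"
      using z by (intro AE_I2) (simp add: norm_mult norm_power summable_geometric)
    have "(LINT \<zeta>|M. norm (cnj \<zeta> ^ n * z ^ n)) = (LINT \<zeta>|M. cmod z ^ n)" for n
      by (rule Bochner_Integration.integral_cong) (auto simp: norm_mult norm_power)
    then show "summable (\<lambda>n. LINT \<zeta>|M. norm (cnj \<zeta> ^ n * z ^ n))"
      using z by (simp add: summable_geometric summable_mult summable_mult2)
  qed
  also have "(LINT \<zeta>|M. (\<Sum>n. cnj \<zeta> ^ n * z ^ n)) = (LINT \<zeta>|M. 1 / (1 - cnj \<zeta> * z))"
  proof (rule Bochner_Integration.integral_cong[OF refl])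
    fix \<zeta> assume "\<zeta> \<in> space M"
    then have "cmod (cnj \<zeta> * z) < 1" using z by (simp add: norm_mult)
    then show "(\<Sum>n. cnj \<zeta> ^ n * z ^ n) = 1 / (1 - cnj \<zeta> * z)"
      using geometric_sums[of "cnj \<zeta> * z"] by (simp add: power_mult_distrib sums_iff)
  qed
  also have "(\<lambda>n. LINT \<zeta>|M. cnj \<zeta> ^ n * z ^ n) = (\<lambda>n. (LINT \<zeta>|M. cnj \<zeta> ^ n) * (z - 0) ^ n)"
    by simp
  finally show "(\<lambda>n. (LINT \<zeta>|M. cnj \<zeta> ^ n) * (z - 0) ^ n) sums (LINT \<zeta>|M. 1 / (1 - cnj \<zeta> * z))" .
qed

end

text \<open>A nonconstant \<open>f\<close> would have an open image, which cannot lie inside the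
  imaginary axis.\<close>

lemma holomorphic_Re_zero_constant:
  assumes "f holomorphic_on ball 0 1" "\<And>z. z \<in> ball 0 1 \<Longrightarrow> Re (f z) = 0"
  shows "f constant_on ball 0 1"
proof (rule ccontr)
  assume "\<not> f constant_on ball 0 1"
  then have "open (f ` ball 0 1)"
    by (intro open_mapping_thm[OF assms(1), of "ball 0 1"]) auto
  then obtain e where e: "e > 0" "ball (f 0) e \<subseteq> f ` ball 0 1"
    by (metis centre_in_ball image_eqI open_contains_ball zero_less_one)
  then have "f 0 + complex_of_real (e / 2) \<in> f ` ball 0 1"
    by (auto simp: dist_norm norm_divide intro!: subsetD[OF e(2)])
  then obtain z where "z \<in> ball 0 1" "f z = f 0 + complex_of_real (e / 2)" by auto
  then have "Re (f z) = Re (f 0) + e / 2" by simp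
  then show False using assms(2)[of z] assms(2)[of 0] \<open>z \<in> ball 0 1\<close> e(1) by simp
qed

subsection \<open>The Clark transform\<close>

text \<open>The formula of \<open>szego_kernel\<close> without the cut-off, because it is used on
  the circle. The conjugation is placed so that the Clark transform is an inner product with this
  kernel.\<close>

definition cauchy_kernel :: "complex \<Rightarrow> complex \<Rightarrow> complex" where
  "cauchy_kernel w \<zeta> = 1 / (1 - cnj w * \<zeta>)"

text \<open>It separates variables and is used twice: in the integrand, where the product of
  \<open>cnj \<zeta> * z\<close> and \<open>cnj w * \<zeta>\<close> is free of
  \<open>\<zeta>\<close>, and for the values of \<open>u\<close>.\<close>

lemma one_minus_product_identity:
  fixes a b :: complex
  assumes "1 - a \<noteq> 0" "1 - b \<noteq> 0"
  shows "(1 - a * b) * (1 / (1 - b) * (1 / (1 - a))) = 1 / (1 - a) + 1 / (1 - b) - 1"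
proof -
  define A B where "A = 1 - a" and "B = 1 - b"
  have ab: "a = 1 - A" "b = 1 - B" by (auto simp: A_def B_def)
  have "A \<noteq> 0" "B \<noteq> 0" using assms by (auto simp: A_def B_def)
  then show ?thesis unfolding ab by (simp add: field_simps)
qed

locale clark =
  fixes u :: "complex \<Rightarrow> complex" and \<alpha> :: complex and \<mu> :: "complex measure"
  assumes inner: "inner_function u" and nonconst: "\<not> u constant_on ball 0 1"
    and alpha: "cmod \<alpha> = 1" and clark: "clark_measure u \<alpha> \<mu>"

sublocale clark \<subseteq> circle_finite_measure \<mu>
  using clark unfolding clark_measure_def circle_finite_measure_def circle_finite_measure_axioms_def
  by blast

context clark
begin

section \<open>The transform as a pairing with Cauchy kernels, and their Gram matrix\<close>

abbreviation V :: "(complex \<Rightarrow> complex) \<Rightarrow> complex \<Rightarrow> complex" where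
  "V \<equiv> clark_transform u \<alpha> \<mu>"

lemma denominator_nonzero: "z \<in> ball 0 1 \<Longrightarrow> 1 - cnj \<alpha> * u z \<noteq> 0"
proof
  assume z: "z \<in> ball 0 1" and "1 - cnj \<alpha> * u z = 0"
  then have "cmod (cnj \<alpha> * u z) = 1" by (metis eq_iff_diff_eq_0 norm_one)
  then show False using inner_function_less_1[OF inner nonconst z] alpha by (simp add: norm_mult)
qed

lemma cnj_denominator_nonzero: "w \<in> ball 0 1 \<Longrightarrow> 1 - \<alpha> * cnj (u w) \<noteq> 0"
  using denominator_nonzero[of w] complex_cnj_zero_iff[of "1 - cnj \<alpha> * u w"] by simp

lemma kernel_denominator_nonzero:
  assumes "w \<in> ball 0 1" "cmod \<zeta> \<le> 1" shows "1 - cnj w * \<zeta> \<noteq> 0"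
proof
  assume "1 - cnj w * \<zeta> = 0"
  then have "cmod (cnj w * \<zeta>) = 1" by (metis eq_iff_diff_eq_0 norm_one)
  then show False using cmod_mult_less_1[of "cnj w" \<zeta>] assms by simp
qed

lemma cauchy_kernel_L2: "w \<in> ball 0 1 \<Longrightarrow> cauchy_kernel w \<in> L2 \<mu>"
  unfolding cauchy_kernel_def [abs_def]
  by (intro L2_continuous continuous_intros ballI kernel_denominator_nonzero) auto

lemma clark_transform_eq:
  "z \<in> ball 0 1 \<Longrightarrow> V f z = (1 - cnj \<alpha> * u z) * L2_inner \<mu> f (cauchy_kernel z)"
  by (simp add: clark_transform_def on_disk_def L2_inner_def cauchy_kernel_def mult.commute)

lemma clark_transform_outside: "z \<notin> ball 0 1 \<Longrightarrow> V f z = 0"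
  by (simp add: clark_transform_def on_disk_def)

lemma clark_transform_eqI:
  "(\<And>z. z \<in> ball 0 1 \<Longrightarrow> V f z = g z) \<Longrightarrow> (\<And>z. z \<notin> ball 0 1 \<Longrightarrow> g z = 0) \<Longrightarrow> V f = g"
  by (rule ext) (metis clark_transform_outside)

text \<open>The Herglotz formula controls only real parts, so it fixes the Cauchy integral
  \<open>c\<close> up to an imaginary constant. The Gram matrix involves
  \<open>c z + cnj (c w)\<close>, from which the constant cancels.\<close>

lemma inner_cauchy_kernels:
  assumes z: "z \<in> ball 0 1" and w: "w \<in> ball 0 1"
  shows "L2_inner \<mu> (cauchy_kernel w) (cauchy_kernel z)
    = (1 - u z * cnj (u w)) / ((1 - cnj w * z) * (1 - cnj \<alpha> * u z) * (1 - \<alpha> * cnj (u w)))"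
proof -
  define c where "c z = (LINT \<zeta>|\<mu>. 1 / (1 - cnj \<zeta> * z))" for z
  define m where "m = (LINT \<zeta>|\<mu>. (1 :: complex))"
  define G where "G z = (1 + cnj \<alpha> * u z) / (1 - cnj \<alpha> * u z)" for z
  \<comment> \<open>On the circle \<open>(\<zeta> + z) / (\<zeta> - z)\<close> equals
    \<open>2 / (1 - cnj \<zeta> * z) - 1\<close>, so \<open>D\<close> is holomorphic with zero real
    part.\<close>
  define D where "D z = G z - (2 * c z - m)" for z
  have cnj_kernel: "1 / (1 - cnj \<zeta> * z) = cnj (cauchy_kernel z \<zeta>)" for \<zeta> z
    by (simp add: cauchy_kernel_def mult.commute)
  have int: "integrable \<mu> (\<lambda>\<zeta>. 1 / (1 - cnj \<zeta> * z))" if "z \<in> ball 0 1" for z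
    unfolding cnj_kernel by (intro integrable_cnj L2_integrable cauchy_kernel_L2 that)
  have m: "cnj m = m" unfolding m_def by simp
  have "D holomorphic_on ball 0 1"
    unfolding D_def G_def c_def
    by (intro holomorphic_intros cauchy_integral_holomorphic inner_function_holomorphic inner
        denominator_nonzero)
  moreover have "Re (D z) = 0" if z: "z \<in> ball 0 1" for z
  proof -
    have "Re (G z) = (LINT \<zeta>|\<mu>. Re ((\<zeta> + z) / (\<zeta> - z)))"
      using clark z unfolding clark_measure_def G_def by blast
    also have "\<dots> = (LINT \<zeta>|\<mu>. Re (2 * (1 / (1 - cnj \<zeta> * z)) - 1))"
    proof (rule Bochner_Integration.integral_cong[OF refl])
      fix \<zeta> assume "\<zeta> \<in> space \<mu>"
      then have \<zeta>: "\<zeta> * cnj \<zeta> = 1" "cmod \<zeta> = 1"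
        by (auto simp: complex_norm_square [symmetric])
      have "cnj \<zeta> \<noteq> 0" "1 - cnj \<zeta> * z \<noteq> 0"
        using \<zeta> kernel_denominator_nonzero[OF z, of \<zeta>] by (auto simp: mult.commute complex_eq_iff)
      then have "(\<zeta> + z) / (\<zeta> - z) = (cnj \<zeta> * (\<zeta> + z)) / (cnj \<zeta> * (\<zeta> - z))" by simp
      also have "\<dots> = (1 + cnj \<zeta> * z) / (1 - cnj \<zeta> * z)"
        using \<zeta>(1) by (simp add: distrib_left right_diff_distrib mult.commute)
      also have "\<dots> = 2 * (1 / (1 - cnj \<zeta> * z)) - 1"
        using \<open>1 - cnj \<zeta> * z \<noteq> 0\<close> by (simp add: field_simps)
      finally show "Re ((\<zeta> + z) / (\<zeta> - z)) = Re (2 * (1 / (1 - cnj \<zeta> * z)) - 1)" by simp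
    qed
    also have "\<dots> = Re (LINT \<zeta>|\<mu>. 2 * (1 / (1 - cnj \<zeta> * z)) - 1)"
      by (rule integral_Re) (intro Bochner_Integration.integrable_diff integrable_mult_right int z
        L2_integrable L2_const)
    also have "(LINT \<zeta>|\<mu>. 2 * (1 / (1 - cnj \<zeta> * z)) - 1) = 2 * c z - m"
      unfolding c_def m_def
      by (subst Bochner_Integration.integral_diff)
        (intro integrable_mult_right int z L2_integrable L2_const, rule L2_integrable[OF L2_const], simp only: integral_mult_right_zero)
    finally show ?thesis by (simp add: D_def)
  qed
  ultimately obtain d where d: "\<And>z. z \<in> ball 0 1 \<Longrightarrow> D z = d" and Red: "Re d = 0"
    using holomorphic_Re_zero_constant[of D] unfolding constant_on_def
    by (metis centre_in_ball zero_less_one)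
  have "D z + cnj (D w) = 0" using d[OF z] d[OF w] Red by (simp add: complex_eq_iff)
  then have sum: "2 * (c z + cnj (c w) - m) = G z + cnj (G w)"
    by (simp add: D_def m algebra_simps)
  \<comment> \<open>The factor \<open>1 - cnj w * z\<close> turns the product of the two kernels
    into a sum, because \<open>cnj w * z\<close> is
    \<open>(cnj \<zeta> * z) * (cnj w * \<zeta>)\<close> on the circle.\<close>
  have "(1 - cnj w * z) * L2_inner \<mu> (cauchy_kernel w) (cauchy_kernel z)
      = (LINT \<zeta>|\<mu>. (1 - cnj w * z) * (cauchy_kernel w \<zeta> * cnj (cauchy_kernel z \<zeta>)))"
    unfolding L2_inner_def by (rule integral_mult_right_zero [symmetric])
  also have "\<dots> = (LINT \<zeta>|\<mu>. 1 / (1 - cnj \<zeta> * z) + cnj (1 / (1 - cnj \<zeta> * w)) - 1)"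
  proof (rule Bochner_Integration.integral_cong[OF refl])
    fix \<zeta> assume "\<zeta> \<in> space \<mu>"
    then have \<zeta>: "\<zeta> * cnj \<zeta> = 1" "cmod \<zeta> = 1"
      by (auto simp: complex_norm_square [symmetric])
    define a b where "a = cnj \<zeta> * z" and "b = cnj w * \<zeta>"
    have nz: "1 - a \<noteq> 0" "1 - b \<noteq> 0"
      using kernel_denominator_nonzero[OF w, of \<zeta>] kernel_denominator_nonzero[OF z, of \<zeta>] \<zeta>(2)
      unfolding a_def b_def by (auto simp: mult.commute complex_eq_iff)
    have ab: "cnj w * z = a * b" using \<zeta>(1) unfolding a_def b_def
      by (metis (no_types, opaque_lifting) mult.assoc mult.commute mult_1)
    have "(1 - a * b) * (1 / (1 - b) * (1 / (1 - a))) = 1 / (1 - a) + 1 / (1 - b) - 1"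
      by (rule one_minus_product_identity[OF nz])
    then show "(1 - cnj w * z) * (cauchy_kernel w \<zeta> * cnj (cauchy_kernel z \<zeta>))
        = 1 / (1 - cnj \<zeta> * z) + cnj (1 / (1 - cnj \<zeta> * w)) - 1"
      unfolding cnj_kernel [symmetric] ab
      by (simp add: cauchy_kernel_def a_def b_def mult.commute)
  qed
  also have "\<dots> = c z + cnj (c w) - m"
    unfolding c_def m_def
    by (simp add: int[OF z] int[OF w] L2_integrable[OF L2_const] del: complex_cnj_divide flip: Bochner_Integration.integral_cnj)
  also have "\<dots> = (G z + cnj (G w)) / 2" by (simp only: sum [symmetric]) simp
  \<comment> \<open>The same identity read backwards, now with
    \<open>p * q = u z * cnj (u w)\<close> since \<open>\<alpha>\<close> is unimodular.\<close>
  also have "\<dots> = (1 - u z * cnj (u w)) / ((1 - cnj \<alpha> * u z) * (1 - \<alpha> * cnj (u w)))"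
  proof -
    define p q where "p = cnj \<alpha> * u z" and "q = \<alpha> * cnj (u w)"
    have nz: "1 - p \<noteq> 0" "1 - q \<noteq> 0"
      using denominator_nonzero[OF z] cnj_denominator_nonzero[OF w] by (simp_all add: p_def q_def)
    have "\<alpha> * cnj \<alpha> = 1" using alpha by (simp add: complex_norm_square [symmetric])
    then have pq: "u z * cnj (u w) = p * q" unfolding p_def q_def
      by (metis (no_types, opaque_lifting) mult.assoc mult.commute mult_1)
    have "(1 + p) / (1 - p) = 2 * (1 / (1 - p)) - 1" "(1 + q) / (1 - q) = 2 * (1 / (1 - q)) - 1"
      using nz by (simp_all add: field_simps)
    then have "((1 + p) / (1 - p) + (1 + q) / (1 - q)) / 2 = (1 - p * q) / ((1 - p) * (1 - q))"
      using one_minus_product_identity[OF nz] by (simp add: mult.commute)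
    moreover have "cnj (G w) = (1 + q) / (1 - q)" by (simp add: G_def q_def)
    moreover have "G z = (1 + p) / (1 - p)" by (simp add: G_def p_def)
    ultimately show ?thesis by (simp only: pq flip: p_def q_def)
  qed
  finally have product: "(1 - cnj w * z) * L2_inner \<mu> (cauchy_kernel w) (cauchy_kernel z)
    = (1 - u z * cnj (u w)) / ((1 - cnj \<alpha> * u z) * (1 - \<alpha> * cnj (u w)))" .
  have "1 - cnj w * z \<noteq> 0" using kernel_denominator_nonzero[OF w, of z] z by simp
  then have "L2_inner \<mu> (cauchy_kernel w) (cauchy_kernel z)
      = (1 - cnj w * z) * L2_inner \<mu> (cauchy_kernel w) (cauchy_kernel z) / (1 - cnj w * z)"
    by (rule nonzero_mult_div_cancel_left [symmetric])
  then show ?thesis unfolding product divide_divide_eq_left by (simp only: mult_ac)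
qed

lemma clark_transform_cauchy_kernel:
  assumes w: "w \<in> ball 0 1"
  shows "V (cauchy_kernel w) = (\<lambda>z. 1 / (1 - \<alpha> * cnj (u w)) * model_kernel u w z)"
proof (rule clark_transform_eqI)
  fix z :: complex assume z: "z \<in> ball 0 1"
  show "V (cauchy_kernel w) z = 1 / (1 - \<alpha> * cnj (u w)) * model_kernel u w z"
    using z denominator_nonzero[OF z] unfolding clark_transform_eq[OF z] inner_cauchy_kernels[OF z w]
    by (simp add: model_kernel_def szego_kernel_def on_disk_def divide_simps)
next
  fix z :: complex assume "z \<notin> ball 0 1"
  then show "1 / (1 - \<alpha> * cnj (u w)) * model_kernel u w z = 0"
    by (simp add: model_kernel_def szego_kernel_def on_disk_def)
qed

section \<open>Linearity of the transform and isometry on the span of the kernels\<close>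

lemma clark_transform_add:
  assumes "f \<in> L2 \<mu>" "g \<in> L2 \<mu>" shows "V (\<lambda>x. f x + g x) = (\<lambda>z. V f z + V g z)"
  by (rule clark_transform_eqI)
    (simp_all only: clark_transform_eq clark_transform_outside L2_inner_add_left assms cauchy_kernel_L2
      distrib_left add_0_right not_False_eq_True)

lemma clark_transform_diff:
  assumes "f \<in> L2 \<mu>" "g \<in> L2 \<mu>" shows "V (\<lambda>x. f x - g x) = (\<lambda>z. V f z - V g z)"
  by (rule clark_transform_eqI)
    (simp_all only: clark_transform_eq clark_transform_outside L2_inner_diff_left assms cauchy_kernel_L2
      right_diff_distrib diff_self not_False_eq_True)

lemma clark_transform_cmult: "V (\<lambda>x. c * f x) = (\<lambda>z. c * V f z)"
  by (rule clark_transform_eqI)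
    (simp_all only: clark_transform_eq clark_transform_outside L2_inner_cmult_left mult.left_commute mult_zero_right not_False_eq_True)

lemma clark_transform_zero: "V (\<lambda>x. 0) = (\<lambda>z. 0)"
  using clark_transform_cmult[of 0 "\<lambda>x. 0"] by simp

text \<open>Adding one kernel at a time lets statements about the span be proved by induction
  without handling finite sums.\<close>

inductive_set kernel_span :: "(complex \<Rightarrow> complex) set" where
  zero: "(\<lambda>x. 0) \<in> kernel_span"
| step: "g \<in> kernel_span \<Longrightarrow> w \<in> ball 0 1 \<Longrightarrow> (\<lambda>x. g x + c * cauchy_kernel w x) \<in> kernel_span"

lemma kernel_span_L2: "g \<in> kernel_span \<Longrightarrow> g \<in> L2 \<mu>"
  by (induction rule: kernel_span.induct) (auto intro!: L2_add L2_cmult cauchy_kernel_L2)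

lemma kernel_span_lin:
  assumes h: "h \<in> kernel_span" and g: "g \<in> kernel_span"
  shows "(\<lambda>x. g x + c * h x) \<in> kernel_span"
  using h
proof (induction rule: kernel_span.induct)
  case (step h w d)
  then show ?case using kernel_span.step[OF step.IH step.hyps(2), of "c * d"]
    by (simp add: algebra_simps)
qed (simp add: g)

lemma kernel_span_diff: "g \<in> kernel_span \<Longrightarrow> h \<in> kernel_span \<Longrightarrow> (\<lambda>x. g x - h x) \<in> kernel_span"
  using kernel_span_lin[of h g "-1"] by simp

lemma cauchy_kernel_in_kernel_span: "w \<in> ball 0 1 \<Longrightarrow> cauchy_kernel w \<in> kernel_span"
  using kernel_span.step[OF kernel_span.zero, of w 1] by simp

lemma clark_transform_kernel_span: "g \<in> kernel_span \<Longrightarrow> V g \<in> model_space u"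
  by (induction rule: kernel_span.induct)
    (simp_all only: clark_transform_zero model_space_zero[OF inner] clark_transform_add clark_transform_cmult
      kernel_span_L2 L2_cmult cauchy_kernel_L2 clark_transform_cauchy_kernel model_space_add[OF inner]
      model_space_cmult[OF inner] model_kernel_in_model_space[OF inner])

lemma kernel_span_H2: "g \<in> kernel_span \<Longrightarrow> V g \<in> H2"
  by (rule model_space_H2[OF clark_transform_kernel_span])

text \<open>The reproducing property gives \<open>V g w\<close> times the conjugate of the constant
  in front of the model kernel, which cancels the prefactor of \<open>V\<close>.\<close>

lemma clark_transform_inner_cauchy_kernel:
  assumes g: "V g \<in> model_space u" and w: "w \<in> ball 0 1"
  shows "H2_inner (V g) (V (cauchy_kernel w)) = L2_inner \<mu> g (cauchy_kernel w)"
proof -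
  have "H2_inner (V g) (V (cauchy_kernel w)) = cnj (1 / (1 - \<alpha> * cnj (u w))) * V g w"
    unfolding clark_transform_cauchy_kernel[OF w]
    by (subst H2_inner_cmult_right)
      (simp_all only: model_space_H2[OF g] model_space_H2[OF model_kernel_in_model_space[OF inner w]] g model_kernel_in_model_space[OF inner w] H2_inner_model_kernel[OF inner g w])
  also have "\<dots> = L2_inner \<mu> g (cauchy_kernel w)"
    using denominator_nonzero[OF w] by (simp only: clark_transform_eq[OF w]) simp
  finally show ?thesis .
qed

text \<open>Induction on \<open>h\<close> alone suffices: \<open>g\<close> enters only through
  membership of \<open>V g\<close> in the model space.\<close>

lemma clark_transform_inner_kernel_span:
  assumes g: "g \<in> kernel_span" and h: "h \<in> kernel_span"
  shows "H2_inner (V g) (V h) = L2_inner \<mu> g h"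
  using h
proof (induction rule: kernel_span.induct)
  case zero
  have "V g \<in> H2" by (rule kernel_span_H2[OF g])
  then show ?case unfolding clark_transform_zero
    using H2_inner_cmult_right[OF H2_zero, of "V g" 0] by (simp add: L2_inner_def)
next
  case (step h w c)
  note L = kernel_span_L2[OF g] kernel_span_L2[OF step.hyps(1)] cauchy_kernel_L2[OF step.hyps(2)]
  have H: "V g \<in> H2" "V h \<in> H2" "V (cauchy_kernel w) \<in> H2"
    using g step.hyps cauchy_kernel_in_kernel_span
    by (auto intro!: kernel_span_H2)
  have "H2_inner (V g) (V (\<lambda>x. h x + c * cauchy_kernel w x))
      = H2_inner (V g) (V h) + cnj c * H2_inner (V g) (V (cauchy_kernel w))"
    by (simp add: clark_transform_add clark_transform_cmult L L2_cmult H2_inner_add_right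
        H2_inner_cmult_right H H2_cmult)
  also have "\<dots> = L2_inner \<mu> g (\<lambda>x. h x + c * cauchy_kernel w x)"
    using step clark_transform_kernel_span[OF g]
    by (simp add: clark_transform_inner_cauchy_kernel L2_inner_add_right L L2_cmult L2_inner_cmult_right)
  finally show ?case .
qed

lemma clark_transform_norm_kernel_span: "g \<in> kernel_span \<Longrightarrow> H2_norm (V g) = L2_norm \<mu> g"
  by (simp add: H2_norm_def clark_transform_inner_kernel_span L2_norm_eq_sqrt_inner)

lemma clark_transform_tendsto_pointwise:
  assumes "\<And>n. e n \<in> L2 \<mu>" "g \<in> L2 \<mu>" "(\<lambda>n. L2_norm \<mu> (\<lambda>x. e n x - g x)) \<longlonglongrightarrow> 0" "z \<in> ball 0 1"
  shows "(\<lambda>n. V (e n) z) \<longlonglongrightarrow> V g z"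
  unfolding clark_transform_eq[OF assms(4)]
  by (intro tendsto_intros L2_inner_tendsto assms cauchy_kernel_L2)

text \<open>Carries Cauchy sequences both ways: from \<open>L2 \<mu>\<close> to \<open>l2\<close>
  for limits of transforms, and back for surjectivity.\<close>

lemma taylor_coeff_clark_diff:
  assumes "g \<in> kernel_span" "h \<in> kernel_span"
  shows "l2_norm (\<lambda>n. taylor_coeff (V g) n - taylor_coeff (V h) n) = L2_norm \<mu> (\<lambda>x. g x - h x)"
proof -
  have H: "V g \<in> H2" "V h \<in> H2"
    using assms by (auto intro!: kernel_span_H2)
  have "L2_norm \<mu> (\<lambda>x. g x - h x) = H2_norm (V (\<lambda>x. g x - h x))"
    by (simp add: clark_transform_norm_kernel_span kernel_span_diff assms)
  also have "\<dots> = H2_norm (\<lambda>z. V g z - V h z)"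
    by (simp add: clark_transform_diff kernel_span_L2 assms)
  finally show ?thesis
    using H by (simp add: H2_norm_l2 H2_diff taylor_coeff_diff H2_holomorphic)
qed

text \<open>The transforms of \<open>e n\<close> have a norm limit by completeness of
  \<open>l2\<close>, and they converge pointwise to \<open>V g\<close> by its integral formula.
  Evaluation on the disk is continuous for both modes, so the limits coincide.\<close>

lemma clark_transform_limit:
  assumes e: "\<And>n. e n \<in> kernel_span" and g: "g \<in> L2 \<mu>"
    and lim: "(\<lambda>n. L2_norm \<mu> (\<lambda>x. e n x - g x)) \<longlonglongrightarrow> 0"
  shows "V g \<in> model_space u" "H2_norm (V g) = L2_norm \<mu> g"
proof -
  have H: "V (e n) \<in> H2" for n by (rule kernel_span_H2[OF e])
  have "L2_Cauchy \<mu> e" by (rule L2_Cauchy_convergent[OF kernel_span_L2[OF e] g lim])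
  then have cauchy: "L2_Cauchy (count_space UNIV) (\<lambda>n. taylor_coeff (V (e n)))"
    by (simp add: L2_Cauchy_def taylor_coeff_clark_diff e)
  obtain a where a: "a \<in> l2"
    and alim: "(\<lambda>n. l2_norm (\<lambda>k. taylor_coeff (V (e n)) k - a k)) \<longlonglongrightarrow> 0"
    by (rule L2_complete[OF H2_taylor_coeff_l2[OF H] cauchy], rule that)
  define h where "h = of_coeffs a"
  have h: "h \<in> H2" "taylor_coeff h = a" using a by (auto simp: h_def of_coeffs_H2 taylor_coeff_of_coeffs)
  have hlim: "(\<lambda>n. H2_norm (\<lambda>z. V (e n) z - h z)) \<longlonglongrightarrow> 0"
    using alim by (simp add: H2_norm_l2 H2_diff H h taylor_coeff_diff H2_holomorphic)
  have "V g = h"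
  proof (rule clark_transform_eqI)
    fix z :: complex assume z: "z \<in> ball 0 1"
    show "V g z = h z"
      by (rule LIMSEQ_unique[OF clark_transform_tendsto_pointwise[OF kernel_span_L2[OF e] g lim z]
            H2_tendsto_pointwise[OF H h(1) hlim z]])
  qed (rule H2_outside[OF h(1)])
  moreover have "h \<in> model_space u"
    by (rule model_space_closed[OF inner clark_transform_kernel_span[OF e] h(1) hlim])
  moreover have "H2_norm h = L2_norm \<mu> g"
  proof (rule LIMSEQ_unique)
    show "(\<lambda>n. L2_norm \<mu> (e n)) \<longlonglongrightarrow> L2_norm \<mu> g"
      by (rule L2_norm_tendsto[OF kernel_span_L2[OF e] g lim])
    have "(\<lambda>n. l2_norm (taylor_coeff (V (e n)))) \<longlonglongrightarrow> l2_norm a"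
      by (rule L2_norm_tendsto[OF H2_taylor_coeff_l2[OF H] a alim])
    then show "(\<lambda>n. L2_norm \<mu> (e n)) \<longlonglongrightarrow> H2_norm h"
      by (simp add: h H2_norm_l2 [symmetric] H clark_transform_norm_kernel_span e) (simp add: H2_norm_l2 h)
  qed
  ultimately show "V g \<in> model_space u" "H2_norm (V g) = L2_norm \<mu> g" by simp_all
qed

text \<open>The difference between \<open>f\<close> and its projection \<open>g\<close> is
  orthogonal to every Cauchy kernel, hence invisible to \<open>V\<close>. The norm identity concerns
  \<open>g\<close>; its transfer to \<open>f\<close> has to wait for injectivity.\<close>

lemma kernel_span_projection:
  assumes f: "f \<in> L2 \<mu>"
  obtains g where "g \<in> L2 \<mu>" "V g = V f" "V g \<in> model_space u" "H2_norm (V g) = L2_norm \<mu> g"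
proof -
  obtain g e where g: "g \<in> L2 \<mu>" and e: "\<And>n::nat. e n \<in> kernel_span"
    and lim: "(\<lambda>n. L2_norm \<mu> (\<lambda>x. e n x - g x)) \<longlonglongrightarrow> 0"
    and orth: "\<And>h. h \<in> kernel_span \<Longrightarrow> L2_inner \<mu> (\<lambda>x. f x - g x) h = 0"
    by (rule L2_projection[of kernel_span \<mu> f])
      (auto intro: kernel_span_L2 kernel_span.zero kernel_span_lin f)
  have "V g = V f"
  proof (rule clark_transform_eqI[OF _ clark_transform_outside])
    fix z :: complex assume z: "z \<in> ball 0 1"
    show "V g z = V f z"
      using orth[OF cauchy_kernel_in_kernel_span[OF z]] f g cauchy_kernel_L2[OF z]
      by (simp only: clark_transform_eq[OF z] L2_inner_diff_left) simp
  qed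
  then show ?thesis using that[OF g] clark_transform_limit[OF e g lim] by blast
qed

lemma clark_transform_in_model_space: "f \<in> L2 \<mu> \<Longrightarrow> V f \<in> model_space u"
  by (metis kernel_span_projection)

section \<open>The kernel of the transform\<close>

lemma cauchy_kernel_zero: "cauchy_kernel 0 = (\<lambda>x. 1)"
  by (auto simp: cauchy_kernel_def)

text \<open>On the circle \<open>\<zeta> / (1 - cnj \<zeta> * z) = \<zeta> + z / (1 - cnj \<zeta> *
  z)\<close>. Against \<open>f\<close> the second term integrates to zero, leaving the integral of
  \<open>\<zeta> * f \<zeta>\<close> as the constant; membership of the transform in the model space
  forces it to vanish.\<close>

lemma clark_transform_kernel_shift:
  assumes f: "f \<in> L2 \<mu>" "V f = (\<lambda>z. 0)"
  shows "V (\<lambda>\<zeta>. \<zeta> * f \<zeta>) = (\<lambda>z. 0)"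
proof -
  define a where "a = (LINT \<zeta>|\<mu>. \<zeta> * f \<zeta>)"
  have sf: "(\<lambda>\<zeta>. \<zeta> * f \<zeta>) \<in> L2 \<mu>" by (intro L2_continuous_mult f continuous_intros)
  have "V (\<lambda>\<zeta>. \<zeta> * f \<zeta>) z = a * (1 - cnj \<alpha> * u z)" if z: "z \<in> ball 0 1" for z
  proof -
    have zero: "L2_inner \<mu> f (cauchy_kernel z) = 0"
      using clark_transform_eq[OF z, of f] denominator_nonzero[OF z] f(2) by simp
    have "L2_inner \<mu> (\<lambda>\<zeta>. \<zeta> * f \<zeta>) (cauchy_kernel z) = (LINT \<zeta>|\<mu>. \<zeta> * f \<zeta> + z * (f \<zeta> * cnj (cauchy_kernel z \<zeta>)))"
      unfolding L2_inner_def
    proof (rule Bochner_Integration.integral_cong[OF refl])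
      fix \<zeta> assume "\<zeta> \<in> space \<mu>"
      then have \<zeta>: "\<zeta> * cnj \<zeta> = 1" "cmod \<zeta> = 1"
        by (auto simp: complex_norm_square [symmetric])
      have nz: "1 - cnj \<zeta> * z \<noteq> 0"
        using \<zeta> kernel_denominator_nonzero[OF z, of \<zeta>] by (auto simp: mult.commute complex_eq_iff)
      have ck: "cnj (cauchy_kernel z \<zeta>) = 1 / (1 - cnj \<zeta> * z)"
        by (simp add: cauchy_kernel_def mult.commute)
      have "\<zeta> * f \<zeta> * (1 / (1 - cnj \<zeta> * z))
          = (\<zeta> * f \<zeta> * (1 - cnj \<zeta> * z) + z * f \<zeta> * (\<zeta> * cnj \<zeta>)) * (1 / (1 - cnj \<zeta> * z))"
        by (simp add: algebra_simps)
      also have "\<dots> = \<zeta> * f \<zeta> + z * (f \<zeta> * (1 / (1 - cnj \<zeta> * z)))"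
        using nz by (simp add: \<zeta>(1) add_divide_distrib)
      finally show "\<zeta> * f \<zeta> * cnj (cauchy_kernel z \<zeta>) = \<zeta> * f \<zeta> + z * (f \<zeta> * cnj (cauchy_kernel z \<zeta>))"
        by (simp only: ck)
    qed
    also have "\<dots> = a + z * L2_inner \<mu> f (cauchy_kernel z)"
      unfolding a_def L2_inner_def
      using L2_integrable[OF sf] L2_inner_integrable[OF f(1) cauchy_kernel_L2[OF z]] by simp
    finally show ?thesis using zero by (simp add: clark_transform_eq[OF z])
  qed
  then have eq: "V (\<lambda>\<zeta>. \<zeta> * f \<zeta>) = on_disk (\<lambda>z. a * (1 - cnj \<alpha> * u z))"
    by (intro clark_transform_eqI) (auto simp: on_disk_def)
  then have "a = 0"
    using one_minus_inner_notin_model_space[OF inner nonconst alpha] clark_transform_in_model_space[OF sf]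
    by simp
  then show ?thesis by (simp add: eq on_disk_def)
qed

text \<open>Here \<open>z * cnj \<zeta> / (1 - cnj \<zeta> * z)\<close> is the difference of the
  conjugated Cauchy kernels at \<open>z\<close> and at 0, both of which annihilate \<open>f\<close>.
  Division by \<open>z\<close> leaves out the origin, which is recovered by continuity of a function
  in the model space.\<close>

lemma clark_transform_kernel_cnj_shift:
  assumes f: "f \<in> L2 \<mu>" "V f = (\<lambda>z. 0)"
  shows "V (\<lambda>\<zeta>. cnj \<zeta> * f \<zeta>) = (\<lambda>z. 0)"
proof -
  let ?g = "\<lambda>\<zeta>. cnj \<zeta> * f \<zeta>"
  have g: "?g \<in> L2 \<mu>" by (intro L2_continuous_mult f continuous_intros)
  have zero: "L2_inner \<mu> f (cauchy_kernel z) = 0" if "z \<in> ball 0 1" for z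
    using clark_transform_eq[OF that, of f] denominator_nonzero[OF that] f(2) by simp
  have punctured: "V ?g z = 0" if z: "z \<in> ball 0 1" "z \<noteq> 0" for z
  proof -
    have "z * L2_inner \<mu> ?g (cauchy_kernel z) = (LINT \<zeta>|\<mu>. z * (?g \<zeta> * cnj (cauchy_kernel z \<zeta>)))"
      unfolding L2_inner_def by (rule integral_mult_right_zero [symmetric])
    also have "\<dots> = (LINT \<zeta>|\<mu>. f \<zeta> * cnj (cauchy_kernel z \<zeta>) - f \<zeta> * cnj (cauchy_kernel 0 \<zeta>))"
    proof (rule Bochner_Integration.integral_cong[OF refl])
      fix \<zeta> assume "\<zeta> \<in> space \<mu>"
      then have "1 - cnj \<zeta> * z \<noteq> 0"
        using kernel_denominator_nonzero[OF z(1), of \<zeta>] by (auto simp: mult.commute complex_eq_iff)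
      then show "z * (?g \<zeta> * cnj (cauchy_kernel z \<zeta>)) = f \<zeta> * cnj (cauchy_kernel z \<zeta>) - f \<zeta> * cnj (cauchy_kernel 0 \<zeta>)"
        by (simp add: cauchy_kernel_def field_simps)
    qed
    also have "\<dots> = L2_inner \<mu> f (cauchy_kernel z) - L2_inner \<mu> f (cauchy_kernel 0)"
      unfolding L2_inner_def
      by (intro Bochner_Integration.integral_diff L2_inner_integrable f cauchy_kernel_L2 z) simp
    finally have "z * L2_inner \<mu> ?g (cauchy_kernel z) = 0" using zero z by simp
    then show ?thesis using z by (simp add: clark_transform_eq[OF z(1)])
  qed
  have cont: "continuous_on (ball 0 1) (V ?g)"
    by (intro holomorphic_on_imp_continuous_on H2_holomorphic model_space_H2[OF clark_transform_in_model_space] g)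
  have "((V ?g) \<longlongrightarrow> V ?g 0) (at 0)"
    using cont by (auto simp: continuous_on_eq_continuous_at isCont_def)
  moreover have "((V ?g) \<longlongrightarrow> 0) (at 0)"
    using eventually_at_in_open[of "ball 0 1" "0::complex"]
    by (intro tendsto_eventually) (auto elim!: eventually_mono intro!: punctured)
  ultimately have "V ?g 0 = 0" using tendsto_unique[OF at_neq_bot] by blast
  then show ?thesis using punctured by (intro clark_transform_eqI) auto
qed

theorem clark_transform_eq_0_iff:
  assumes f: "f \<in> L2 \<mu>" shows "V f = (\<lambda>z. 0) \<longleftrightarrow> (AE x in \<mu>. f x = 0)"
proof
  assume "V f = (\<lambda>z. 0)"
  show "AE x in \<mu>. f x = 0"
  proof (rule AE_zero_of_shift_invariant[of "{f \<in> L2 \<mu>. V f = (\<lambda>z. 0)}"])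
    fix f assume f: "f \<in> {f \<in> L2 \<mu>. V f = (\<lambda>z. 0)}"
    then have L: "f \<in> L2 \<mu>" "V f = (\<lambda>z. 0)" by auto
    \<comment> \<open>The Cauchy kernel at 0 is the constant 1, so \<open>V f 0\<close> is this
      integral times a nonzero factor.\<close>
    show "(LINT x|\<mu>. f x) = 0"
      using clark_transform_eq[of 0 f] denominator_nonzero[of 0] L
      by (simp add: cauchy_kernel_zero L2_inner_def)
    show "(\<lambda>x. x * f x) \<in> {f \<in> L2 \<mu>. V f = (\<lambda>z. 0)}"
      using clark_transform_kernel_shift[OF L] L(1) by (auto intro!: L2_continuous_mult continuous_intros)
    show "(\<lambda>x. cnj x * f x) \<in> {f \<in> L2 \<mu>. V f = (\<lambda>z. 0)}"
      using clark_transform_kernel_cnj_shift[OF L] L(1) by (auto intro!: L2_continuous_mult continuous_intros)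
    show "(\<lambda>x. c * f x) \<in> {f \<in> L2 \<mu>. V f = (\<lambda>z. 0)}" for c
      using L by (simp add: clark_transform_cmult L2_cmult)
    fix g assume "g \<in> {f \<in> L2 \<mu>. V f = (\<lambda>z. 0)}"
    then show "(\<lambda>x. f x + g x) \<in> {f \<in> L2 \<mu>. V f = (\<lambda>z. 0)}"
      using L by (simp add: clark_transform_add L2_add)
  qed (use f \<open>V f = (\<lambda>z. 0)\<close> in auto)
next
  assume "AE x in \<mu>. f x = 0"
  then have "L2_inner \<mu> f h = L2_inner \<mu> (\<lambda>x. 0) h" if "h \<in> L2 \<mu>" for h
    using f that by (intro L2_inner_cong_AE) auto
  then show "V f = (\<lambda>z. 0)"
    by (intro clark_transform_eqI) (simp_all add: clark_transform_eq cauchy_kernel_L2 L2_inner_def)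
qed

section \<open>Unitarity of the transform\<close>

lemma clark_transform_eq_iff:
  assumes "f \<in> L2 \<mu>" "g \<in> L2 \<mu>" shows "V f = V g \<longleftrightarrow> (AE x in \<mu>. f x = g x)"
proof -
  have "V f = V g \<longleftrightarrow> V (\<lambda>x. f x - g x) = (\<lambda>z. 0)"
    unfolding clark_transform_diff[OF assms] by (auto simp: fun_eq_iff)
  then show ?thesis using clark_transform_eq_0_iff[OF L2_diff[OF assms]] by simp
qed

text \<open>By injectivity \<open>f\<close> agrees almost everywhere with its projection onto the
  closed span, where the norm identity is known.\<close>

theorem clark_transform_norm:
  assumes f: "f \<in> L2 \<mu>" shows "H2_norm (V f) = L2_norm \<mu> f"
proof -
  obtain g where g: "g \<in> L2 \<mu>" "V g = V f" "H2_norm (V g) = L2_norm \<mu> g"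
    using kernel_span_projection[OF f] by metis
  then have "AE x in \<mu>. g x = f x" using clark_transform_eq_iff f by blast
  then have "(LINT x|\<mu>. (cmod (g x))\<^sup>2) = (LINT x|\<mu>. (cmod (f x))\<^sup>2)"
    using f g(1) by (intro integral_cong_AE) (auto elim!: eventually_mono)
  then show ?thesis using g by (simp add: L2_norm_def)
qed

text \<open>Project \<open>g\<close> onto the closure of the transformed span. The residual lies in
  the model space and is orthogonal to the transforms of Cauchy kernels, which evaluate at points up
  to nonzero factors, so it vanishes.\<close>

theorem clark_transform_surj:
  assumes g: "g \<in> model_space u" obtains f where "f \<in> L2 \<mu>" "V f = g"
proof -
  define E where "E = (\<lambda>e. taylor_coeff (V e)) ` kernel_span"
  have H: "V e \<in> H2" if "e \<in> kernel_span" for e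
    by (rule kernel_span_H2[OF that])
  have gH: "g \<in> H2" by (rule model_space_H2[OF g])
  obtain a s where a: "a \<in> l2" and s: "\<And>n::nat. s n \<in> E"
    and lim: "(\<lambda>n. l2_norm (\<lambda>k. s n k - a k)) \<longlonglongrightarrow> 0"
    and orth: "\<And>b. b \<in> E \<Longrightarrow> l2_inner (\<lambda>k. taylor_coeff g k - a k) b = 0"
  proof (rule L2_projection[of E "count_space UNIV" "taylor_coeff g"])
    show "E \<subseteq> l2" unfolding E_def using H H2_taylor_coeff_l2 by blast
    have "taylor_coeff (V (\<lambda>x. 0)) = (\<lambda>k. 0)"
      using taylor_coeff_eqI[of "\<lambda>k. 0" "\<lambda>z. 0"] by (simp add: clark_transform_zero)
    then show "(\<lambda>k. 0) \<in> E" unfolding E_def using kernel_span.zero by (metis imageI)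
    show "taylor_coeff g \<in> l2" by (rule H2_taylor_coeff_l2[OF gH])
    fix c b b' assume "b \<in> E" "b' \<in> E"
    then obtain e e' where e: "e \<in> kernel_span" "b = taylor_coeff (V e)"
      "e' \<in> kernel_span" "b' = taylor_coeff (V e')" by (auto simp: E_def)
    have "taylor_coeff (V (\<lambda>x. e x + c * e' x)) = (\<lambda>k. b k + c * b' k)"
      using e H by (simp add: clark_transform_add clark_transform_cmult kernel_span_L2 L2_cmult
          taylor_coeff_add taylor_coeff_cmult H2_holomorphic H2_cmult)
    from image_eqI[where f = "\<lambda>e. taylor_coeff (V e)", OF this [symmetric] kernel_span_lin[OF e(3,1)]]
    show "(\<lambda>k. b k + c * b' k) \<in> E" unfolding E_def .
  qed (rule that)
  from s obtain e where e: "\<And>n. e n \<in> kernel_span" "\<And>n. s n = taylor_coeff (V (e n))"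
    unfolding E_def image_iff by metis
  define h where "h = of_coeffs a"
  have h: "h \<in> H2" "taylor_coeff h = a" using a by (auto simp: h_def of_coeffs_H2 taylor_coeff_of_coeffs)
  have hlim: "(\<lambda>n. H2_norm (\<lambda>z. V (e n) z - h z)) \<longlonglongrightarrow> 0"
    using lim by (simp add: H2_norm_l2 H2_diff H e h taylor_coeff_diff H2_holomorphic)
  have hK: "h \<in> model_space u"
    by (rule model_space_closed[OF inner clark_transform_kernel_span[OF e(1)] h(1) hlim])
  have "g = h"
  proof (rule H2_eqI[OF gH h(1)])
    fix w :: complex assume w: "w \<in> ball 0 1"
    have d: "(\<lambda>z. g z - h z) \<in> model_space u" by (rule model_space_diff[OF inner g hK])
    note k = cauchy_kernel_in_kernel_span[OF w]
    have "H2_inner (\<lambda>z. g z - h z) (V (cauchy_kernel w)) = 0"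
      using orth[of "taylor_coeff (V (cauchy_kernel w))"] k H[OF k]
      by (simp add: H2_inner_l2 H2_diff gH h taylor_coeff_diff H2_holomorphic E_def)
    then have "cnj (1 / (1 - \<alpha> * cnj (u w))) * (g w - h w) = 0"
      unfolding clark_transform_cauchy_kernel[OF w]
      by (subst (asm) H2_inner_cmult_right)
        (simp_all only: model_space_H2[OF d] model_space_H2[OF model_kernel_in_model_space[OF inner w]] d model_kernel_in_model_space[OF inner w] H2_inner_model_kernel[OF inner d w])
    then show "g w = h w" using denominator_nonzero[OF w] by simp
  qed
  \<comment> \<open>Isometry on the span sends the Cauchy property of the coefficients back to
    \<open>L2 \<mu>\<close>, which provides a preimage.\<close>
  have "L2_Cauchy (count_space UNIV) s"
    by (rule L2_Cauchy_convergent[OF _ a lim]) (simp add: e H H2_taylor_coeff_l2)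
  then have cauchy: "L2_Cauchy \<mu> e"
    by (simp add: L2_Cauchy_def e taylor_coeff_clark_diff)
  obtain f where f: "f \<in> L2 \<mu>" "(\<lambda>n. L2_norm \<mu> (\<lambda>x. e n x - f x)) \<longlonglongrightarrow> 0"
    by (rule L2_complete[OF kernel_span_L2[OF e(1)] cauchy], rule that)
  have "V f = h"
  proof (rule clark_transform_eqI)
    fix z :: complex assume z: "z \<in> ball 0 1"
    show "V f z = h z"
      by (rule LIMSEQ_unique[OF clark_transform_tendsto_pointwise[OF kernel_span_L2[OF e(1)] f z]
            H2_tendsto_pointwise[OF H[OF e(1)] h(1) hlim z]])
  qed (rule H2_outside[OF h(1)])
  then show ?thesis using that f(1) \<open>g = h\<close> by simp
qed

end

subsection \<open>The functional calculus\<close>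

text \<open>On \<open>H\<close> the usual computation \<open>B = B A B' = B'\<close> applies; off
  \<open>H\<close> both operators are undefined, so they agree as partial functions.\<close>

lemma bounded_inverse_unique:
  assumes B: "is_bounded_inverse H A B" and B': "is_bounded_inverse H A B'"
  shows "B = B'"
proof
  fix g
  show "B g = B' g"
  proof (cases "g \<in> H")
    case True
    then obtain h where h: "B' g = Some h"
      using B' unfolding is_bounded_inverse_def bounded_operator_def by blast
    have "(A \<circ>\<^sub>m B') g = Some g" using B' True by (simp add: is_bounded_inverse_def)
    then have A: "A h = Some g" using h by (simp add: map_comp_def)
    have "(B \<circ>\<^sub>m A) h = Some h" using B A by (auto simp: is_bounded_inverse_def restrict_map_def)
    then show ?thesis using A h by (simp add: map_comp_def)
  next
    case False
    then have "g \<notin> dom B" "g \<notin> dom B'"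
      using B B' by (auto simp: is_bounded_inverse_def bounded_operator_def)
    then show ?thesis by (simp add: domIff)
  qed
qed

context clark
begin

section \<open>The calculus as multiplication on square-integrable functions\<close>

lemma AE_iff_measure_0:
  assumes "{s \<in> sphere 0 1. P s} \<in> sets \<mu>"
  shows "(AE s in \<mu>. \<not> P s) \<longleftrightarrow> measure \<mu> {s \<in> sphere 0 1. P s} = 0"
  using AE_iff_measurable[of "{s \<in> sphere 0 1. P s}" \<mu> "\<lambda>s. \<not> P s"] assms
  by (simp add: emeasure_eq_measure)

text \<open>Removes the choice made by \<open>inv_into\<close>: the chosen preimage agrees with
  \<open>f\<close> almost everywhere, which affects neither membership in \<open>L2 \<mu>\<close>
  nor the transform.\<close>

lemma clark_calculus_transform:
  assumes \<phi>: "\<phi> \<in> borel_measurable \<mu>" and f: "f \<in> L2 \<mu>"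
  shows "clark_calculus u \<alpha> \<mu> \<phi> (V f)
    = (if (\<lambda>\<zeta>. \<phi> \<zeta> * f \<zeta>) \<in> L2 \<mu> then Some (V (\<lambda>\<zeta>. \<phi> \<zeta> * f \<zeta>)) else None)"
proof -
  define f' where "f' = inv_into (L2 \<mu>) V (V f)"
  have f': "f' \<in> L2 \<mu>" "V f' = V f"
    unfolding f'_def using f by (simp_all add: inv_into_into f_inv_into_f)
  note [measurable] = \<phi> L2_measurable[OF f] L2_measurable[OF f'(1)]
  have "AE x in \<mu>. f' x = f x" using f' f clark_transform_eq_iff by blast
  then have 1: "AE x in \<mu>. \<phi> x * f' x = \<phi> x * f x" by eventually_elim simp
  then have 2: "AE x in \<mu>. \<phi> x * f x = \<phi> x * f' x" by eventually_elim auto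
  have meas: "(\<lambda>x. \<phi> x * f' x) \<in> borel_measurable \<mu>" "(\<lambda>x. \<phi> x * f x) \<in> borel_measurable \<mu>"
    by measurable
  have "(\<lambda>x. \<phi> x * f' x) \<in> L2 \<mu> \<longleftrightarrow> (\<lambda>x. \<phi> x * f x) \<in> L2 \<mu>"
    using L2_cong_AE[OF _ meas(1) 1] L2_cong_AE[OF _ meas(2) 2] by blast
  moreover have "V (\<lambda>x. \<phi> x * f' x) = V (\<lambda>x. \<phi> x * f x)"
    if "(\<lambda>x. \<phi> x * f' x) \<in> L2 \<mu>" "(\<lambda>x. \<phi> x * f x) \<in> L2 \<mu>"
    using clark_transform_eq_iff[OF that] 1 by blast
  ultimately show ?thesis
    using clark_transform_in_model_space[OF f] f'(1)
    by (simp add: clark_calculus_def mult_operator_def f'_def [symmetric])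
qed

lemma clark_calculus_cases:
  assumes \<phi>: "\<phi> \<in> borel_measurable \<mu>" and g: "g \<in> dom (clark_calculus u \<alpha> \<mu> \<phi>)"
  obtains f where "f \<in> L2 \<mu>" "g = V f" "(\<lambda>\<zeta>. \<phi> \<zeta> * f \<zeta>) \<in> L2 \<mu>"
    "clark_calculus u \<alpha> \<mu> \<phi> g = Some (V (\<lambda>\<zeta>. \<phi> \<zeta> * f \<zeta>))"
proof -
  have "g \<in> model_space u" using g by (auto simp: clark_calculus_def split: if_splits)
  then obtain f where f: "f \<in> L2 \<mu>" "V f = g" by (rule clark_transform_surj)
  then show ?thesis using that g clark_calculus_transform[OF \<phi> f(1)] by (auto split: if_splits)
qed

lemma clark_calculus_outside: "g \<notin> model_space u \<Longrightarrow> clark_calculus u \<alpha> \<mu> \<phi> g = None"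
  by (simp add: clark_calculus_def)

lemma clark_calculus_bounded:
  assumes \<psi>: "\<psi> \<in> borel_measurable \<mu>" "AE s in \<mu>. cmod (\<psi> s) \<le> C"
  shows "bounded_operator (model_space u) (clark_calculus u \<alpha> \<mu> \<psi>)"
proof -
  let ?B = "clark_calculus u \<alpha> \<mu> \<psi>"
  note L = L2_mult_bounded(1)[OF _ \<psi>]
  have val: "?B (V f) = Some (V (\<lambda>x. \<psi> x * f x))" if "f \<in> L2 \<mu>" for f
    using clark_calculus_transform[OF \<psi>(1) that] L[OF that] by simp
  then have ap: "appl ?B (V f) = V (\<lambda>x. \<psi> x * f x)" if "f \<in> L2 \<mu>" for f
    using that by (simp add: appl_def)
  have surj: "\<exists>f\<in>L2 \<mu>. V f = g" if "g \<in> model_space u" for g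
    using clark_transform_surj[OF that] by metis
  have dom: "dom ?B = model_space u"
  proof
    show "dom ?B \<subseteq> model_space u" by (auto simp: clark_calculus_def split: if_splits)
    show "model_space u \<subseteq> dom ?B" using surj val by (force simp: domIff)
  qed
  have ran: "ran ?B \<subseteq> model_space u"
  proof
    fix h assume "h \<in> ran ?B"
    then obtain g where "?B g = Some h" by (auto simp: ran_def)
    moreover from this have "g \<in> dom ?B" by auto
    then obtain f where "f \<in> L2 \<mu>" "g = V f" using dom surj by auto
    ultimately show "h \<in> model_space u" using val[of f] L[of f] clark_transform_in_model_space by auto
  qed
  have add: "appl ?B (\<lambda>z. f z + g z) = (\<lambda>z. appl ?B f z + appl ?B g z)"
    if m: "f \<in> model_space u" "g \<in> model_space u" for f g
  proof -
    obtain a where a: "a \<in> L2 \<mu>" "V a = f" using surj[OF m(1)] by blast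
    obtain b where b: "b \<in> L2 \<mu>" "V b = g" using surj[OF m(2)] by blast
    have "appl ?B (V (\<lambda>x. a x + b x)) = V (\<lambda>x. \<psi> x * (a x + b x))"
      by (rule ap[OF L2_add[OF a(1) b(1)]])
    also have "\<dots> = (\<lambda>z. appl ?B (V a) z + appl ?B (V b) z)"
      by (simp only: distrib_left clark_transform_add L a(1) b(1) ap)
    finally show ?thesis by (simp only: clark_transform_add a b)
  qed
  have scale: "appl ?B (\<lambda>z. c * f z) = (\<lambda>z. c * appl ?B f z)" if m: "f \<in> model_space u" for c f
  proof -
    obtain a where a: "a \<in> L2 \<mu>" "V a = f" using surj[OF m] by blast
    have "appl ?B (V (\<lambda>x. c * a x)) = V (\<lambda>x. \<psi> x * (c * a x))"
      by (rule ap[OF L2_cmult[OF a(1)]])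
    also have "\<dots> = (\<lambda>z. c * appl ?B (V a) z)"
      by (simp only: mult.left_commute[of _ c] clark_transform_cmult ap a(1))
    finally show ?thesis by (simp only: clark_transform_cmult a)
  qed
  \<comment> \<open>\<open>max C 0\<close> is taken because the norm bound for multiplication asks
    for a nonnegative constant and \<open>C\<close> carries no sign.\<close>
  have bound: "H2_norm (appl ?B g) \<le> max C 0 * H2_norm g" if m: "g \<in> model_space u" for g
  proof -
    obtain a where a: "a \<in> L2 \<mu>" "V a = g" using surj[OF m] by blast
    have "AE s in \<mu>. cmod (\<psi> s) \<le> max C 0" using \<psi>(2) by eventually_elim simp
    from L2_mult_bounded(2)[OF a(1) \<psi>(1) this] have "L2_norm \<mu> (\<lambda>x. \<psi> x * a x) \<le> max C 0 * L2_norm \<mu> a"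
      by simp
    then show ?thesis using a by (auto simp: ap clark_transform_norm L)
  qed
  have "linear_operator (model_space u) ?B"
    unfolding linear_operator_def dom
    by (intro conjI allI ballI subset_refl ran add scale model_space_zero[OF inner]
        model_space_add[OF inner] model_space_cmult[OF inner])
  then show ?thesis unfolding bounded_operator_def using dom bound by blast
qed

text \<open>Off the essential range, \<open>\<Phi>\<close> stays at distance \<open>e\<close> from 0
  almost everywhere. Thus \<open>\<Psi>\<close> is essentially bounded by \<open>1 / e\<close> and
  is the reciprocal of \<open>\<Phi>\<close> off a null set, so multiplying by \<open>\<Psi>\<close>
  lands in the domain of multiplication by \<open>\<Phi>\<close>.\<close>

lemma clark_calculus_bounded_inverse:
  fixes \<Phi> \<Psi> :: "complex \<Rightarrow> real"
  assumes \<Phi>: "\<Phi> \<in> borel_measurable \<mu>" and \<Psi>: "\<And>s. \<Psi> s = (if \<Phi> s \<noteq> 0 then 1 / \<Phi> s else 0)"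
    and ess: "0 \<notin> essential_range \<mu> (\<lambda>s. complex_of_real (\<Phi> s))"
  shows "is_bounded_inverse (model_space u) (clark_calculus u \<alpha> \<mu> (\<lambda>s. complex_of_real (\<Phi> s)))
    (clark_calculus u \<alpha> \<mu> (\<lambda>s. complex_of_real (\<Psi> s)))"
proof -
  let ?\<phi> = "\<lambda>s. complex_of_real (\<Phi> s)" and ?\<psi> = "\<lambda>s. complex_of_real (\<Psi> s)"
  let ?A = "clark_calculus u \<alpha> \<mu> ?\<phi>" and ?B = "clark_calculus u \<alpha> \<mu> ?\<psi>"
  note [measurable] = \<Phi>
  have \<phi>: "?\<phi> \<in> borel_measurable \<mu>" by measurable
  have "\<Psi> = (\<lambda>s. if \<Phi> s \<noteq> 0 then 1 / \<Phi> s else 0)" using \<Psi> by auto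
  then have [measurable]: "\<Psi> \<in> borel_measurable \<mu>" by (simp only:) measurable
  have \<psi>: "?\<psi> \<in> borel_measurable \<mu>" by measurable
  obtain e where e: "e > 0" "measure \<mu> {s \<in> sphere 0 1. \<bar>\<Phi> s\<bar> < e} = 0"
    using ess unfolding essential_range_def by (auto simp: zero_less_measure_iff not_less)
  have "{s \<in> space \<mu>. \<bar>\<Phi> s\<bar> < e} \<in> sets \<mu>" by measurable
  then have ge: "AE s in \<mu>. \<not> \<bar>\<Phi> s\<bar> < e" using e AE_iff_measure_0 by simp
  have bound: "AE s in \<mu>. cmod (?\<psi> s) \<le> 1 / e"
    using ge by eventually_elim (use e in \<open>auto simp: \<Psi> frac_le\<close>)
  have inv: "AE s in \<mu>. ?\<phi> s * (?\<psi> s * f s) = f s" "AE s in \<mu>. ?\<psi> s * (?\<phi> s * f s) = f s" for f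
    using ge by (eventually_elim, use e in \<open>auto simp: \<Psi>\<close>)+
  note L = L2_mult_bounded(1)[OF _ \<psi> bound]
  have Bval: "?B (V f) = Some (V (\<lambda>x. ?\<psi> x * f x))" if "f \<in> L2 \<mu>" for f
    using clark_calculus_transform[OF \<psi> that] L[OF that] by simp
  have AB: "?A (V (\<lambda>x. ?\<psi> x * f x)) = Some (V f)" if f: "f \<in> L2 \<mu>" for f
  proof -
    note [measurable] = L2_measurable[OF f]
    have L': "(\<lambda>x. ?\<phi> x * (?\<psi> x * f x)) \<in> L2 \<mu>"
      by (rule L2_cong_AE[OF f _ inv(1)]) measurable
    then have "V (\<lambda>x. ?\<phi> x * (?\<psi> x * f x)) = V f" using clark_transform_eq_iff f inv(1) by blast
    then show ?thesis using clark_calculus_transform[OF \<phi> L[OF f]] L' by simp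
  qed
  have BA: "?B (V (\<lambda>x. ?\<phi> x * f x)) = Some (V f)" if f: "f \<in> L2 \<mu>" "(\<lambda>x. ?\<phi> x * f x) \<in> L2 \<mu>" for f
    using Bval[OF f(2)] clark_transform_eq_iff[OF L[OF f(2)] f(1)] inv(2) by simp
  have surj: "\<exists>f\<in>L2 \<mu>. V f = g" if "g \<in> model_space u" for g
    using clark_transform_surj[OF that] by metis
  have "(?A \<circ>\<^sub>m ?B) g = (Some |` model_space u) g" for g
  proof (cases "g \<in> model_space u")
    case True
    then obtain f where "f \<in> L2 \<mu>" "V f = g" using surj by blast
    then show ?thesis using True Bval[of f] AB[of f] by (simp add: map_comp_def)
  qed (simp add: clark_calculus_outside map_comp_def)
  moreover have "(?B \<circ>\<^sub>m ?A) g = (Some |` dom ?A) g" for g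
  proof (cases "g \<in> dom ?A")
    case True
    then obtain f where "f \<in> L2 \<mu>" "g = V f" "(\<lambda>x. ?\<phi> x * f x) \<in> L2 \<mu>"
      "?A g = Some (V (\<lambda>x. ?\<phi> x * f x))" by (rule clark_calculus_cases[OF \<phi>])
    then show ?thesis using True BA[of f] by (simp add: map_comp_def)
  qed (simp add: map_comp_def domIff)
  moreover have "appl ?B g \<in> dom ?A" if g: "g \<in> dom ?A" for g
  proof -
    obtain f where "f \<in> L2 \<mu>" "g = V f" using clark_calculus_cases[OF \<phi> g] by metis
    then show ?thesis using Bval[of f] AB[of f] by (auto simp: appl_def)
  qed
  ultimately show ?thesis
    unfolding is_bounded_inverse_def using clark_calculus_bounded[OF \<psi> bound] by blast
qed

text \<open>The indicator of the set where \<open>\<phi>\<close> is small is nearly annihilated by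
  the operator, which contradicts a bound \<open>C\<close> for the inverse.\<close>

lemma bounded_inverse_imp_notin_essential_range:
  assumes \<phi>: "\<phi> \<in> borel_measurable \<mu>"
    and inv: "has_bounded_inverse (model_space u) (clark_calculus u \<alpha> \<mu> \<phi>)"
  shows "0 \<notin> essential_range \<mu> \<phi>"
proof
  assume ess: "0 \<in> essential_range \<mu> \<phi>"
  let ?A = "clark_calculus u \<alpha> \<mu> \<phi>"
  obtain B where B: "is_bounded_inverse (model_space u) ?A B"
    using inv by (auto simp: has_bounded_inverse_def)
  then obtain C where C: "\<And>g. g \<in> model_space u \<Longrightarrow> H2_norm (appl B g) \<le> C * H2_norm g"
    unfolding is_bounded_inverse_def bounded_operator_def by blast
  \<comment> \<open>Chosen so that \<open>\<bar>C\<bar> * e < 1\<close> for every real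
    \<open>C\<close>, including 0.\<close>
  define e where "e = 1 / (2 * (\<bar>C\<bar> + 1))"
  have e: "e > 0" "\<bar>C\<bar> * e < 1" by (auto simp: e_def field_simps)
  define S where "S = {s \<in> sphere 0 1. cmod (\<phi> s) < e}"
  have pos: "measure \<mu> S > 0" using ess e(1) unfolding essential_range_def S_def by auto
  note [measurable] = \<phi>
  have S_space: "S = {s \<in> space \<mu>. cmod (\<phi> s) < e}" by (simp add: S_def)
  have [measurable]: "S \<in> sets \<mu>" unfolding S_space by measurable
  define f where "f s = complex_of_real (indicator S s)" for s
  have [measurable]: "f \<in> borel_measurable \<mu>" unfolding f_def by measurable
  have f: "f \<in> L2 \<mu>"
    by (rule L2_bounded_by[of _ _ "\<lambda>_. 1"]) (auto simp: f_def split: split_indicator)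
  have norm_f: "L2_norm \<mu> f > 0"
  proof -
    have "(LINT s|\<mu>. (cmod (f s))\<^sup>2) = (LINT s|\<mu>. indicator S s)"
      by (rule Bochner_Integration.integral_cong) (auto simp: f_def split: split_indicator)
    also have "\<dots> = measure \<mu> S"
      using S_space by (simp add: Int_absorb2 subset_iff)
    finally show ?thesis using pos by (simp add: L2_norm_def)
  qed
  \<comment> \<open>\<open>\<phi>\<close> may be unbounded; cut off to \<open>S\<close> it is
    bounded by \<open>e\<close>, and on the support of \<open>f\<close> nothing changes.\<close>
  define h where "h s = \<phi> s * indicator S s" for s
  have "h \<in> borel_measurable \<mu>" unfolding h_def by measurable
  moreover have "AE s in \<mu>. cmod (h s) \<le> e"
    by (rule AE_I2) (use e(1) in \<open>auto simp: h_def S_def split: split_indicator\<close>)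
  ultimately have h: "h \<in> borel_measurable \<mu>" "AE s in \<mu>. cmod (h s) \<le> e" .
  have \<phi>f: "(\<lambda>s. \<phi> s * f s) = (\<lambda>s. h s * f s)"
    by (auto simp: f_def h_def split: split_indicator)
  have \<phi>f_L2: "(\<lambda>s. \<phi> s * f s) \<in> L2 \<mu>" unfolding \<phi>f by (rule L2_mult_bounded(1)[OF f h])
  have val: "?A (V f) = Some (V (\<lambda>s. \<phi> s * f s))"
    using clark_calculus_transform[OF \<phi> f] \<phi>f_L2 by simp
  have "(B \<circ>\<^sub>m ?A) (V f) = Some (V f)"
    using B val by (auto simp: is_bounded_inverse_def restrict_map_def)
  then have "appl B (V (\<lambda>s. \<phi> s * f s)) = V f" using val by (simp add: map_comp_def appl_def)
  then have "L2_norm \<mu> f \<le> C * L2_norm \<mu> (\<lambda>s. \<phi> s * f s)"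
    using C[OF clark_transform_in_model_space[OF \<phi>f_L2]] f \<phi>f_L2 by (simp add: clark_transform_norm)
  also have "\<dots> \<le> \<bar>C\<bar> * L2_norm \<mu> (\<lambda>s. \<phi> s * f s)" by (intro mult_right_mono) auto
  also have "\<dots> \<le> \<bar>C\<bar> * (e * L2_norm \<mu> f)"
    unfolding \<phi>f using e(1) by (intro mult_left_mono L2_mult_bounded(2)[OF f h]) auto
  also have "\<dots> < 1 * L2_norm \<mu> f"
    unfolding mult.assoc [symmetric] using e(2) norm_f by (intro mult_strict_right_mono)
  finally show False by simp
qed

text \<open>Injectivity of \<open>V\<close> turns the eigenvalue equation into
  \<open>\<phi> s * f s = c * f s\<close> almost everywhere.\<close>

lemma clark_calculus_eigenspace:
  assumes \<phi>: "\<phi> \<in> borel_measurable \<mu>"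
  shows "eigenspace (clark_calculus u \<alpha> \<mu> \<phi>) c = V ` {f \<in> L2 \<mu>. AE s in \<mu>. \<phi> s \<noteq> c \<longrightarrow> f s = 0}"
proof
  let ?A = "clark_calculus u \<alpha> \<mu> \<phi>"
  show "eigenspace ?A c \<subseteq> V ` {f \<in> L2 \<mu>. AE s in \<mu>. \<phi> s \<noteq> c \<longrightarrow> f s = 0}"
  proof
    fix g assume "g \<in> eigenspace ?A c"
    then have g: "g \<in> dom ?A" "appl ?A g = (\<lambda>z. c * g z)" by (auto simp: eigenspace_def)
    then obtain f where f: "f \<in> L2 \<mu>" "g = V f" "(\<lambda>s. \<phi> s * f s) \<in> L2 \<mu>"
      "?A g = Some (V (\<lambda>s. \<phi> s * f s))" using clark_calculus_cases[OF \<phi>] by metis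
    have "V (\<lambda>s. \<phi> s * f s) = V (\<lambda>s. c * f s)"
      using g(2) f(2,4) by (simp add: appl_def clark_transform_cmult)
    then have "AE s in \<mu>. \<phi> s * f s = c * f s"
      using clark_transform_eq_iff[OF f(3) L2_cmult[OF f(1)]] by blast
    then have "AE s in \<mu>. \<phi> s \<noteq> c \<longrightarrow> f s = 0" by eventually_elim auto
    then show "g \<in> V ` {f \<in> L2 \<mu>. AE s in \<mu>. \<phi> s \<noteq> c \<longrightarrow> f s = 0}" using f by blast
  qed
  show "V ` {f \<in> L2 \<mu>. AE s in \<mu>. \<phi> s \<noteq> c \<longrightarrow> f s = 0} \<subseteq> eigenspace ?A c"
  proof
    fix g assume "g \<in> V ` {f \<in> L2 \<mu>. AE s in \<mu>. \<phi> s \<noteq> c \<longrightarrow> f s = 0}"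
    then obtain f where f: "f \<in> L2 \<mu>" "g = V f" and z: "AE s in \<mu>. \<phi> s \<noteq> c \<longrightarrow> f s = 0" by blast
    note [measurable] = \<phi> L2_measurable[OF f(1)]
    have eq: "AE s in \<mu>. \<phi> s * f s = c * f s" using z by eventually_elim auto
    have L: "(\<lambda>s. \<phi> s * f s) \<in> L2 \<mu>"
      by (rule L2_cong_AE[OF L2_cmult[OF f(1)] _ eq]) measurable
    have "V (\<lambda>s. \<phi> s * f s) = V (\<lambda>s. c * f s)"
      using clark_transform_eq_iff[OF L L2_cmult[OF f(1)]] eq by blast
    then show "g \<in> eigenspace ?A c"
      using clark_calculus_transform[OF \<phi> f(1)] L f(2)
      by (auto simp: eigenspace_def appl_def clark_transform_cmult)
  qed
qed

lemma clark_calculus_eigenvalue_iff: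
  assumes \<phi>: "\<phi> \<in> borel_measurable \<mu>"
  shows "c \<in> eigenvalues (clark_calculus u \<alpha> \<mu> \<phi>) \<longleftrightarrow> measure \<mu> {s \<in> sphere 0 1. \<phi> s = c} > 0"
proof -
  note [measurable] = \<phi>
  define S where "S = {s \<in> sphere 0 1. \<phi> s = c}"
  have S_space: "S = {s \<in> space \<mu>. \<phi> s = c}" by (simp add: S_def)
  have [measurable]: "S \<in> sets \<mu>" unfolding S_space by measurable
  have null: "(AE s in \<mu>. \<phi> s \<noteq> c) \<longleftrightarrow> measure \<mu> S = 0"
    using \<open>S \<in> sets \<mu>\<close> unfolding S_def by (rule AE_iff_measure_0)
  have "c \<in> eigenvalues (clark_calculus u \<alpha> \<mu> \<phi>) \<longleftrightarrow>
      (\<exists>f\<in>L2 \<mu>. (AE s in \<mu>. \<phi> s \<noteq> c \<longrightarrow> f s = 0) \<and> \<not> (AE s in \<mu>. f s = 0))"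
    unfolding eigenvalues_def clark_calculus_eigenspace[OF \<phi>] using clark_transform_eq_0_iff by auto
  also have "\<dots> \<longleftrightarrow> \<not> (AE s in \<mu>. \<phi> s \<noteq> c)"
  proof
    assume "\<exists>f\<in>L2 \<mu>. (AE s in \<mu>. \<phi> s \<noteq> c \<longrightarrow> f s = 0) \<and> \<not> (AE s in \<mu>. f s = 0)"
    then obtain f where "f \<in> L2 \<mu>"
      and f: "AE s in \<mu>. \<phi> s \<noteq> c \<longrightarrow> f s = 0" "\<not> (AE s in \<mu>. f s = 0)" by blast
    show "\<not> (AE s in \<mu>. \<phi> s \<noteq> c)"
    proof
      assume "AE s in \<mu>. \<phi> s \<noteq> c"
      with f(1) have "AE s in \<mu>. f s = 0" by eventually_elim simp
      with f(2) show False by simp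
    qed
  next
    assume nn: "\<not> (AE s in \<mu>. \<phi> s \<noteq> c)"
    \<comment> \<open>If the level set is not null, its indicator is an eigenfunction that is
      nonzero in \<open>L2 \<mu>\<close>.\<close>
    define f where "f s = complex_of_real (indicator S s)" for s
    have f: "f \<in> L2 \<mu>"
      by (rule L2_bounded_by[of _ _ "\<lambda>_. 1"]) (auto simp: f_def[abs_def] split: split_indicator)
    have "AE s in \<mu>. \<phi> s \<noteq> c \<longrightarrow> f s = 0"
      by (rule AE_I2) (auto simp: f_def S_def split: split_indicator)
    moreover have "\<not> (AE s in \<mu>. f s = 0)"
    proof
      assume "AE s in \<mu>. f s = 0"
      moreover have "AE s in \<mu>. s \<in> space \<mu>" by (rule AE_space)
      ultimately have "AE s in \<mu>. \<phi> s \<noteq> c"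
        by eventually_elim (auto simp: f_def S_def split: split_indicator_asm)
      with nn show False by simp
    qed
    ultimately show "\<exists>f\<in>L2 \<mu>. (AE s in \<mu>. \<phi> s \<noteq> c \<longrightarrow> f s = 0) \<and> \<not> (AE s in \<mu>. f s = 0)" using f by blast
  qed
  also have "\<dots> \<longleftrightarrow> measure \<mu> S > 0"
    unfolding null by (simp add: zero_less_measure_iff)
  finally show ?thesis by (simp add: S_def)
qed

end

theorem proposition6p2:
  fixes u :: "complex \<Rightarrow> complex" and \<alpha> :: complex and \<mu> :: "complex measure"
    and A :: operator and \<Phi> \<Psi> :: "complex \<Rightarrow> real"
  assumes "inner_function u" and "\<not> u constant_on ball 0 1"
    and "\<alpha> \<in> sphere 0 1"
    and "clark_measure u \<alpha> \<mu>"
    and "linear_operator (model_space u) A"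
    and "densely_defined (model_space u) A"
    and "closed_operator (model_space u) A"
    and "self_adjoint (model_space u) A"
    and "commutes_with A (clark_unitary u \<alpha>)"
    and "\<Phi> \<in> borel_measurable borel_circle"
    and "A = clark_calculus u \<alpha> \<mu> (\<lambda>s. complex_of_real (\<Phi> s))"
    and "\<And>s. \<Psi> s = (if \<Phi> s \<noteq> 0 then 1 / \<Phi> s else 0)"
  shows "(has_bounded_inverse (model_space u) A \<longleftrightarrow>
            0 \<notin> essential_range \<mu> (\<lambda>s. complex_of_real (\<Phi> s))) \<and>
         (has_bounded_inverse (model_space u) A \<longrightarrow>
            (\<forall>B. is_bounded_inverse (model_space u) A B \<longleftrightarrow>
                 B = clark_calculus u \<alpha> \<mu> (\<lambda>s. complex_of_real (\<Psi> s)))) \<and>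
         eigenvalues A =
            complex_of_real ` {l. measure \<mu> {s \<in> sphere 0 1. \<Phi> s = l} > 0} \<and>
         (\<forall>l::real. complex_of_real l \<in> eigenvalues A \<longrightarrow>
            eigenspace A (complex_of_real l) =
            clark_transform u \<alpha> \<mu> ` {f \<in> L2 \<mu>. AE s in \<mu>. \<Phi> s \<noteq> l \<longrightarrow> f s = 0})"
proof -
  interpret clark u \<alpha> \<mu>
    using assms(1-4) by unfold_locales auto
  let ?\<phi> = "\<lambda>s. complex_of_real (\<Phi> s)"
  have \<Phi>: "\<Phi> \<in> borel_measurable \<mu>" using assms(10) by (rule measurable_M)
  then have \<phi>: "?\<phi> \<in> borel_measurable \<mu>" by measurable
  note A = assms(11)
  have inverse: "is_bounded_inverse (model_space u) A (clark_calculus u \<alpha> \<mu> (\<lambda>s. complex_of_real (\<Psi> s)))"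
    if "0 \<notin> essential_range \<mu> ?\<phi>"
    unfolding A by (rule clark_calculus_bounded_inverse[OF \<Phi> assms(12) that])
  have iff: "has_bounded_inverse (model_space u) A \<longleftrightarrow> 0 \<notin> essential_range \<mu> ?\<phi>"
    using bounded_inverse_imp_notin_essential_range[OF \<phi>] inverse
    unfolding A has_bounded_inverse_def by blast
  \<comment> \<open>The equivalence over all \<open>B\<close> expresses that the calculus of
    \<open>\<Psi>\<close> is an inverse and the only one.\<close>
  have unique: "\<forall>B. is_bounded_inverse (model_space u) A B \<longleftrightarrow>
      B = clark_calculus u \<alpha> \<mu> (\<lambda>s. complex_of_real (\<Psi> s))" if "has_bounded_inverse (model_space u) A"
    using inverse bounded_inverse_unique that iff by blast
  have "eigenvalues A = complex_of_real ` {l. measure \<mu> {s \<in> sphere 0 1. \<Phi> s = l} > 0}"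
  proof (rule set_eqI)
    fix c
    show "c \<in> eigenvalues A \<longleftrightarrow> c \<in> complex_of_real ` {l. measure \<mu> {s \<in> sphere 0 1. \<Phi> s = l} > 0}"
    proof (cases "c \<in> \<real>")
      case True
      then obtain l where "c = complex_of_real l" by (auto elim: Reals_cases)
      then show ?thesis unfolding A clark_calculus_eigenvalue_iff[OF \<phi>] by auto
    next
      case False
      \<comment> \<open>\<open>\<Phi>\<close> is real-valued, so a nonreal \<open>c\<close> has an
        empty level set and is no eigenvalue.\<close>
      then have "{s \<in> sphere 0 1. complex_of_real (\<Phi> s) = c} = {}" by auto
      then have "c \<notin> eigenvalues A" unfolding A clark_calculus_eigenvalue_iff[OF \<phi>] by (simp only:) simp
      then show ?thesis using False by auto
    qed
  qed
  moreover have "eigenspace A (complex_of_real l) =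
      clark_transform u \<alpha> \<mu> ` {f \<in> L2 \<mu>. AE s in \<mu>. \<Phi> s \<noteq> l \<longrightarrow> f s = 0}" for l
    unfolding A clark_calculus_eigenspace[OF \<phi>] by simp
  ultimately show ?thesis using iff unique by blast
qed

end
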